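(* Let $M$ be a metric space such that for every separable Banach space $Z$ whose dual $Z^*$ is nonseparable, $M$ admits a bilipschitz embedding into $Z^*$. Then for every non-superreflexive Banach space $X$, the finite subsets of $M$ embed into $X$ with uniformly bounded distortions; that is, there is a constant $C<\infty$ such that every finite subset of $M$ (with the induced metric) admits a bilipschitz embedding into $X$ with distortion at most $C$.
   Context: A map $f:(A,d_A)\to (Y,d_Y)$ between metric spaces is a bilipschitz embedding with distortion at most $C$ if there is $r>0$ such that $r\,d_A(u,v)\le d_Y(f(u),f(v))\le rC\,d_A(u,v)$ for all $u,v\in A$; it is a bilipschitz embedding if this holds for some $C<\infty$. Banach spaces are regarded as metric spaces with the metric induced by the norm. A Banach space $X$ is superreflexive if every Banach space finitely representable in $X$ is reflexive, and non-superreflexive otherwise. Here $Y$ is finitely representable in $X$ if for every $\varepsilon>0$ and every finite-dimensional subspace $F\subset Y$ there is a finite-dimensional subspace $G\subset X$ with $d(F,G)<1+\varepsilon$, where $d$ is the Banach-Mazur distance. *)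

theory Defs
  imports "HOL-Analysis.Analysis" "HOL-Library.Function_Algebras" "HOL-Library.Nat_Bijection"
begin

text \<open>
  Functions into a real vector space form a real vector space under pointwise operations, so
  that sequences, functionals, and functionals on functionals are all covered.
\<close>

instantiation "fun" :: (type, real_vector) real_vector
begin

definition "scaleR c f = (\<lambda>x. c *\<^sub>R f x)"

instance
  by standard (auto simp: fun_eq_iff scaleR_fun_def scaleR_add_right scaleR_add_left)

end

lemma scaleR_fun_apply [simp]: "(c *\<^sub>R f) x = c *\<^sub>R f x"
  by (simp add: scaleR_fun_def)


section \<open>Real normed spaces with an explicit carrier\<close>

text \<open>
  Statements that quantify over Banach spaces inside a formula cannot use the class
  \<^class>\<open>banach\<close>. Here a normed space is a linear subspace of an ambient real vector space
  together with a norm on it. The ambient type supplies only the linear structure (the norm is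
  unrelated to any topology on it), and values of the norm off the carrier are irrelevant.
\<close>

record 'a nspace =
  vecs :: "'a set"
  nrm :: "'a \<Rightarrow> real"

definition normed_space :: "'a::real_vector nspace \<Rightarrow> bool" where
  "normed_space E \<longleftrightarrow>
     subspace (vecs E) \<and>
     (\<forall>x\<in>vecs E. 0 \<le> nrm E x \<and> (nrm E x = 0 \<longleftrightarrow> x = 0)) \<and>
     (\<forall>x\<in>vecs E. \<forall>c. nrm E (c *\<^sub>R x) = \<bar>c\<bar> * nrm E x) \<and>
     (\<forall>x\<in>vecs E. \<forall>y\<in>vecs E. nrm E (x + y) \<le> nrm E x + nrm E y)"

text \<open>
  The metric induced by the norm. The value 0 off the carrier is there only because
  \<^locale>\<open>Metric_space\<close> requires nonnegativity and symmetry on the whole type.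
\<close>

definition norm_dist :: "'a::real_vector nspace \<Rightarrow> 'a \<Rightarrow> 'a \<Rightarrow> real" where
  "norm_dist E x y = (if x \<in> vecs E \<and> y \<in> vecs E then nrm E (x - y) else 0)"

definition norm_metric :: "'a::real_vector nspace \<Rightarrow> 'a metric" where
  "norm_metric E = metric (vecs E, norm_dist E)"

definition banach_space :: "'a::real_vector nspace \<Rightarrow> bool" where
  "banach_space E \<longleftrightarrow> normed_space E \<and> mcomplete_of (norm_metric E)"

definition separable :: "'a::real_vector nspace \<Rightarrow> bool" where
  "separable E \<longleftrightarrow> separable_space (mtopology_of (norm_metric E))"


section \<open>Operators, duals, reflexivity\<close>

definition bounded_op ::
  "'a::real_vector nspace \<Rightarrow> 'b::real_vector nspace \<Rightarrow> ('a \<Rightarrow> 'b) \<Rightarrow> bool" where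
  "bounded_op E F T \<longleftrightarrow>
     T ` vecs E \<subseteq> vecs F \<and>
     (\<forall>x\<in>vecs E. \<forall>y\<in>vecs E. T (x + y) = T x + T y) \<and>
     (\<forall>c. \<forall>x\<in>vecs E. T (c *\<^sub>R x) = c *\<^sub>R T x) \<and>
     (\<exists>K. \<forall>x\<in>vecs E. nrm F (T x) \<le> K * nrm E x)"

definition op_norm :: "'a nspace \<Rightarrow> 'b nspace \<Rightarrow> ('a \<Rightarrow> 'b) \<Rightarrow> real" where
  "op_norm E F T = (SUP x\<in>{x \<in> vecs E. nrm E x \<le> 1}. nrm F (T x))"

definition real_line :: "real nspace" where
  "real_line = \<lparr>vecs = UNIV, nrm = abs\<rparr>"

text \<open>
  Functionals are extended by 0 off the carrier, so that distinct elements of the dual are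
  distinct functionals on the carrier.
\<close>

definition dual :: "'a::real_vector nspace \<Rightarrow> ('a \<Rightarrow> real) nspace" where
  "dual E = \<lparr>vecs = {f. bounded_op E real_line f \<and> (\<forall>x. x \<notin> vecs E \<longrightarrow> f x = 0)},
             nrm = op_norm E real_line\<rparr>"

text \<open>Surjectivity of the canonical embedding into the bidual.\<close>

definition reflexive_space :: "'a::real_vector nspace \<Rightarrow> bool" where
  "reflexive_space E \<longleftrightarrow>
     (\<forall>\<Phi>\<in>vecs (dual (dual E)). \<exists>x\<in>vecs E. \<forall>f\<in>vecs (dual E). \<Phi> f = f x)"


section \<open>Finite representability and superreflexivity\<close>

definition isomorphisms ::
  "'a::real_vector nspace \<Rightarrow> 'b::real_vector nspace \<Rightarrow> ('a \<Rightarrow> 'b) set" where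
  "isomorphisms E F =
     {T. bij_betw T (vecs E) (vecs F) \<and> bounded_op E F T \<and>
         bounded_op F E (inv_into (vecs E) T)}"

text \<open>The infimum is \<open>\<infinity>\<close> if the spaces are not isomorphic.\<close>

definition banach_mazur ::
  "'a::real_vector nspace \<Rightarrow> 'b::real_vector nspace \<Rightarrow> ereal" where
  "banach_mazur E F =
     (INF T\<in>isomorphisms E F. ereal (op_norm E F T * op_norm F E (inv_into (vecs E) T)))"

definition fin_dim_subspaces :: "'a::real_vector nspace \<Rightarrow> 'a nspace set" where
  "fin_dim_subspaces E =
     {\<lparr>vecs = span B, nrm = nrm E\<rparr> | B. finite B \<and> span B \<subseteq> vecs E}"

definition finitely_representable ::
  "'b::real_vector nspace \<Rightarrow> 'a::real_vector nspace \<Rightarrow> bool" where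
  "finitely_representable Y X \<longleftrightarrow>
     (\<forall>\<epsilon>>0. \<forall>F\<in>fin_dim_subspaces Y. \<exists>G\<in>fin_dim_subspaces X.
        banach_mazur F G < ereal (1 + \<epsilon>))"

text \<open>
  The type argument is the ambient type of the spaces \<open>Y\<close>. Superreflexivity of \<open>X\<close> is
  \<open>superreflexive TYPE('y) X\<close> for all \<open>'y\<close>. Hence an assumption
  \<open>\<not> superreflexive TYPE('y) X\<close> with \<open>'y\<close> a type variable of the theorem, occurring nowhere else,
  says that \<open>X\<close> is non-superreflexive: some nonreflexive Banach space over some type is finitely
  representable in \<open>X\<close>.
\<close>

definition superreflexive :: "'b::real_vector itself \<Rightarrow> 'a::real_vector nspace \<Rightarrow> bool" where
  "superreflexive _ X \<longleftrightarrow>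
     (\<forall>Y::'b nspace. banach_space Y \<and> finitely_representable Y X \<longrightarrow> reflexive_space Y)"


section \<open>Bilipschitz embeddings\<close>

definition bilipschitz_embedding ::
  "real \<Rightarrow> 'a metric \<Rightarrow> 'b metric \<Rightarrow> ('a \<Rightarrow> 'b) \<Rightarrow> bool" where
  "bilipschitz_embedding C A Y f \<longleftrightarrow>
     f ` mspace A \<subseteq> mspace Y \<and>
     (\<exists>r>0. \<forall>u\<in>mspace A. \<forall>v\<in>mspace A.
        r * mdist A u v \<le> mdist Y (f u) (f v) \<and>
        mdist Y (f u) (f v) \<le> r * C * mdist A u v)"


section \<open>Basic facts\<close>

lemma
  assumes "normed_space E" "x \<in> vecs E"
  shows normed_space_nonneg: "0 \<le> nrm E x"
    and normed_space_eq_0: "nrm E x = 0 \<longleftrightarrow> x = 0"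
    and normed_space_scaleR: "nrm E (c *\<^sub>R x) = \<bar>c\<bar> * nrm E x"
    and normed_space_triangle: "y \<in> vecs E \<Longrightarrow> nrm E (x + y) \<le> nrm E x + nrm E y"
  using assms by (simp_all add: normed_space_def)

lemma normed_space_subspace: "normed_space E \<Longrightarrow> subspace (vecs E)"
  by (simp add: normed_space_def)

lemma Metric_space_norm_dist:
  assumes "normed_space E"
  shows "Metric_space (vecs E) (norm_dist E)"
proof -
  have sub: "subspace (vecs E)" using assms by (simp add: normed_space_def)
  have diff: "x - y \<in> vecs E" if "x \<in> vecs E" "y \<in> vecs E" for x y
    using sub that by (rule subspace_diff)
  have sym: "nrm E (x - y) = nrm E (y - x)" if "x \<in> vecs E" "y \<in> vecs E" for x y
  proof -
    have "nrm E ((-1) *\<^sub>R (x - y)) = \<bar>-1\<bar> * nrm E (x - y)"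
      by (rule normed_space_scaleR[OF assms diff[OF that]])
    then show ?thesis by simp
  qed
  have tri: "nrm E (x - z) \<le> nrm E (x - y) + nrm E (y - z)"
    if "x \<in> vecs E" "y \<in> vecs E" "z \<in> vecs E" for x y z
  proof -
    have "nrm E ((x - y) + (y - z)) \<le> nrm E (x - y) + nrm E (y - z)"
      by (rule normed_space_triangle[OF assms]) (use diff that in simp_all)
    then show ?thesis by simp
  qed
  show ?thesis
  proof
    fix x y
    show "0 \<le> norm_dist E x y"
      using normed_space_nonneg[OF assms diff] by (simp add: norm_dist_def)
    show "norm_dist E x y = norm_dist E y x"
      using sym by (simp add: norm_dist_def)
    assume "x \<in> vecs E" "y \<in> vecs E"
    then show "norm_dist E x y = 0 \<longleftrightarrow> x = y"
      using normed_space_eq_0[OF assms diff] by (simp add: norm_dist_def)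
    fix z assume "z \<in> vecs E"
    with \<open>x \<in> vecs E\<close> \<open>y \<in> vecs E\<close> show "norm_dist E x z \<le> norm_dist E x y + norm_dist E y z"
      using tri by (simp add: norm_dist_def)
  qed
qed

lemma mspace_norm_metric [simp]: "normed_space E \<Longrightarrow> mspace (norm_metric E) = vecs E"
  by (simp add: norm_metric_def Metric_space.mspace_metric Metric_space_norm_dist)

lemma mdist_norm_metric:
  "\<lbrakk>normed_space E; x \<in> vecs E; y \<in> vecs E\<rbrakk> \<Longrightarrow> mdist (norm_metric E) x y = nrm E (x - y)"
  by (simp add: norm_metric_def Metric_space.mdist_metric Metric_space_norm_dist norm_dist_def)

lemma
  assumes "f \<in> vecs (dual E)"
  shows dual_add: "\<lbrakk>x \<in> vecs E; y \<in> vecs E\<rbrakk> \<Longrightarrow> f (x + y) = f x + f y"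
    and dual_scaleR: "x \<in> vecs E \<Longrightarrow> f (c *\<^sub>R x) = c * f x"
    and dual_bounded: "\<exists>K. \<forall>x\<in>vecs E. \<bar>f x\<bar> \<le> K * nrm E x"
    and dual_outside: "x \<notin> vecs E \<Longrightarrow> f x = 0"
  using assms by (simp_all add: dual_def bounded_op_def real_line_def)

lemma dualI:
  assumes "\<And>x y. \<lbrakk>x \<in> vecs E; y \<in> vecs E\<rbrakk> \<Longrightarrow> f (x + y) = f x + f y"
    and "\<And>c x. x \<in> vecs E \<Longrightarrow> f (c *\<^sub>R x) = c * f x"
    and "\<And>x. x \<in> vecs E \<Longrightarrow> \<bar>f x\<bar> \<le> K * nrm E x"
    and "\<And>x. x \<notin> vecs E \<Longrightarrow> f x = 0"
  shows "f \<in> vecs (dual E)"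
proof -
  have "\<exists>K. \<forall>x\<in>vecs E. \<bar>f x\<bar> \<le> K * nrm E x" using assms(3) by blast
  then show ?thesis using assms(1,2,4) by (simp add: dual_def bounded_op_def real_line_def)
qed

lemma dual_upper:
  assumes E: "normed_space E" and f: "f \<in> vecs (dual E)"
  shows "bdd_above ((\<lambda>x. \<bar>f x\<bar>) ` {x \<in> vecs E. nrm E x \<le> 1})"
proof -
  obtain K where K: "\<And>x. x \<in> vecs E \<Longrightarrow> \<bar>f x\<bar> \<le> K * nrm E x"
    using dual_bounded[OF f] by blast
  have "\<bar>f x\<bar> \<le> \<bar>K\<bar>" if "x \<in> vecs E" "nrm E x \<le> 1" for x
  proof -
    have "\<bar>f x\<bar> \<le> \<bar>K\<bar> * nrm E x"
      using K[OF that(1)] mult_right_mono[OF abs_ge_self normed_space_nonneg[OF E that(1)]]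
      by (rule order_trans)
    also have "\<dots> \<le> \<bar>K\<bar> * 1" by (rule mult_left_mono) (use that in auto)
    finally show ?thesis by simp
  qed
  then show ?thesis by (auto intro!: bdd_aboveI)
qed

lemma dual_norm_eq: "nrm (dual E) f = (SUP x\<in>{x \<in> vecs E. nrm E x \<le> 1}. \<bar>f x\<bar>)"
  by (simp add: dual_def op_norm_def real_line_def)

lemma dual_norm_bound:
  assumes E: "normed_space E" and f: "f \<in> vecs (dual E)" and x: "x \<in> vecs E"
  shows "\<bar>f x\<bar> \<le> nrm (dual E) f * nrm E x"
proof (cases "x = 0")
  case True
  have "f (0 *\<^sub>R x) = 0 * f x" by (rule dual_scaleR[OF f x])
  moreover have "nrm E 0 = 0" using E x True by (simp add: normed_space_def)
  ultimately show ?thesis using True by simp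
next
  case False
  then have pos: "nrm E x > 0" using normed_space_nonneg[OF E x] normed_space_eq_0[OF E x] by simp
  let ?y = "(1 / nrm E x) *\<^sub>R x"
  have y: "?y \<in> vecs E" using E x by (simp add: normed_space_def subspace_scale)
  have "nrm E ?y = 1" using normed_space_scaleR[OF E x, of "1 / nrm E x"] pos by simp
  then have "\<bar>f ?y\<bar> \<le> nrm (dual E) f"
    unfolding dual_norm_eq using y by (intro cSUP_upper dual_upper[OF E f]) auto
  moreover have "f ?y = f x / nrm E x"
    using dual_scaleR[OF f x] by simp
  ultimately show ?thesis using pos by (simp add: abs_divide pos_divide_le_eq)
qed

lemma normed_space_dual:
  assumes E: "normed_space E"
  shows "normed_space (dual E)"
proof -
  let ?U = "{x \<in> vecs E. nrm E x \<le> 1}"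
  have zU: "0 \<in> ?U"
    using subspace_0[OF normed_space_subspace[OF E]] normed_space_eq_0[OF E, of 0] by simp
  have nonneg: "0 \<le> nrm (dual E) f" if "f \<in> vecs (dual E)" for f
    unfolding dual_norm_eq
    by (rule cSUP_upper2[OF dual_upper[OF E that] zU]) simp
  have least: "nrm (dual E) f \<le> B" if "\<And>x. x \<in> ?U \<Longrightarrow> \<bar>f x\<bar> \<le> B" for f B
    unfolding dual_norm_eq using zU that by (intro cSUP_least) blast+
  have upper: "\<bar>f x\<bar> \<le> nrm (dual E) f" if "f \<in> vecs (dual E)" "x \<in> ?U" for f x
    unfolding dual_norm_eq using that by (intro cSUP_upper dual_upper[OF E]) auto
  have add: "f + g \<in> vecs (dual E)" if fg: "f \<in> vecs (dual E)" "g \<in> vecs (dual E)" for f g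
  proof -
    have K: "\<bar>(f + g) x\<bar> \<le> (nrm (dual E) f + nrm (dual E) g) * nrm E x" if "x \<in> vecs E" for x
      using dual_norm_bound[OF E fg(1) that] dual_norm_bound[OF E fg(2) that]
      by (simp add: distrib_right)
    show ?thesis
      by (rule dualI[OF _ _ K])
        (use fg in \<open>simp_all add: dual_add dual_scaleR dual_outside distrib_left\<close>)
  qed
  have scale: "c *\<^sub>R f \<in> vecs (dual E)" if f: "f \<in> vecs (dual E)" for c f
  proof -
    have K: "\<bar>(c *\<^sub>R f) x\<bar> \<le> (\<bar>c\<bar> * nrm (dual E) f) * nrm E x" if "x \<in> vecs E" for x
      using mult_left_mono[OF dual_norm_bound[OF E f that], of "\<bar>c\<bar>"]
      by (simp add: abs_mult mult.assoc)
    show ?thesis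
      by (rule dualI[OF _ _ K])
        (use f in \<open>simp_all add: dual_add dual_scaleR dual_outside distrib_left\<close>)
  qed
  have zero: "0 \<in> vecs (dual E)"
    by (rule dualI[where K = 0]) simp_all
  have def: "f = 0" if f: "f \<in> vecs (dual E)" and n: "nrm (dual E) f = 0" for f
  proof
    fix x
    show "f x = 0 x"
    proof (cases "x \<in> vecs E")
      case True
      then show ?thesis using dual_norm_bound[OF E f True] n by simp
    next
      case False
      then show ?thesis using dual_outside[OF f] by simp
    qed
  qed
  have n0: "nrm (dual E) 0 = 0"
    using nonneg[OF zero] least[of 0 0] by simp
  have le: "nrm (dual E) (c *\<^sub>R f) \<le> \<bar>c\<bar> * nrm (dual E) f" if "f \<in> vecs (dual E)" for c f
    by (rule least) (use upper[OF that] in \<open>auto simp: abs_mult intro!: mult_left_mono\<close>)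
  have hom: "nrm (dual E) (c *\<^sub>R f) = \<bar>c\<bar> * nrm (dual E) f" if f: "f \<in> vecs (dual E)" for c f
  proof (cases "c = 0")
    case True
    then show ?thesis using n0 by simp
  next
    case False
    have "nrm (dual E) ((1 / c) *\<^sub>R (c *\<^sub>R f)) \<le> \<bar>1 / c\<bar> * nrm (dual E) (c *\<^sub>R f)"
      by (rule le[OF scale[OF f]])
    then have "\<bar>c\<bar> * nrm (dual E) f \<le> nrm (dual E) (c *\<^sub>R f)"
      using False by (simp add: field_simps)
    with le[OF f, of c] show ?thesis by simp
  qed
  have tri: "nrm (dual E) (f + g) \<le> nrm (dual E) f + nrm (dual E) g"
    if "f \<in> vecs (dual E)" "g \<in> vecs (dual E)" for f g
  proof (rule least)
    fix x assume "x \<in> ?U"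
    then have "\<bar>f x\<bar> \<le> nrm (dual E) f" "\<bar>g x\<bar> \<le> nrm (dual E) g"
      using upper that by blast+
    then show "\<bar>(f + g) x\<bar> \<le> nrm (dual E) f + nrm (dual E) g" by simp
  qed
  show ?thesis
    unfolding normed_space_def subspace_def
  proof (intro conjI ballI allI)
    show "0 \<in> vecs (dual E)" by (rule zero)
    fix f assume f: "f \<in> vecs (dual E)"
    show "0 \<le> nrm (dual E) f" by (rule nonneg[OF f])
    show "nrm (dual E) f = 0 \<longleftrightarrow> f = 0" using def[OF f] n0 by blast
    fix c
    show "c *\<^sub>R f \<in> vecs (dual E)" by (rule scale[OF f])
    show "nrm (dual E) (c *\<^sub>R f) = \<bar>c\<bar> * nrm (dual E) f" by (rule hom[OF f])
    fix g assume g: "g \<in> vecs (dual E)"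
    show "f + g \<in> vecs (dual E)" by (rule add[OF f g])
    show "nrm (dual E) (f + g) \<le> nrm (dual E) f + nrm (dual E) g" by (rule tri[OF f g])
  qed
qed


section \<open>Separable spaces live on sequences\<close>

text \<open>
  Every separable normed space, over whatever type, is isometrically isomorphic to one whose
  carrier is a linear subspace of \<open>nat \<Rightarrow> real\<close>. So quantifying over \<open>(nat \<Rightarrow> real) nspace\<close> is
  quantifying over all separable spaces up to isometric isomorphism, which preserves completeness
  and the dual.
\<close>

lemma independent_nat_sets:
  fixes v :: "nat set \<Rightarrow> nat \<Rightarrow> real"
  defines "v \<equiv> \<lambda>S k. if S \<inter> {..<fst (prod_decode k)} = set_decode (snd (prod_decode k)) then 1 else 0"
  shows "inj v" "independent (range v)"
proof -
  have sep: "\<exists>k. v S k = 1 \<and> (\<forall>R\<in>\<R>. R \<noteq> S \<longrightarrow> v R k = 0)" if "finite \<R>" for S \<R>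
  proof -
    have "\<exists>n. (n \<in> R) \<noteq> (n \<in> S)" if "R \<noteq> S" for R
      using that by blast
    then obtain p where p: "\<And>R. R \<noteq> S \<Longrightarrow> (p R \<in> R) \<noteq> (p R \<in> S)"
      by metis
    define m where "m = Suc (Max (insert 0 (p ` \<R>)))"
    have pm: "p R < m" if "R \<in> \<R>" for R
      unfolding m_def using that \<open>finite \<R>\<close> by (simp add: less_Suc_eq_le)
    define k where "k = prod_encode (m, set_encode (S \<inter> {..<m}))"
    have vk: "v R k = (if R \<inter> {..<m} = S \<inter> {..<m} then 1 else 0)" for R
      by (simp add: v_def k_def set_encode_inverse)
    have "v R k = 0" if "R \<in> \<R>" "R \<noteq> S" for R
      using p[OF that(2)] pm[OF that(1)] unfolding vk by auto
    moreover have "v S k = 1" by (simp add: vk)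
    ultimately show ?thesis by blast
  qed
  show inj: "inj v"
  proof (rule injI, rule ccontr)
    fix S R assume "v S = v R" "S \<noteq> R"
    with sep[of "{R}" S] show False by auto
  qed
  show "independent (range v)"
    unfolding independent_explicit_module
  proof (intro allI impI)
    fix t u w
    assume t: "finite t" "t \<subseteq> range v" and s: "(\<Sum>w\<in>t. u w *\<^sub>R w) = 0" and w: "w \<in> t"
    obtain \<R> where \<R>: "finite \<R>" "t = v ` \<R>" using t by (meson finite_subset_image subset_UNIV)
    obtain S where S: "S \<in> \<R>" "w = v S" using w \<R> by blast
    obtain k where k: "v S k = 1" "\<And>R. R \<in> \<R> \<Longrightarrow> R \<noteq> S \<Longrightarrow> v R k = 0"
      using sep[OF \<R>(1), of S] by metis
    have app: "(\<Sum>w\<in>T. u w *\<^sub>R w) k = (\<Sum>w\<in>T. u w * w k)" for T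
      by (induction T rule: infinite_finite_induct) auto
    have "0 = (\<Sum>w\<in>t. u w * w k)" unfolding app[symmetric] s by (simp only: zero_fun_apply)
    also have "\<dots> = (\<Sum>R\<in>\<R>. u (v R) * v R k)"
      unfolding \<R>(2) by (simp add: sum.reindex[OF inj_on_subset[OF inj subset_UNIV]])
    also have "\<dots> = (\<Sum>R\<in>\<R>. if R = S then u (v S) else 0)"
      by (rule sum.cong) (use k in auto)
    also have "\<dots> = u w" using \<R>(1) S by simp
    finally show "u w = 0" by simp
  qed
qed

lemma separable_on_sequences:
  fixes E :: "'a::real_vector nspace"
  assumes E: "normed_space E" and sep: "separable E"
  obtains E' :: "(nat \<Rightarrow> real) nspace" and T :: "'a \<Rightarrow> nat \<Rightarrow> real"
  where "normed_space E'" "linear T" "bij_betw T (vecs E) (vecs E')"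
    "\<And>x. x \<in> vecs E \<Longrightarrow> nrm E' (T x) = nrm E x"
proof -
  interpret M: Metric_space "vecs E" "norm_dist E" by (rule Metric_space_norm_dist[OF E])
  have sub: "subspace (vecs E)" using E by (simp add: normed_space_def)
  obtain D where D: "countable D" "D \<subseteq> vecs E" "M.mtopology closure_of D = vecs E"
    using sep unfolding separable_def separable_space_def norm_metric_def by auto
  have "D \<noteq> {}" using D(3) sub subspace_0 by fastforce
  then obtain d :: "nat \<Rightarrow> 'a" where d: "D = range d"
    using D(1) uncountable_def by blast
  define q :: "nat \<Rightarrow> rat" where "q = from_nat_into UNIV"
  have q: "range q = UNIV" unfolding q_def by (rule range_from_nat_into) auto
  define S where "S x = {k. norm_dist E x (d (fst (prod_decode k))) < of_rat (q (snd (prod_decode k)))}" for x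
  have S_inj: "inj_on S (vecs E)"
  proof (rule inj_onI, rule ccontr)
    fix x y assume x: "x \<in> vecs E" and y: "y \<in> vecs E" and eq: "S x = S y" and ne: "x \<noteq> y"
    define \<delta> where "\<delta> = norm_dist E x y / 2"
    have "\<delta> > 0" using ne x y by (simp add: \<delta>_def M.mdist_pos_less)
    then obtain n where n: "norm_dist E x (d n) < \<delta>"
      using x D(3) unfolding M.metric_closure_of d by (auto simp: M.in_mball)
    obtain r :: rat where r: "norm_dist E x (d n) < of_rat r" "of_rat r < \<delta>"
      using of_rat_dense[OF n] by blast
    obtain j where j: "q j = r" using q by (metis rangeE UNIV_I)
    have "prod_encode (n, j) \<in> S x" using r j by (simp add: S_def)
    then have "prod_encode (n, j) \<in> S y" using eq by simp
    then have "norm_dist E y (d n) < \<delta>" using r j by (simp add: S_def)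
    moreover have "d n \<in> vecs E" using D(2) d by auto
    ultimately show False
      using M.triangle[of x "d n" y] n x y by (simp add: \<delta>_def M.commute)
  qed
  obtain v :: "nat set \<Rightarrow> nat \<Rightarrow> real" where v: "inj v" "independent (range v)"
    using independent_nat_sets by blast
  obtain B where B: "B \<subseteq> vecs E" "independent B" "vecs E \<subseteq> span B"
    using maximal_independent_subset by blast
  have span: "span B = vecs E" using B sub by (simp add: span_minimal subset_antisym)
  obtain T :: "'a \<Rightarrow> nat \<Rightarrow> real" where T: "linear T" "\<And>x. x \<in> B \<Longrightarrow> T x = v (S x)"
    using linear_independent_extend[OF B(2), of "\<lambda>x. v (S x)"] by blast
  have "independent (T ` B)"
    by (rule independent_mono[OF v(2)]) (use T(2) in auto)
  moreover have "inj_on T B"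
    using S_inj B(1) v(1) T(2) by (auto simp: inj_on_def inj_def subset_iff)
  ultimately have inj: "inj_on T (vecs E)"
    using linear_inj_on_span_independent_image[OF T(1)] span by metis
  define E' where "E' = \<lparr>vecs = T ` vecs E, nrm = (\<lambda>y. nrm E (inv_into (vecs E) T y))\<rparr>"
  have iso: "nrm E' (T x) = nrm E x" if "x \<in> vecs E" for x
    using that inj by (simp add: E'_def)
  have vE': "vecs E' = T ` vecs E" by (simp add: E'_def)
  have "normed_space E'"
    unfolding normed_space_def
  proof (intro conjI ballI allI)
    show "subspace (vecs E')" unfolding vE' by (rule linear_subspace_image[OF T(1) sub])
  next
    fix y assume "y \<in> vecs E'"
    then obtain x where x: "x \<in> vecs E" "y = T x" by (auto simp: vE')
    show "0 \<le> nrm E' y" using E x iso by (simp add: normed_space_def)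
    have "T x = 0 \<longleftrightarrow> x = 0"
      using inj x(1) sub T(1) by (metis inj_on_def linear_0 subspace_0)
    then show "nrm E' y = 0 \<longleftrightarrow> y = 0" using E x iso by (simp add: normed_space_def)
    fix c
    have "c *\<^sub>R x \<in> vecs E" "c *\<^sub>R y = T (c *\<^sub>R x)"
      using sub x T(1) by (auto simp: subspace_scale linear_scale)
    then show "nrm E' (c *\<^sub>R y) = \<bar>c\<bar> * nrm E' y"
      using iso x normed_space_scaleR[OF E] by simp
    fix z assume "z \<in> vecs E'"
    then obtain w where w: "w \<in> vecs E" "z = T w" by (auto simp: vE')
    have "x + w \<in> vecs E" "y + z = T (x + w)"
      using sub x w T(1) by (auto simp: subspace_add linear_add)
    then show "nrm E' (y + z) \<le> nrm E' y + nrm E' z"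
      using iso x w E by (simp add: normed_space_def)
  qed
  moreover have "bij_betw T (vecs E) (vecs E')"
    using inj by (simp add: bij_betw_def vE')
  ultimately show ?thesis using that T(1) iso by blast
qed

end

theory Submission
  imports Defs
begin

text \<open>
  The hypothesis on \<open>M\<close> is used for a single space \<open>Z\<close>, built from \<open>X\<close> so that finite subsets of
  its dual can be brought back into \<open>X\<close>.

  Let \<open>Y\<close> be nonreflexive and finitely representable in \<open>X\<close>, and let \<open>\<Phi>\<close> be an element of the
  bidual of \<open>Y\<close> outside \<open>Y\<close>. As \<open>Y\<close> is complete, \<open>\<Phi>\<close> has a positive distance \<open>c\<close> from it. Let
  vectors of \<open>Y\<close> tend to \<open>\<Phi>\<close> in the weak-star sense one after the other, each one much further
  along than those before it. The iterated limit of the norm of a linear combination then depends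
  only on the sequence of its nonzero coefficients. This defines a seminorm \<open>Q\<close> on the finitely
  supported functions on the rationals which is invariant under order-preserving moves of the
  support. Any finitely many of its values are almost attained in \<open>Y\<close> itself, and the distance of
  \<open>\<Phi>\<close> from \<open>Y\<close> bounds the modulus of the sum of \<open>x\<close> over each upper set of rationals by \<open>Q x / c\<close>.

  So the indicator of every ray \<open>{p..}\<close> is a bounded functional for \<open>Q\<close>. The space \<open>Z\<close> is the
  closure of the step functions in the dual norm of \<open>Q\<close>. It is separable, since steps and values
  can be taken rational, but its dual is not, since the left limits at different real numbers are
  uniformly apart: the indicator of a ray that starts between two points tells them apart.
  Hence \<open>M\<close> embeds into the dual of \<open>Z\<close>.

  It remains to map finitely many elements \<open>\<Psi>\<close> of the dual of \<open>Z\<close> into \<open>Y\<close> by one linear map, up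
  to a fixed factor; finite representability then leads to \<open>X\<close>. Cut the rationals into finitely
  many cells, fine enough for a step function on them nearly to norm each \<open>\<Psi>\<close>, and spread the value
  of \<open>\<Psi>\<close> at the indicator of each cell evenly over \<open>K\<close> points of the cell. The resulting vector
  pairs with step functions as \<open>\<Psi>\<close> does, so its seminorm is not much smaller than the norm of
  \<open>\<Psi>\<close> (\<open>lift_lower\<close>). That it is not much larger (\<open>lift_upper\<close>) rests on two facts. By Helly's
  theorem some \<open>x\<close> has almost the same masses on the cells and \<open>Q x\<close> hardly above the norm of \<open>\<Psi>\<close>
  (\<open>Helly_moments\<close>). And evening out the mass inside the cells does not increase \<open>Q\<close> in the
  limit of large \<open>K\<close>, because the even distribution is nearly an average of shifted copies of
  \<open>x\<close>, all with the same seminorm (\<open>Q_averaging\<close>). Here the invariance of \<open>Q\<close> is essential, and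
  this is why \<open>Q\<close> is used in place of the norm of \<open>Y\<close>.
\<close>

section \<open>Sublinear functions\<close>

definition sublinear :: "('v::real_vector \<Rightarrow> real) \<Rightarrow> bool" where
  "sublinear p \<longleftrightarrow> (\<forall>x y. p (x + y) \<le> p x + p y) \<and> (\<forall>c\<ge>0. \<forall>x. p (c *\<^sub>R x) = c * p x)"

lemma
  assumes "sublinear p"
  shows sublinear_add: "p (x + y) \<le> p x + p y"
    and sublinear_scale: "0 \<le> c \<Longrightarrow> p (c *\<^sub>R x) = c * p x"
    and sublinear_zero: "p 0 = 0"
    and sublinear_minus: "- p (- x) \<le> p x"
proof -
  show add: "p (x + y) \<le> p x + p y" for x y using assms by (simp add: sublinear_def)
  show scale: "p (c *\<^sub>R x) = c * p x" if "0 \<le> c" for c x using assms that by (simp add: sublinear_def)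
  show 0: "p 0 = 0" using scale[of 0 0] by simp
  show "- p (- x) \<le> p x" using add[of x "- x"] 0 by simp
qed

text \<open>
  Lowering a sublinear \<open>p\<close> along the ray through \<open>z\<close> makes it additive there. So a minimal
  sublinear function is additive, and one such step before the passage to a minimal function
  forces the value at \<open>z\<close>.
\<close>

lemma sublinear_tilt:
  fixes z :: "'v::real_vector"
  assumes p: "sublinear p"
  defines "p' \<equiv> \<lambda>x. INF t\<in>{0..}. p (x + t *\<^sub>R z) - t * p z"
  shows "sublinear p'" and "p' x \<le> p x" and "p' x \<le> p (x + z) - p z" and "p' (- z) \<le> - p z"
proof -
  have low: "- p (- x) \<le> p (x + t *\<^sub>R z) - t * p z" if "0 \<le> t" for x t
  proof -
    have "t * p z = p ((x + t *\<^sub>R z) + (- x))" using that sublinear_scale[OF p] by simp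
    also have "\<dots> \<le> p (x + t *\<^sub>R z) + p (- x)" by (rule sublinear_add[OF p])
    finally show ?thesis by simp
  qed
  have bdd: "bdd_below ((\<lambda>t. p (x + t *\<^sub>R z) - t * p z) ` {0..})" for x
    using low by (intro bdd_belowI2[where m = "- p (- x)"]) auto
  have upper: "p' x \<le> p (x + t *\<^sub>R z) - t * p z" if "0 \<le> t" for x t
    unfolding p'_def using that by (intro cINF_lower[OF bdd]) auto
  have greatest: "m \<le> p' x" if "\<And>t. 0 \<le> t \<Longrightarrow> m \<le> p (x + t *\<^sub>R z) - t * p z" for m x
    unfolding p'_def using that by (intro cINF_greatest) auto
  show "p' x \<le> p x" using upper[of 0 x] by simp
  show "p' x \<le> p (x + z) - p z" using upper[of 1 x] by simp
  show "p' (- z) \<le> - p z" using upper[of 1 "- z"] sublinear_zero[OF p] by simp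
  have add: "p' (x + y) \<le> p' x + p' y" for x y
  proof -
    have "p' (x + y) - (p (x + t *\<^sub>R z) - t * p z) \<le> p (y + s *\<^sub>R z) - s * p z"
      if "0 \<le> t" "0 \<le> s" for t s
      using upper[of "t + s" "x + y"] sublinear_add[OF p, of "x + t *\<^sub>R z" "y + s *\<^sub>R z"] that
      by (simp add: algebra_simps)
    then have "p' (x + y) - (p (x + t *\<^sub>R z) - t * p z) \<le> p' y" if "0 \<le> t" for t
      using that by (intro greatest) auto
    then have "p' (x + y) - p' y \<le> p' x"
      by (intro greatest) (simp add: algebra_simps)
    then show ?thesis by simp
  qed
  have le: "p' (c *\<^sub>R x) \<le> c * p' x" if "0 < c" for c x
  proof -
    have "p' (c *\<^sub>R x) / c \<le> p' x"
    proof (rule greatest)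
      fix t :: real assume t: "0 \<le> t"
      have "p (c *\<^sub>R x + (c * t) *\<^sub>R z) = c * p (x + t *\<^sub>R z)"
        using sublinear_scale[OF p, of c "x + t *\<^sub>R z"] that by (simp add: scaleR_add_right)
      then show "p' (c *\<^sub>R x) / c \<le> p (x + t *\<^sub>R z) - t * p z"
        using upper[of "c * t" "c *\<^sub>R x"] that t by (simp add: field_simps)
    qed
    then show ?thesis using that by (simp add: field_simps)
  qed
  have "p' (c *\<^sub>R x) = c * p' x" if "0 \<le> c" for c x
  proof (cases "c = 0")
    case True
    have "0 \<le> p' 0" by (rule greatest) (simp add: sublinear_scale[OF p] sublinear_zero[OF p])
    moreover have "p' 0 \<le> 0" using upper[of 0 0] sublinear_zero[OF p] by simp
    ultimately show ?thesis using True by simp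
  next
    case False
    with that have c: "0 < c" by simp
    have "p' ((1 / c) *\<^sub>R (c *\<^sub>R x)) \<le> (1 / c) * p' (c *\<^sub>R x)" by (rule le) (use c in simp)
    then show ?thesis using le[OF c, of x] c by (simp add: field_simps)
  qed
  with add show "sublinear p'" by (simp add: sublinear_def)
qed

text \<open>
  Zorn's lemma applies because the infimum of a chain of sublinear functions below \<open>P\<close> is finite:
  each of them is at least \<open>- P (- x)\<close> at \<open>x\<close>.
\<close>

lemma minimal_sublinear:
  fixes P :: "'v::real_vector \<Rightarrow> real"
  assumes P: "sublinear P"
  obtains p where "sublinear p" "\<And>x. p x \<le> P x"
    "\<And>p'. sublinear p' \<Longrightarrow> (\<And>x. p' x \<le> p x) \<Longrightarrow> p' = p"
proof -
  define A where "A = {p. sublinear p \<and> p \<le> P}"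
  have "\<exists>m\<in>A. \<forall>a\<in>A. m \<ge> a \<longrightarrow> a = m"
  proof (rule predicate_Zorn)
    show "partial_order_on A (relation_of (\<ge>) A)"
      by (rule partial_order_on_relation_ofI) (auto intro: order_trans)
    fix C assume "C \<in> Chains (relation_of (\<ge>) A)"
    then have CA: "C \<subseteq> A" and chain: "\<And>p q. p \<in> C \<Longrightarrow> q \<in> C \<Longrightarrow> p \<le> q \<or> q \<le> p"
      unfolding Chains_def relation_of_def by blast+
    show "\<exists>u\<in>A. \<forall>a\<in>C. a \<ge> u"
    proof (cases "C = {}")
      case True
      then show ?thesis using P by (auto simp: A_def)
    next
      case False
      define I where "I x = (INF p\<in>C. p x)" for x
      have low: "- P (- x) \<le> p x" if "p \<in> C" for p x
      proof -
        have "sublinear p" "p \<le> P" using that CA by (auto simp: A_def)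
        then show ?thesis using sublinear_minus[of p x] le_funD[of p P "- x"] by simp
      qed
      have bdd: "bdd_below ((\<lambda>p. p x) ` C)" for x
        using low by (intro bdd_belowI2[where m = "- P (- x)"]) auto
      have lower: "I x \<le> p x" if "p \<in> C" for p x
        unfolding I_def using that by (intro cINF_lower[OF bdd])
      have greatest: "m \<le> I x" if "\<And>p. p \<in> C \<Longrightarrow> m \<le> p x" for m x
        unfolding I_def using that False by (intro cINF_greatest) auto
      have slin: "sublinear p" if "p \<in> C" for p using CA that by (auto simp: A_def)
      have add: "I (x + y) \<le> I x + I y" for x y
      proof -
        have "I (x + y) - q y \<le> p x" if pq: "p \<in> C" "q \<in> C" for p q
        proof -
          have "p \<le> q \<or> q \<le> p" by (rule chain[OF pq])
          then show ?thesis
          proof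
            assume "p \<le> q"
            then show ?thesis
              using lower[OF pq(1), of "x + y"] sublinear_add[OF slin[OF pq(1)], of x y] le_funD[of p q y]
              by simp
          next
            assume "q \<le> p"
            then show ?thesis
              using lower[OF pq(2), of "x + y"] sublinear_add[OF slin[OF pq(2)], of x y] le_funD[of q p x]
              by simp
          qed
        qed
        then have "I (x + y) - q y \<le> I x" if "q \<in> C" for q using that by (intro greatest)
        then have "I (x + y) - I x \<le> I y" by (intro greatest) (simp add: algebra_simps)
        then show ?thesis by simp
      qed
      have "I (c *\<^sub>R x) = c * I x" if "0 \<le> c" for c x
      proof -
        have "(INF p\<in>C. p (c *\<^sub>R x)) = (INF p\<in>C. c * p x)"
          by (rule INF_cong) (auto simp: sublinear_scale[OF slin that])
        also have "\<dots> = c * (INF p\<in>C. p x)"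
        proof (cases "c = 0")
          case True
          then show ?thesis using False by simp
        next
          case c: False
          show ?thesis
          proof (rule antisym)
            have bdd': "bdd_below ((\<lambda>p. c * p x) ` C)"
              using low that by (intro bdd_belowI2[where m = "c * - P (- x)"] mult_left_mono) auto
            have "(INF p\<in>C. c * p x) / c \<le> (INF p\<in>C. p x)"
            proof (rule cINF_greatest[OF False])
              fix p assume "p \<in> C"
              then have "(INF p\<in>C. c * p x) \<le> c * p x" by (rule cINF_lower[OF bdd'])
              then show "(INF p\<in>C. c * p x) / c \<le> p x" using c that by (simp add: field_simps)
            qed
            then show "(INF p\<in>C. c * p x) \<le> c * (INF p\<in>C. p x)"
              using c that by (simp add: field_simps)
            show "c * (INF p\<in>C. p x) \<le> (INF p\<in>C. c * p x)"
              using False lower that unfolding I_def by (intro cINF_greatest mult_left_mono) auto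
          qed
        qed
        finally show ?thesis unfolding I_def .
      qed
      with add have "sublinear I" by (simp add: sublinear_def)
      moreover obtain p where "p \<in> C" using False by blast
      then have "I \<le> P" using lower[OF \<open>p \<in> C\<close>] CA
        by (auto simp: A_def le_fun_def intro: order_trans)
      ultimately have "I \<in> A" by (simp add: A_def)
      then show ?thesis using lower by (auto simp: le_fun_def)
    qed
  qed
  then obtain m where "m \<in> A" and m: "\<And>a. a \<in> A \<Longrightarrow> a \<le> m \<Longrightarrow> a = m" by blast
  show ?thesis
  proof
    show "sublinear m" "\<And>x. m x \<le> P x" using \<open>m \<in> A\<close> by (auto simp: A_def le_fun_def)
    show "p' = m" if "sublinear p'" "\<And>x. p' x \<le> m x" for p'
    proof (rule m)
      show le: "p' \<le> m" using that(2) by (rule le_funI)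
      have "m \<le> P" using \<open>m \<in> A\<close> by (simp add: A_def)
      with le have "p' \<le> P" by (rule order_trans)
      with that(1) show "p' \<in> A" by (simp add: A_def)
    qed
  qed
qed

lemma Hahn_Banach_support:
  fixes P :: "'v::real_vector \<Rightarrow> real"
  assumes P: "sublinear P"
  obtains a where "linear a" "\<And>x. a x \<le> P x" "a z = P z"
proof -
  obtain P' where P': "sublinear P'" "\<And>x. P' x \<le> P x" "P' (- z) \<le> - P z"
    using sublinear_tilt[OF P, where z = z] by blast
  obtain p where p: "sublinear p" "\<And>x. p x \<le> P' x"
    and min: "\<And>p'. sublinear p' \<Longrightarrow> (\<And>x. p' x \<le> p x) \<Longrightarrow> p' = p"
    using minimal_sublinear[OF P'(1)] by blast
  have add: "p (x + y) = p x + p y" for x y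
  proof -
    let ?p = "\<lambda>x. INF t\<in>{0..}. p (x + t *\<^sub>R y) - t * p y"
    have "?p = p" by (intro min sublinear_tilt(1,2)[OF p(1)])
    then have "?p x = p x" by (rule fun_cong)
    moreover have "?p x \<le> p (x + y) - p y" by (rule sublinear_tilt(3)[OF p(1)])
    ultimately have "p x \<le> p (x + y) - p y" by (simp only:)
    then show ?thesis using sublinear_add[OF p(1), of x y] by simp
  qed
  have neg: "p (- x) = - p x" for x using add[of x "- x"] sublinear_zero[OF p(1)] by simp
  have "p (c *\<^sub>R x) = c * p x" for c x
  proof (cases "0 \<le> c")
    case True
    then show ?thesis by (rule sublinear_scale[OF p(1)])
  next
    case False
    then have "p ((- c) *\<^sub>R x) = (- c) * p x" by (intro sublinear_scale[OF p(1)]) simp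
    then show ?thesis using neg[of "c *\<^sub>R x"] by simp
  qed
  with add have "linear p" by (intro linearI) auto
  moreover have "p x \<le> P x" for x using p(2) P'(2) order_trans by blast
  moreover have "p z = P z"
    using p(2)[of "- z"] P'(3) neg[of z] calculation(2)[of z] by simp
  ultimately show ?thesis using that by blast
qed

text \<open>
  Helly's theorem: moment conditions that no linear combination of the functionals \<open>f k\<close> rules
  out can be met, up to \<open>\<epsilon>\<close>, by a vector of norm almost \<open>C\<close>. The infimum of
  \<open>N x + K * (\<Sum>k\<in>S. \<bar>z k - f k x\<bar>)\<close> over \<open>x\<close> is sublinear in \<open>z\<close>, and a linear functional
  supporting it at \<open>b\<close> is a combination of the kind that the hypothesis bounds.
\<close>

lemma Helly_moments:
  fixes f :: "'k \<Rightarrow> 'v::real_vector \<Rightarrow> real"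
  assumes V: "subspace V" and S: "finite S" and \<epsilon>: "0 < \<epsilon>"
    and N0: "\<And>x. x \<in> V \<Longrightarrow> 0 \<le> N x"
    and Nadd: "\<And>x y. x \<in> V \<Longrightarrow> y \<in> V \<Longrightarrow> N (x + y) \<le> N x + N y"
    and Nsc: "\<And>c x. x \<in> V \<Longrightarrow> N (c *\<^sub>R x) = \<bar>c\<bar> * N x"
    and fadd: "\<And>k x y. k \<in> S \<Longrightarrow> x \<in> V \<Longrightarrow> y \<in> V \<Longrightarrow> f k (x + y) = f k x + f k y"
    and fsc: "\<And>k c x. k \<in> S \<Longrightarrow> x \<in> V \<Longrightarrow> f k (c *\<^sub>R x) = c * f k x"
    and bound: "\<And>a. (\<And>x. x \<in> V \<Longrightarrow> (\<Sum>k\<in>S. a k * f k x) \<le> N x) \<Longrightarrow> (\<Sum>k\<in>S. a k * b k) \<le> C"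
  obtains x where "x \<in> V" "N x \<le> C + \<epsilon>" "\<And>k. k \<in> S \<Longrightarrow> \<bar>f k x - b k\<bar> \<le> \<epsilon>"
proof -
  have C: "0 \<le> C" using bound[of "\<lambda>_. 0"] N0 by simp
  define K where "K = (C + \<epsilon>) / \<epsilon>"
  have K: "0 < K" using C \<epsilon> by (simp add: K_def)
  have V0: "0 \<in> V" using V by (rule subspace_0)
  have N_0: "N 0 = 0" using Nsc[OF V0, of 0] by simp
  have f_0: "f k 0 = 0" if "k \<in> S" for k using fsc[OF that V0, of 0] by simp
  define g where "g z x = N x + K * (\<Sum>k\<in>S. \<bar>z k - f k x\<bar>)" for z :: "'k \<Rightarrow> real" and x
  define P where "P z = (INF x\<in>V. g z x)" for z
  have g0: "0 \<le> g z x" if "x \<in> V" for z x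
    unfolding g_def using K N0[OF that] by (simp add: sum_nonneg)
  have bdd: "bdd_below (g z ` V)" for z using g0 by (intro bdd_belowI2[where m = 0])
  have lower: "P z \<le> g z x" if "x \<in> V" for z x
    unfolding P_def using that by (intro cINF_lower[OF bdd])
  have greatest: "m \<le> P z" if "\<And>x. x \<in> V \<Longrightarrow> m \<le> g z x" for m z
    unfolding P_def using that V0 by (intro cINF_greatest) auto
  have P_add: "P (y + z) \<le> P y + P z" for y z
  proof -
    have "P (y + z) - g y u \<le> g z v" if uv: "u \<in> V" "v \<in> V" for u v
    proof -
      have "(\<Sum>k\<in>S. \<bar>(y + z) k - f k (u + v)\<bar>) \<le> (\<Sum>k\<in>S. \<bar>y k - f k u\<bar> + \<bar>z k - f k v\<bar>)"
        by (rule sum_mono) (use fadd uv in auto)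
      then have "K * (\<Sum>k\<in>S. \<bar>(y + z) k - f k (u + v)\<bar>) \<le> K * (\<Sum>k\<in>S. \<bar>y k - f k u\<bar> + \<bar>z k - f k v\<bar>)"
        using K by (intro mult_left_mono) auto
      then have "g (y + z) (u + v) \<le> g y u + g z v"
        using Nadd[OF uv] unfolding g_def by (simp add: sum.distrib algebra_simps)
      then show ?thesis using lower[of "u + v" "y + z"] subspace_add[OF V uv] by simp
    qed
    then have "P (y + z) - g y u \<le> P z" if "u \<in> V" for u using that by (intro greatest)
    then have "P (y + z) - P z \<le> P y" by (intro greatest) (simp add: algebra_simps)
    then show ?thesis by simp
  qed
  have g_sc: "g (c *\<^sub>R z) (c *\<^sub>R x) = \<bar>c\<bar> * g z x" if "x \<in> V" for c z x
  proof -
    have "(\<Sum>k\<in>S. \<bar>(c *\<^sub>R z) k - f k (c *\<^sub>R x)\<bar>) = (\<Sum>k\<in>S. \<bar>c\<bar> * \<bar>z k - f k x\<bar>)"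
      by (rule sum.cong) (use fsc that in \<open>auto simp: abs_mult[symmetric] right_diff_distrib\<close>)
    then show ?thesis using Nsc[OF that] by (simp add: g_def sum_distrib_left algebra_simps)
  qed
  have P_le: "P (c *\<^sub>R z) \<le> c * P z" if "0 < c" for c z
  proof -
    have "P (c *\<^sub>R z) / c \<le> P z"
    proof (rule greatest)
      fix x assume x: "x \<in> V"
      have "P (c *\<^sub>R z) \<le> g (c *\<^sub>R z) (c *\<^sub>R x)" using x V by (intro lower subspace_scale)
      then show "P (c *\<^sub>R z) / c \<le> g z x" using that g_sc[OF x] by (simp add: field_simps)
    qed
    then show ?thesis using that by (simp add: field_simps)
  qed
  have P_0: "P 0 = 0"
  proof (rule antisym)
    show "P 0 \<le> 0" using lower[OF V0, of 0] N_0 f_0 by (simp add: g_def)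
    show "0 \<le> P 0" using g0 by (rule greatest)
  qed
  have "P (c *\<^sub>R z) = c * P z" if "0 \<le> c" for c z
  proof (cases "c = 0")
    case True
    then show ?thesis using P_0 by simp
  next
    case False
    with that have c: "0 < c" by simp
    have "P ((1 / c) *\<^sub>R (c *\<^sub>R z)) \<le> (1 / c) * P (c *\<^sub>R z)" by (rule P_le) (use c in simp)
    then show ?thesis using P_le[OF c, of z] c by (simp add: field_simps)
  qed
  with P_add have "sublinear P" by (simp add: sublinear_def)
  then obtain a where a: "linear a" "\<And>z. a z \<le> P z" "a b = P b"
    using Hahn_Banach_support[where z = b] by blast
  define e where "e k = a (\<lambda>j. if j = k then 1 else 0)" for k
  have a_eq: "a z = (\<Sum>k\<in>S. e k * z k)" for z
  proof -
    define w where "w = z - (\<Sum>k\<in>S. z k *\<^sub>R (\<lambda>j. if j = k then 1 else 0))"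
    have sum_app: "(\<Sum>k\<in>T. z k *\<^sub>R (\<lambda>j. if j = k then 1 else 0)) i = (\<Sum>k\<in>T. if i = k then z k else 0)" for T i
      by (induction T rule: infinite_finite_induct) auto
    have w0: "w k = 0" if "k \<in> S" for k
      unfolding w_def using that S by (simp add: sum_app)
    have "P w \<le> 0" "P (- w) \<le> 0"
      using lower[OF V0, of w] lower[OF V0, of "- w"] N_0 f_0 w0 by (auto simp: g_def)
    then have "a w \<le> 0" "a (- w) \<le> 0" using a(2) order_trans by blast+
    then have "a w = 0" using linear_neg[OF a(1), of w] by simp
    then show ?thesis
      by (simp add: w_def linear_diff[OF a(1)] linear_sum[OF a(1)] linear_scale[OF a(1)] e_def mult.commute)
  qed
  have "P b \<le> C"
    unfolding a(3)[symmetric] a_eq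
  proof (rule bound)
    fix x assume x: "x \<in> V"
    have "(\<Sum>k\<in>S. e k * f k x) \<le> P (\<lambda>k. f k x)" using a(2) a_eq[of "\<lambda>k. f k x"] by metis
    also have "\<dots> \<le> N x" using lower[OF x, of "\<lambda>k. f k x"] by (simp add: g_def)
    finally show "(\<Sum>k\<in>S. e k * f k x) \<le> N x" .
  qed
  then have "\<not> (\<forall>x\<in>V. C + \<epsilon> \<le> g b x)" using greatest[of "C + \<epsilon>" b] \<epsilon> by auto
  then obtain x where x: "x \<in> V" "g b x < C + \<epsilon>" by (auto simp: not_le)
  show ?thesis
  proof
    show "x \<in> V" by (rule x)
    have nn: "0 \<le> K * (\<Sum>k\<in>S. \<bar>b k - f k x\<bar>)" using K by (simp add: sum_nonneg)
    then show "N x \<le> C + \<epsilon>" using x(2) unfolding g_def by linarith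
    fix k assume k: "k \<in> S"
    have "K * \<bar>b k - f k x\<bar> \<le> K * (\<Sum>k\<in>S. \<bar>b k - f k x\<bar>)"
      using K k S by (intro mult_left_mono member_le_sum) auto
    also have "\<dots> \<le> C + \<epsilon>" using x(2) N0[OF x(1)] unfolding g_def by linarith
    also have "\<dots> = K * \<epsilon>" using \<epsilon> by (simp add: K_def)
    finally show "\<bar>f k x - b k\<bar> \<le> \<epsilon>" using K by (simp add: abs_minus_commute)
  qed
qed

section \<open>Normed spaces with an explicit carrier\<close>

lemma
  assumes E: "normed_space E"
  shows vecs_zero: "0 \<in> vecs E"
    and vecs_add: "x \<in> vecs E \<Longrightarrow> y \<in> vecs E \<Longrightarrow> x + y \<in> vecs E"
    and vecs_diff: "x \<in> vecs E \<Longrightarrow> y \<in> vecs E \<Longrightarrow> x - y \<in> vecs E"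
    and vecs_scale: "x \<in> vecs E \<Longrightarrow> c *\<^sub>R x \<in> vecs E"
    and vecs_sum: "(\<And>i. i \<in> I \<Longrightarrow> g i \<in> vecs E) \<Longrightarrow> sum g I \<in> vecs E"
    and nrm_zero: "nrm E 0 = 0"
  using normed_space_subspace[OF E] normed_space_eq_0[OF E, of 0]
  by (auto simp: subspace_0 subspace_add subspace_diff subspace_scale subspace_sum)

lemma
  assumes E: "normed_space E" and f: "f \<in> vecs (dual E)"
  shows dual_sum: "(\<And>i. i \<in> I \<Longrightarrow> g i \<in> vecs E) \<Longrightarrow> f (sum g I) = (\<Sum>i\<in>I. f (g i))"
    and dual_diff: "x \<in> vecs E \<Longrightarrow> y \<in> vecs E \<Longrightarrow> f (x - y) = f x - f y"
    and dual_zero: "f 0 = 0"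
proof -
  show 0: "f 0 = 0" using dual_scaleR[OF f vecs_zero[OF E], of 0] by simp
  show "f (sum g I) = (\<Sum>i\<in>I. f (g i))" if "\<And>i. i \<in> I \<Longrightarrow> g i \<in> vecs E"
    using that by (induction I rule: infinite_finite_induct) (simp_all add: 0 dual_add[OF f] vecs_sum[OF E])
  show "f (x - y) = f x - f y" if xy: "x \<in> vecs E" "y \<in> vecs E"
  proof -
    have "f (x + (-1) *\<^sub>R y) = f x + f ((-1) *\<^sub>R y)"
      by (rule dual_add[OF f xy(1) vecs_scale[OF E xy(2)]])
    then show ?thesis using dual_scaleR[OF f xy(2), of "-1"] by simp
  qed
qed

lemma dual_norm_le:
  assumes E: "normed_space E" and C: "0 \<le> C"
    and f: "\<And>x. x \<in> vecs E \<Longrightarrow> \<bar>f x\<bar> \<le> C * nrm E x"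
  shows "nrm (dual E) f \<le> C"
  unfolding dual_norm_eq
proof (rule cSUP_least)
  show "{x \<in> vecs E. nrm E x \<le> 1} \<noteq> {}" using vecs_zero[OF E] nrm_zero[OF E] by auto
  fix x assume "x \<in> {x \<in> vecs E. nrm E x \<le> 1}"
  then show "\<bar>f x\<bar> \<le> C"
    using f[of x] mult_left_mono[of "nrm E x" 1 C] C by auto
qed

lemma dual_norm_nearly_attained:
  assumes E: "normed_space E" and m: "m < nrm (dual E) f"
  obtains z where "z \<in> vecs E" "nrm E z \<le> 1" "m < \<bar>f z\<bar>"
proof -
  have "\<not> (\<forall>z\<in>{x \<in> vecs E. nrm E x \<le> 1}. \<bar>f z\<bar> \<le> m)"
  proof
    assume le: "\<forall>z\<in>{x \<in> vecs E. nrm E x \<le> 1}. \<bar>f z\<bar> \<le> m"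
    have "nrm (dual E) f \<le> m"
      unfolding dual_norm_eq
    proof (rule cSUP_least)
      show "{x \<in> vecs E. nrm E x \<le> 1} \<noteq> {}" using vecs_zero[OF E] nrm_zero[OF E] by auto
    qed (use le in auto)
    with m show False by simp
  qed
  then show ?thesis using that by (auto simp: not_le)
qed

text \<open>
  The norm is given only on the carrier, but composing it with a linear projection of the ambient
  type onto the carrier makes it sublinear everywhere.
\<close>

lemma norming_functional:
  assumes E: "normed_space E" and y: "y \<in> vecs E"
  obtains f where "f \<in> vecs (dual E)" "\<And>x. x \<in> vecs E \<Longrightarrow> \<bar>f x\<bar> \<le> nrm E x" "f y = nrm E y"
proof -
  have "linear (id :: 'a \<Rightarrow> 'a)" by (rule linearI) simp_all
  from Real_Vector_Spaces.linear_exists_left_inverse_on[OF this normed_space_subspace[OF E]]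
  obtain \<pi> where \<pi>: "range \<pi> \<subseteq> vecs E" "linear \<pi>" "\<And>x. x \<in> vecs E \<Longrightarrow> \<pi> x = x"
    by auto
  have \<pi>v: "\<pi> x \<in> vecs E" for x using \<pi>(1) by auto
  have "sublinear (\<lambda>x. nrm E (\<pi> x))"
    using \<pi>v by (simp add: sublinear_def linear_add[OF \<pi>(2)] linear_scale[OF \<pi>(2)]
        normed_space_triangle[OF E] normed_space_scaleR[OF E])
  then obtain a where a: "linear a" "\<And>x. a x \<le> nrm E (\<pi> x)" "a y = nrm E (\<pi> y)"
    using Hahn_Banach_support[where z = y] by blast
  have bound: "\<bar>a x\<bar> \<le> nrm E x" if "x \<in> vecs E" for x
  proof -
    have "a ((-1) *\<^sub>R x) \<le> nrm E ((-1) *\<^sub>R x)"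
      using a(2)[of "(-1) *\<^sub>R x"] \<pi>(3)[OF vecs_scale[OF E that]] by metis
    then have "- a x \<le> nrm E x"
      using linear_scale[OF a(1), of "-1" x] normed_space_scaleR[OF E that, of "-1"] by simp
    moreover have "a x \<le> nrm E x" using a(2)[of x] \<pi>(3)[OF that] by simp
    ultimately show ?thesis by simp
  qed
  show ?thesis
  proof
    show "(\<lambda>x. if x \<in> vecs E then a x else 0) \<in> vecs (dual E)"
      by (rule dualI[where K = 1])
        (use bound in \<open>auto simp: vecs_add[OF E] vecs_scale[OF E] linear_add[OF a(1)] linear_scale[OF a(1)]\<close>)
  qed (use bound y a(3) \<pi>(3) in auto)
qed

lemma banach_limit:
  assumes E: "banach_space E" and \<sigma>: "\<And>n::nat. \<sigma> n \<in> vecs E"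
    and cauchy: "\<And>\<epsilon>. 0 < \<epsilon> \<Longrightarrow> \<exists>N. \<forall>m\<ge>N. \<forall>n\<ge>N. nrm E (\<sigma> m - \<sigma> n) < \<epsilon>"
  obtains l where "l \<in> vecs E" "\<And>\<epsilon>. 0 < \<epsilon> \<Longrightarrow> \<exists>N. \<forall>n\<ge>N. nrm E (\<sigma> n - l) < \<epsilon>"
proof -
  have nE: "normed_space E" using E by (simp add: banach_space_def)
  interpret M: Metric_space "vecs E" "norm_dist E" by (rule Metric_space_norm_dist[OF nE])
  have "M.mcomplete" using E by (simp add: banach_space_def norm_metric_def)
  moreover have "M.MCauchy \<sigma>"
    unfolding M.MCauchy_def
  proof (intro conjI allI impI)
    show "range \<sigma> \<subseteq> vecs E" using \<sigma> by auto
    fix \<epsilon> :: real assume "0 < \<epsilon>"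
    from cauchy[OF this] show "\<exists>N. \<forall>n n'. N \<le> n \<longrightarrow> N \<le> n' \<longrightarrow> norm_dist E (\<sigma> n) (\<sigma> n') < \<epsilon>"
      using \<sigma> by (simp add: norm_dist_def)
  qed
  ultimately obtain l where l: "limitin M.mtopology \<sigma> l sequentially"
    unfolding M.mcomplete_def by blast
  then have lE: "l \<in> vecs E" and ev: "\<And>\<epsilon>. 0 < \<epsilon> \<Longrightarrow> \<exists>N. \<forall>n\<ge>N. norm_dist E (\<sigma> n) l < \<epsilon>"
    unfolding M.limitin_metric eventually_sequentially by blast+
  show ?thesis
    using that[OF lE] ev \<sigma> lE by (simp add: norm_dist_def)
qed

lemma banach_spaceI:
  assumes E: "normed_space E"
    and lim: "\<And>\<sigma>::nat \<Rightarrow> _. (\<And>n. \<sigma> n \<in> vecs E) \<Longrightarrow>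
        (\<And>\<epsilon>. 0 < \<epsilon> \<Longrightarrow> \<exists>N. \<forall>m\<ge>N. \<forall>n\<ge>N. nrm E (\<sigma> m - \<sigma> n) < \<epsilon>) \<Longrightarrow>
        \<exists>l\<in>vecs E. \<forall>\<epsilon>>0. \<exists>N. \<forall>n\<ge>N. nrm E (\<sigma> n - l) < \<epsilon>"
  shows "banach_space E"
proof -
  interpret M: Metric_space "vecs E" "norm_dist E" by (rule Metric_space_norm_dist[OF E])
  have "M.mcomplete"
    unfolding M.mcomplete_def
  proof (intro allI impI)
    fix \<sigma> assume \<sigma>: "M.MCauchy \<sigma>"
    then have v: "\<sigma> n \<in> vecs E" for n by (auto simp: M.MCauchy_def)
    have "\<exists>l\<in>vecs E. \<forall>\<epsilon>>0. \<exists>N. \<forall>n\<ge>N. nrm E (\<sigma> n - l) < \<epsilon>"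
    proof (rule lim)
      fix \<epsilon> :: real assume "0 < \<epsilon>"
      then obtain N where "\<forall>n n'. N \<le> n \<longrightarrow> N \<le> n' \<longrightarrow> norm_dist E (\<sigma> n) (\<sigma> n') < \<epsilon>"
        using \<sigma> unfolding M.MCauchy_def by blast
      then show "\<exists>N. \<forall>m\<ge>N. \<forall>n\<ge>N. nrm E (\<sigma> m - \<sigma> n) < \<epsilon>"
        using v by (auto simp: norm_dist_def)
    qed (rule v)
    then obtain l where l: "l \<in> vecs E" "\<And>\<epsilon>. 0 < \<epsilon> \<Longrightarrow> \<exists>N. \<forall>n\<ge>N. nrm E (\<sigma> n - l) < \<epsilon>"
      by blast
    then show "\<exists>l. limitin M.mtopology \<sigma> l sequentially"
      unfolding M.limitin_metric eventually_sequentially using v by (auto simp: norm_dist_def)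
  qed
  then show ?thesis using E by (simp add: banach_space_def norm_metric_def)
qed

lemma separableI:
  assumes E: "normed_space E" and D: "countable D" "D \<subseteq> vecs E"
    and dense: "\<And>x \<epsilon>. x \<in> vecs E \<Longrightarrow> 0 < \<epsilon> \<Longrightarrow> \<exists>d\<in>D. nrm E (x - d) < \<epsilon>"
  shows "separable E"
proof -
  interpret M: Metric_space "vecs E" "norm_dist E" by (rule Metric_space_norm_dist[OF E])
  have "\<exists>y\<in>D. y \<in> M.mball x e" if xe: "x \<in> vecs E" "0 < e" for x e
  proof -
    obtain d where "d \<in> D" "nrm E (x - d) < e" using dense[OF xe] by blast
    then show ?thesis using xe D(2) by (intro bexI[of _ d]) (auto simp: norm_dist_def)
  qed
  then have "M.mtopology closure_of D = vecs E"
    unfolding M.metric_closure_of by blast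
  then show ?thesis
    using D unfolding separable_def separable_space_def norm_metric_def by auto
qed

lemma not_separableI:
  assumes E: "normed_space E" and g: "inj_on g I" "uncountable I" "g ` I \<subseteq> vecs E" and c: "0 < c"
    and far: "\<And>s t. s \<in> I \<Longrightarrow> t \<in> I \<Longrightarrow> s \<noteq> t \<Longrightarrow> c \<le> nrm E (g s - g t)"
  shows "\<not> separable E"
proof
  assume "separable E"
  interpret M: Metric_space "vecs E" "norm_dist E" by (rule Metric_space_norm_dist[OF E])
  obtain D where D: "countable D" "D \<subseteq> vecs E" "M.mtopology closure_of D = vecs E"
    using \<open>separable E\<close> unfolding separable_def separable_space_def norm_metric_def by auto
  have gE: "g s \<in> vecs E" if "s \<in> I" for s using g(3) that by auto
  have "\<exists>d\<in>D. norm_dist E (g s) d < c / 2" if "s \<in> I" for s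
  proof -
    have "g s \<in> M.mtopology closure_of D" using D(3) gE[OF that] by simp
    then have "\<exists>d\<in>D. d \<in> M.mball (g s) (c / 2)"
      unfolding M.metric_closure_of using half_gt_zero[OF c] by blast
    then show ?thesis by auto
  qed
  then obtain d where d: "\<And>s. s \<in> I \<Longrightarrow> d s \<in> D" "\<And>s. s \<in> I \<Longrightarrow> norm_dist E (g s) (d s) < c / 2"
    by metis
  have "inj_on d I"
  proof (rule inj_onI, rule ccontr)
    fix s t assume st: "s \<in> I" "t \<in> I" "d s = d t" "s \<noteq> t"
    have "d s \<in> vecs E" using d(1) D(2) st by auto
    then have "norm_dist E (g s) (g t) < c"
      using M.triangle[of "g s" "d s" "g t"] d(2)[OF st(1)] d(2)[OF st(2)] gE st
      by (simp add: M.commute)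
    then show False using far[OF st(1,2,4)] gE st by (simp add: norm_dist_def)
  qed
  then have "countable I" using D(1) d(1) by (meson countable_image_inj_on countable_subset image_subsetI)
  with g(2) show False by simp
qed

section \<open>Ultrafilters and a nonreflexive space\<close>

definition ultra :: "'a filter \<Rightarrow> bool" where
  "ultra F \<longleftrightarrow> F \<noteq> bot \<and> (\<forall>P. eventually P F \<or> eventually (\<lambda>x. \<not> P x) F)"

lemma ultrafilter_exists:
  assumes "F \<noteq> bot"
  obtains U where "ultra U" "U \<le> F"
proof -
  define A where "A = {G. G \<noteq> bot \<and> G \<le> F}"
  have "\<exists>m\<in>A. \<forall>a\<in>A. m \<ge> a \<longrightarrow> a = m"
  proof (rule predicate_Zorn)
    show "partial_order_on A (relation_of (\<ge>) A)"
      by (rule partial_order_on_relation_ofI) auto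
    fix C assume "C \<in> Chains (relation_of (\<ge>) A)"
    then have CA: "C \<subseteq> A" and chain: "\<And>p q. p \<in> C \<Longrightarrow> q \<in> C \<Longrightarrow> p \<le> q \<or> q \<le> p"
      unfolding Chains_def relation_of_def by blast+
    show "\<exists>u\<in>A. \<forall>a\<in>C. a \<ge> u"
    proof (cases "C = {}")
      case True
      then show ?thesis using assms by (auto simp: A_def)
    next
      case False
      have "eventually P (Inf C) \<longleftrightarrow> (\<exists>b\<in>C. eventually P b)" for P
      proof (rule eventually_Inf_base[OF False])
        fix p q assume "p \<in> C" "q \<in> C"
        then show "\<exists>x\<in>C. x \<le> inf p q" using chain[of p q] by auto
      qed
      then have "Inf C \<noteq> bot"
        using CA by (auto simp: A_def trivial_limit_def)
      moreover obtain b where "b \<in> C" using False by blast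
      then have "Inf C \<le> F" using CA by (auto simp: A_def intro: Inf_lower2)
      ultimately have "Inf C \<in> A" by (simp add: A_def)
      then show ?thesis by (auto intro: Inf_lower)
    qed
  qed
  then obtain U where "U \<in> A" and min: "\<And>a. a \<in> A \<Longrightarrow> a \<le> U \<Longrightarrow> a = U" by blast
  then have U: "U \<noteq> bot" "U \<le> F" by (auto simp: A_def)
  have "eventually P U" if "\<not> eventually (\<lambda>x. \<not> P x) U" for P
  proof -
    let ?G = "inf U (principal {x. P x})"
    have "?G \<noteq> bot"
      using that by (simp add: trivial_limit_def eventually_inf_principal)
    then have "?G \<in> A" using U by (auto simp: A_def intro: le_infI1)
    then have "?G = U" by (intro min) auto
    moreover have "eventually P ?G" by (simp add: eventually_inf_principal)
    ultimately show ?thesis by simp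
  qed
  then have "ultra U" using U by (auto simp: ultra_def)
  then show ?thesis using that U by blast
qed

lemma ultra_tendsto_Lim:
  fixes g :: "'a \<Rightarrow> real"
  assumes F: "ultra F" and b: "eventually (\<lambda>x. \<bar>g x\<bar> \<le> b) F"
  shows "(g \<longlongrightarrow> Lim F g) F"
proof -
  have nb: "F \<noteq> bot" using F by (simp add: ultra_def)
  have "filtermap g F \<noteq> bot" using nb by (simp add: filtermap_bot_iff)
  moreover have "eventually (\<lambda>y. y \<in> {-b..b}) (filtermap g F)"
    unfolding eventually_filtermap using b by eventually_elim (auto simp: abs_le_iff)
  ultimately obtain l where l: "inf (nhds l) (filtermap g F) \<noteq> bot"
    using compact_Icc[of "-b" b] unfolding compact_filter by blast
  have "(g \<longlongrightarrow> l) F"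
  proof (rule topological_tendstoI)
    fix U assume U: "open U" "l \<in> U"
    have "\<not> eventually (\<lambda>x. g x \<notin> U) F"
    proof
      assume "eventually (\<lambda>x. g x \<notin> U) F"
      then have "eventually (\<lambda>y. y \<notin> U) (filtermap g F)" by (simp add: eventually_filtermap)
      moreover have "eventually (\<lambda>y. y \<in> U) (nhds l)" using U by (auto simp: eventually_nhds)
      ultimately have "eventually (\<lambda>_. False) (inf (nhds l) (filtermap g F))"
        unfolding eventually_inf by blast
      with l show False by (simp add: trivial_limit_def)
    qed
    then show "eventually (\<lambda>x. g x \<in> U) F" using F by (auto simp: ultra_def)
  qed
  with tendsto_Lim[OF nb this] show ?thesis by simp
qed

lemma ultra_Lim_eq:
  fixes g :: "'a \<Rightarrow> real"
  assumes "ultra F" "(g \<longlongrightarrow> l) F"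
  shows "Lim F g = l"
  using assms by (intro tendsto_Lim) (auto simp: ultra_def)

text \<open>
  By Helly's theorem every basic weak-star neighbourhood of \<open>\<Phi>\<close> meets one fixed ball of \<open>E\<close>. The
  filter that these traces generate is refined to an ultrafilter, so that the limits along it
  of all bounded functions, and not only of the functionals, exist at once.
\<close>

lemma Goldstine_ultrafilter:
  assumes E: "normed_space E" and \<Phi>: "\<Phi> \<in> vecs (dual (dual E))"
  shows "\<exists>F B. ultra F \<and> 0 \<le> B \<and> eventually (\<lambda>y. y \<in> vecs E \<and> nrm E y \<le> B) F \<and>
    (\<forall>f\<in>vecs (dual E). (f \<longlongrightarrow> \<Phi> f) F)"
proof -
  note dE = normed_space_dual[OF E]
  define B where "B = nrm (dual (dual E)) \<Phi> + 1"
  have B: "0 \<le> B" using normed_space_nonneg[OF normed_space_dual[OF dE] \<Phi>] by (simp add: B_def)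
  define W where "W p = {y \<in> vecs E. nrm E y \<le> B \<and> (\<forall>f\<in>fst p. \<bar>f y - \<Phi> f\<bar> \<le> snd p)}" for p :: "('a \<Rightarrow> real) set \<times> real"
  define I :: "(('a \<Rightarrow> real) set \<times> real) set" where "I = {p. finite (fst p) \<and> fst p \<subseteq> vecs (dual E) \<and> 0 < snd p}"
  have ne: "W p \<noteq> {}" if p: "p \<in> I" for p
  proof -
    define \<epsilon> where "\<epsilon> = min 1 (snd p)"
    have S: "finite (fst p)" "\<And>f. f \<in> fst p \<Longrightarrow> f \<in> vecs (dual E)" and \<epsilon>: "0 < \<epsilon>"
      using p by (auto simp: I_def \<epsilon>_def)
    obtain x where "x \<in> vecs E" "nrm E x \<le> nrm (dual (dual E)) \<Phi> + \<epsilon>"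
      "\<And>f. f \<in> fst p \<Longrightarrow> \<bar>f x - \<Phi> f\<bar> \<le> \<epsilon>"
    proof (rule Helly_moments[of "vecs E" "fst p" \<epsilon> "nrm E" "\<lambda>f. f" \<Phi> "nrm (dual (dual E)) \<Phi>"])
      fix a assume a: "\<And>x. x \<in> vecs E \<Longrightarrow> (\<Sum>k\<in>fst p. a k * k x) \<le> nrm E x"
      let ?g = "\<Sum>k\<in>fst p. a k *\<^sub>R k"
      have g: "?g \<in> vecs (dual E)" using S by (intro vecs_sum[OF dE] vecs_scale[OF dE]) auto
      have app: "(\<Sum>k\<in>T. a k *\<^sub>R k) x = (\<Sum>k\<in>T. a k * k x)" for T x
        by (induction T rule: infinite_finite_induct) auto
      have "\<bar>?g x\<bar> \<le> 1 * nrm E x" if x: "x \<in> vecs E" for x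
      proof -
        have "- ?g x = ?g ((-1) *\<^sub>R x)" using dual_scaleR[OF g x, of "-1"] by simp
        also have "\<dots> \<le> nrm E ((-1) *\<^sub>R x)" using a[OF vecs_scale[OF E x]] app by metis
        also have "\<dots> = nrm E x" using normed_space_scaleR[OF E x, of "-1"] by simp
        finally have "- ?g x \<le> nrm E x" .
        moreover have "?g x \<le> nrm E x" using a[OF x] app by metis
        ultimately show ?thesis by simp
      qed
      then have "nrm (dual E) ?g \<le> 1" by (intro dual_norm_le[OF E]) auto
      then have "\<bar>\<Phi> ?g\<bar> \<le> nrm (dual (dual E)) \<Phi>"
        using dual_norm_bound[OF dE \<Phi> g]
          mult_left_mono[of "nrm (dual E) ?g" 1, OF _ normed_space_nonneg[OF normed_space_dual[OF dE] \<Phi>]]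
        by linarith
      moreover have "\<Phi> ?g = (\<Sum>k\<in>fst p. a k * \<Phi> k)"
        using S by (simp add: dual_sum[OF dE \<Phi>] dual_scaleR[OF \<Phi>] vecs_scale[OF dE])
      ultimately show "(\<Sum>k\<in>fst p. a k * \<Phi> k) \<le> nrm (dual (dual E)) \<Phi>" by simp
    qed (use S \<epsilon> normed_space_subspace[OF E] normed_space_nonneg[OF E] normed_space_triangle[OF E]
          normed_space_scaleR[OF E] dual_add[OF S(2)] dual_scaleR[OF S(2)] in auto)
    then have "x \<in> W p" by (fastforce simp: W_def B_def \<epsilon>_def)
    then show ?thesis by blast
  qed
  define F0 where "F0 = (INF p\<in>I. principal (W p))"
  have ev: "eventually P F0 \<longleftrightarrow> (\<exists>p\<in>I. eventually P (principal (W p)))" for P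
    unfolding F0_def
  proof (rule eventually_INF_base)
    have "({}, 1) \<in> I" by (simp add: I_def)
    then show "I \<noteq> {}" by blast
    fix p q assume "p \<in> I" "q \<in> I"
    then show "\<exists>r\<in>I. principal (W r) \<le> inf (principal (W p)) (principal (W q))"
      by (intro bexI[of _ "(fst p \<union> fst q, min (snd p) (snd q))"]) (auto simp: I_def W_def)
  qed
  have "F0 \<noteq> bot" using ne by (auto simp: trivial_limit_def ev eventually_principal)
  then obtain F where F: "ultra F" "F \<le> F0" using ultrafilter_exists by blast
  show ?thesis
  proof (intro exI[of _ F] exI[of _ B] conjI ballI F(1) B)
    have "({}, 1) \<in> I" by (simp add: I_def)
    then have "eventually (\<lambda>y. y \<in> vecs E \<and> nrm E y \<le> B) F0"
      unfolding ev eventually_principal by (rule bexI[rotated]) (simp add: W_def)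
    then show "eventually (\<lambda>y. y \<in> vecs E \<and> nrm E y \<le> B) F" using F(2) by (simp add: filter_leD)
    fix f assume f: "f \<in> vecs (dual E)"
    show "(f \<longlongrightarrow> \<Phi> f) F"
    proof (rule tendstoI)
      fix e :: real assume e: "0 < e"
      then have "({f}, e / 2) \<in> I" using f by (simp add: I_def)
      then have "eventually (\<lambda>y. dist (f y) (\<Phi> f) < e) F0"
        unfolding ev eventually_principal by (rule bexI[rotated]) (use e in \<open>auto simp: W_def dist_real_def\<close>)
      then show "eventually (\<lambda>y. dist (f y) (\<Phi> f) < e) F" using F(2) by (simp add: filter_leD)
    qed
  qed
qed

text \<open>
  Completeness makes the canonical image of \<open>E\<close> closed in the bidual, so an element of the bidual
  outside it has positive distance from it.
\<close>

lemma nonreflexive_distance: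
  assumes E: "banach_space E" and \<Phi>: "\<Phi> \<in> vecs (dual (dual E))"
    and far: "\<not> (\<exists>x\<in>vecs E. \<forall>f\<in>vecs (dual E). \<Phi> f = f x)"
  shows "\<exists>c>0. \<forall>v\<in>vecs E. \<exists>f\<in>vecs (dual E).
    (\<forall>x\<in>vecs E. \<bar>f x\<bar> \<le> nrm E x) \<and> c \<le> \<bar>\<Phi> f - f v\<bar>"
proof (rule ccontr)
  have nE: "normed_space E" using E by (simp add: banach_space_def)
  note dE = normed_space_dual[OF nE]
  assume none: "\<not> ?thesis"
  have "\<exists>v\<in>vecs E. \<forall>f\<in>vecs (dual E). (\<forall>x\<in>vecs E. \<bar>f x\<bar> \<le> nrm E x) \<longrightarrow> \<bar>\<Phi> f - f v\<bar> < c"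
    if "0 < c" for c
    using none that by (meson not_le)
  then have "\<exists>v\<in>vecs E. \<forall>f\<in>vecs (dual E). (\<forall>x\<in>vecs E. \<bar>f x\<bar> \<le> nrm E x) \<longrightarrow> \<bar>\<Phi> f - f v\<bar> < 1 / real (Suc n)" for n
    by simp
  then obtain \<sigma> where \<sigma>: "\<And>n. \<sigma> n \<in> vecs E"
    and near: "\<And>n f. f \<in> vecs (dual E) \<Longrightarrow> (\<forall>x\<in>vecs E. \<bar>f x\<bar> \<le> nrm E x) \<Longrightarrow> \<bar>\<Phi> f - f (\<sigma> n)\<bar> < 1 / real (Suc n)"
    by metis
  have cauchy: "\<exists>N. \<forall>m\<ge>N. \<forall>n\<ge>N. nrm E (\<sigma> m - \<sigma> n) < \<epsilon>" if \<epsilon>: "0 < \<epsilon>" for \<epsilon>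
  proof -
    obtain N where N: "1 / real (Suc N) < \<epsilon> / 2" using \<epsilon> nat_approx_posE[of "\<epsilon>/2"] by auto
    have "nrm E (\<sigma> m - \<sigma> n) < \<epsilon>" if mn: "N \<le> m" "N \<le> n" for m n
    proof -
      obtain f where f: "f \<in> vecs (dual E)" "\<And>x. x \<in> vecs E \<Longrightarrow> \<bar>f x\<bar> \<le> nrm E x"
        "f (\<sigma> m - \<sigma> n) = nrm E (\<sigma> m - \<sigma> n)"
        using norming_functional[OF nE vecs_diff[OF nE \<sigma> \<sigma>]] by metis
      have "1 / real (Suc m) \<le> 1 / real (Suc N)" "1 / real (Suc n) \<le> 1 / real (Suc N)"
        using mn by (auto intro!: divide_left_mono)
      moreover have "\<bar>\<Phi> f - f (\<sigma> k)\<bar> < 1 / real (Suc k)" for k using near[OF f(1)] f(2) by blast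
      note this[of m] this[of n]
      ultimately show ?thesis using f(3) N dual_diff[OF nE f(1) \<sigma>[of m] \<sigma>[of n]] by linarith
    qed
    then show ?thesis by blast
  qed
  obtain l where l: "l \<in> vecs E" "\<And>\<epsilon>. 0 < \<epsilon> \<Longrightarrow> \<exists>N. \<forall>n\<ge>N. nrm E (\<sigma> n - l) < \<epsilon>"
    using banach_limit[of E \<sigma>, OF E \<sigma> cauchy] by blast
  have unit: "\<Phi> f = f l" if f: "f \<in> vecs (dual E)" "\<And>x. x \<in> vecs E \<Longrightarrow> \<bar>f x\<bar> \<le> nrm E x" for f
  proof -
    have "\<bar>\<Phi> f - f l\<bar> \<le> \<epsilon>" if \<epsilon>: "0 < \<epsilon>" for \<epsilon>
    proof -
      obtain N1 where N1: "\<And>n. n \<ge> N1 \<Longrightarrow> nrm E (\<sigma> n - l) < \<epsilon> / 2" using l(2)[of "\<epsilon>/2"] \<epsilon> by auto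
      obtain N2 where N2: "1 / real (Suc N2) < \<epsilon> / 2" using \<epsilon> nat_approx_posE[of "\<epsilon>/2"] by auto
      define n where "n = max N1 N2"
      have "1 / real (Suc n) \<le> 1 / real (Suc N2)" by (auto simp: n_def intro!: divide_left_mono)
      moreover have "\<bar>\<Phi> f - f (\<sigma> n)\<bar> < 1 / real (Suc n)" using near[OF f(1)] f(2) by blast
      moreover have "nrm E (\<sigma> n - l) < \<epsilon> / 2" using N1 by (simp add: n_def)
      ultimately show ?thesis
        using N2 f(2)[OF vecs_diff[OF nE \<sigma>[of n] l(1)]] dual_diff[OF nE f(1) \<sigma>[of n] l(1)] by linarith
    qed
    then show ?thesis by (metis abs_le_zero_iff eq_iff_diff_eq_0 field_le_epsilon add_0)
  qed
  have "\<Phi> f = f l" if f: "f \<in> vecs (dual E)" for f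
  proof -
    define K where "K = nrm (dual E) f + 1"
    have K: "0 < K" using normed_space_nonneg[OF dE f] by (simp add: K_def)
    have "\<bar>((1 / K) *\<^sub>R f) x\<bar> \<le> nrm E x" if x: "x \<in> vecs E" for x
    proof -
      have "\<bar>f x\<bar> \<le> K * nrm E x"
        using dual_norm_bound[OF nE f x] normed_space_nonneg[OF nE x] by (simp add: K_def algebra_simps)
      then show ?thesis using K by (simp add: field_simps)
    qed
    then have "\<Phi> ((1 / K) *\<^sub>R f) = ((1 / K) *\<^sub>R f) l" by (intro unit vecs_scale[OF dE f])
    then show ?thesis using K by (simp add: dual_scaleR[OF \<Phi> f])
  qed
  with l(1) far show False by blast
qed

section \<open>A spreading seminorm\<close>

definition supp :: "(rat \<Rightarrow> real) \<Rightarrow> rat set" where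
  "supp x = {t. x t \<noteq> 0}"

definition c00 :: "(rat \<Rightarrow> real) set" where
  "c00 = {x. finite (supp x)}"

definition unit_at :: "rat \<Rightarrow> rat \<Rightarrow> real" where
  "unit_at t = (\<lambda>s. if s = t then 1 else 0)"

lemma supp_add: "supp (x + y) \<subseteq> supp x \<union> supp y"
  and supp_scale: "supp (a *\<^sub>R x) \<subseteq> supp x"
  and supp_unit: "supp (unit_at t) = {t}"
  by (auto simp: supp_def unit_at_def)

lemma subspace_c00: "subspace c00"
  unfolding subspace_def c00_def
  using finite_subset[OF supp_add] finite_subset[OF supp_scale]
  by (auto simp: supp_def)

lemma unit_in_c00: "unit_at t \<in> c00"
  by (simp add: c00_def supp_unit)

lemma sum_apply: "(\<Sum>i\<in>I. g i) t = (\<Sum>i\<in>I. g i t)" for g :: "'i \<Rightarrow> 'a \<Rightarrow> real"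
  by (induction I rule: infinite_finite_induct) auto

lemma c00_expand:
  assumes "finite S" "supp x \<subseteq> S"
  shows "x = (\<Sum>t\<in>S. x t *\<^sub>R unit_at t)"
proof
  fix s
  have "(\<Sum>t\<in>S. (x t *\<^sub>R unit_at t) s) = (\<Sum>t\<in>S. if t = s then x s else 0)"
    by (rule sum.cong) (auto simp: unit_at_def)
  also have "\<dots> = x s" using assms by (auto simp: supp_def)
  finally show "x s = (\<Sum>t\<in>S. x t *\<^sub>R unit_at t) s" by (simp add: sum_apply)
qed

text \<open>
  Only the order of the coefficients of \<open>x\<close> matters for \<open>Q x\<close> (\<open>Q_spread\<close>). The bound on the sums
  over upper sets (\<open>Q_tail\<close>) is what remains of nonreflexivity: it makes the indicators of rays
  bounded functionals.
\<close>

locale spreading_seminorm =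
  fixes Q :: "(rat \<Rightarrow> real) \<Rightarrow> real" and B c :: real
  assumes c_pos: "0 < c"
    and Q_nonneg: "x \<in> c00 \<Longrightarrow> 0 \<le> Q x"
    and Q_add: "x \<in> c00 \<Longrightarrow> y \<in> c00 \<Longrightarrow> Q (x + y) \<le> Q x + Q y"
    and Q_scale: "x \<in> c00 \<Longrightarrow> Q (a *\<^sub>R x) = \<bar>a\<bar> * Q x"
    and Q_unit: "Q (unit_at t) \<le> B"
    and Q_tail: "x \<in> c00 \<Longrightarrow> (\<And>s t. s \<in> U \<Longrightarrow> s \<le> t \<Longrightarrow> t \<in> U) \<Longrightarrow> c * \<bar>\<Sum>t\<in>supp x \<inter> U. x t\<bar> \<le> Q x"
    and Q_spread: "finite S \<Longrightarrow> strict_mono_on S h \<Longrightarrow>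
      Q (\<Sum>t\<in>S. w t *\<^sub>R unit_at (h t)) = Q (\<Sum>t\<in>S. w t *\<^sub>R unit_at t)"

text \<open>
  The head of the list belongs to the outermost limit: its vector is chosen first, and the
  vectors of the later coefficients are chosen much further along the filter.
\<close>

fun iter_norm :: "'y::real_vector nspace \<Rightarrow> 'y filter \<Rightarrow> real list \<Rightarrow> 'y \<Rightarrow> real" where
  "iter_norm Y F [] v = nrm Y v"
| "iter_norm Y F (a # as) v = Lim F (\<lambda>y. iter_norm Y F as (v + a *\<^sub>R y))"

text \<open>
  The last condition says that the distance of \<open>\<Phi>\<close> from \<open>Y\<close> in the bidual is at least \<open>c\<close>.
\<close>

locale weak_star_limit =
  fixes Y :: "'y::real_vector nspace" and F :: "'y filter" and B c :: real
    and \<Phi> :: "('y \<Rightarrow> real) \<Rightarrow> real"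
  assumes normed: "normed_space Y"
    and F_ultra: "ultra F" and B_nonneg: "0 \<le> B"
    and F_bounded: "eventually (\<lambda>y. y \<in> vecs Y \<and> nrm Y y \<le> B) F"
    and F_tendsto: "f \<in> vecs (dual Y) \<Longrightarrow> (f \<longlongrightarrow> \<Phi> f) F"
    and c_pos: "0 < c"
    and far: "v \<in> vecs Y \<Longrightarrow>
      \<exists>f\<in>vecs (dual Y). (\<forall>x\<in>vecs Y. \<bar>f x\<bar> \<le> nrm Y x) \<and> c \<le> \<bar>\<Phi> f - f v\<bar>"
begin

abbreviation "iter \<equiv> iter_norm Y F"

lemma F_nontrivial: "F \<noteq> bot"
  using F_ultra by (simp add: ultra_def)

lemma F_vecs: "eventually (\<lambda>y. y \<in> vecs Y) F"
  using F_bounded by eventually_elim simp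

lemma step_vecs: "v \<in> vecs Y \<Longrightarrow> y \<in> vecs Y \<Longrightarrow> v + a *\<^sub>R y \<in> vecs Y"
  by (intro vecs_add[OF normed] vecs_scale[OF normed])

lemma
  assumes "v \<in> vecs Y"
  shows iter_nonneg: "0 \<le> iter as v"
    and iter_upper: "iter as v \<le> nrm Y v + B * (\<Sum>a\<leftarrow>as. \<bar>a\<bar>)"
    and iter_tendsto: "((\<lambda>y. iter as (v + b *\<^sub>R y)) \<longlongrightarrow> iter (b # as) v) F"
proof -
  have lim: "((\<lambda>y. iter as (v + b *\<^sub>R y)) \<longlongrightarrow> iter (b # as) v) F"
    and ev: "eventually (\<lambda>y. 0 \<le> iter as (v + b *\<^sub>R y) \<and>
        iter as (v + b *\<^sub>R y) \<le> nrm Y v + \<bar>b\<bar> * B + B * (\<Sum>a\<leftarrow>as. \<bar>a\<bar>)) F"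
    if v: "v \<in> vecs Y"
      and IH: "\<And>v. v \<in> vecs Y \<Longrightarrow> 0 \<le> iter as v \<and> iter as v \<le> nrm Y v + B * (\<Sum>a\<leftarrow>as. \<bar>a\<bar>)" for v b as
  proof -
    have ev0: "eventually (\<lambda>y. 0 \<le> iter as (v + b *\<^sub>R y) \<and>
        iter as (v + b *\<^sub>R y) \<le> nrm Y v + \<bar>b\<bar> * B + B * (\<Sum>a\<leftarrow>as. \<bar>a\<bar>)) F"
      using F_bounded
    proof eventually_elim
      case (elim y)
      then have y: "y \<in> vecs Y" and "\<bar>b\<bar> * nrm Y y \<le> \<bar>b\<bar> * B" by (auto intro: mult_left_mono)
      moreover have "nrm Y (v + b *\<^sub>R y) \<le> nrm Y v + \<bar>b\<bar> * nrm Y y"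
        using normed_space_triangle[OF normed v vecs_scale[OF normed y]] normed_space_scaleR[OF normed y] by simp
      ultimately show ?case using IH[OF step_vecs[OF v y, of b]] by simp
    qed
    show "eventually (\<lambda>y. 0 \<le> iter as (v + b *\<^sub>R y) \<and>
        iter as (v + b *\<^sub>R y) \<le> nrm Y v + \<bar>b\<bar> * B + B * (\<Sum>a\<leftarrow>as. \<bar>a\<bar>)) F"
      by (rule ev0)
    show "((\<lambda>y. iter as (v + b *\<^sub>R y)) \<longlongrightarrow> iter (b # as) v) F"
      unfolding iter_norm.simps
      by (rule ultra_tendsto_Lim[OF F_ultra], rule eventually_mono[OF ev0], subst abs_of_nonneg) auto
  qed
  have both: "0 \<le> iter as v \<and> iter as v \<le> nrm Y v + B * (\<Sum>a\<leftarrow>as. \<bar>a\<bar>)" if "v \<in> vecs Y" for v as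
    using that
  proof (induction as arbitrary: v)
    case Nil
    then show ?case using normed_space_nonneg[OF normed] by simp
  next
    case (Cons b as)
    have lim': "((\<lambda>y. iter as (v + b *\<^sub>R y)) \<longlongrightarrow> iter (b # as) v) F"
      by (rule lim[OF Cons.prems Cons.IH])
    have ev': "eventually (\<lambda>y. 0 \<le> iter as (v + b *\<^sub>R y) \<and>
        iter as (v + b *\<^sub>R y) \<le> nrm Y v + \<bar>b\<bar> * B + B * (\<Sum>a\<leftarrow>as. \<bar>a\<bar>)) F"
      by (rule ev[OF Cons.prems Cons.IH])
    have "0 \<le> iter (b # as) v"
      by (rule tendsto_lowerbound[OF lim' _ F_nontrivial]) (rule eventually_mono[OF ev'], auto)
    moreover have "iter (b # as) v \<le> nrm Y v + \<bar>b\<bar> * B + B * (\<Sum>a\<leftarrow>as. \<bar>a\<bar>)"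
      by (rule tendsto_upperbound[OF lim' _ F_nontrivial]) (rule eventually_mono[OF ev'], auto)
    ultimately show ?case by (simp add: algebra_simps)
  qed
  from both[OF assms, of as] show "0 \<le> iter as v" "iter as v \<le> nrm Y v + B * (\<Sum>a\<leftarrow>as. \<bar>a\<bar>)" by auto
  show "((\<lambda>y. iter as (v + b *\<^sub>R y)) \<longlongrightarrow> iter (b # as) v) F"
    by (rule lim[OF assms both])
qed

lemma iter_add:
  assumes "v \<in> vecs Y" "w \<in> vecs Y"
  shows "iter (map (\<lambda>i. x i + y i) ts) (v + w) \<le> iter (map x ts) v + iter (map y ts) w"
  using assms
proof (induction ts arbitrary: v w)
  case Nil
  then show ?case using normed_space_triangle[OF normed] by simp
next
  case (Cons i ts)
  have "eventually (\<lambda>u. iter (map (\<lambda>i. x i + y i) ts) ((v + w) + (x i + y i) *\<^sub>R u)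
      \<le> iter (map x ts) (v + x i *\<^sub>R u) + iter (map y ts) (w + y i *\<^sub>R u)) F"
    using F_vecs
  proof eventually_elim
    case (elim u)
    have "(v + w) + (x i + y i) *\<^sub>R u = (v + x i *\<^sub>R u) + (w + y i *\<^sub>R u)" by (simp add: algebra_simps)
    then show ?case
      using Cons.IH[OF step_vecs[OF Cons.prems(1) elim, of "x i"] step_vecs[OF Cons.prems(2) elim, of "y i"]]
      by (simp only:)
  qed
  from tendsto_le[OF F_nontrivial
      tendsto_add[OF iter_tendsto[OF Cons.prems(1)] iter_tendsto[OF Cons.prems(2)]]
      iter_tendsto[OF vecs_add[OF normed Cons.prems]] this]
  show ?case by (simp only: list.map)
qed

lemma iter_scale:
  assumes "v \<in> vecs Y"
  shows "iter (map (\<lambda>i. a * x i) ts) (a *\<^sub>R v) = \<bar>a\<bar> * iter (map x ts) v"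
  using assms
proof (induction ts arbitrary: v)
  case Nil
  then show ?case using normed_space_scaleR[OF normed] by simp
next
  case (Cons i ts)
  have lim: "((\<lambda>u. \<bar>a\<bar> * iter (map x ts) (v + x i *\<^sub>R u)) \<longlongrightarrow> \<bar>a\<bar> * iter (x i # map x ts) v) F"
    by (intro tendsto_mult tendsto_const iter_tendsto Cons.prems)
  have "eventually (\<lambda>u. \<bar>a\<bar> * iter (map x ts) (v + x i *\<^sub>R u)
      = iter (map (\<lambda>i. a * x i) ts) (a *\<^sub>R v + (a * x i) *\<^sub>R u)) F"
    using F_vecs
  proof eventually_elim
    case (elim u)
    show ?case
      using Cons.IH[OF step_vecs[OF Cons.prems elim, of "x i"]] by (simp add: scaleR_add_right)
  qed
  from Lim_transform_eventually[OF lim this] show ?case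
    by (simp add: ultra_Lim_eq[OF F_ultra])
qed

text \<open>
  A limit of a constant is that constant. This is the reason why iterated limits see only the
  order of the nonzero coefficients and not the positions they occupy.
\<close>

lemma iter_skip_zeros: "iter (filter (\<lambda>a. a \<noteq> 0) as) v = iter as v"
  by (induction as arbitrary: v) (simp_all add: ultra_Lim_eq[OF F_ultra tendsto_const])

lemma iter_lower:
  assumes f: "f \<in> vecs (dual Y)" "\<And>x. x \<in> vecs Y \<Longrightarrow> \<bar>f x\<bar> \<le> nrm Y x" and v: "v \<in> vecs Y"
  shows "\<bar>f v + sum_list as * \<Phi> f\<bar> \<le> iter as v"
  using v
proof (induction as arbitrary: v)
  case Nil
  then show ?case using f by simp
next
  case (Cons a as)
  have lim: "((\<lambda>u. \<bar>f v + a * f u + sum_list as * \<Phi> f\<bar>) \<longlongrightarrow> \<bar>f v + a * \<Phi> f + sum_list as * \<Phi> f\<bar>) F"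
    by (intro tendsto_intros F_tendsto f)
  have "eventually (\<lambda>u. \<bar>f v + a * f u + sum_list as * \<Phi> f\<bar> \<le> iter as (v + a *\<^sub>R u)) F"
    using F_vecs
  proof eventually_elim
    case (elim u)
    then show ?case
      using Cons.IH[OF step_vecs[OF Cons.prems elim, of a]] Cons.prems
      by (simp add: dual_add[OF f(1)] dual_scaleR[OF f(1)] vecs_scale[OF normed])
  qed
  from tendsto_le[OF F_nontrivial iter_tendsto[OF Cons.prems] lim this]
  show ?case by (simp add: algebra_simps)
qed

text \<open>
  The norm is weak-star lower semicontinuous, so with \<open>s = sum_list bs\<close> the iterated limit is at
  least the bidual norm of \<open>v + s * \<Phi>\<close>, which is \<open>\<bar>s\<bar>\<close> times the distance of \<open>\<Phi>\<close> from the
  vector \<open>- v / s\<close> of \<open>Y\<close>. The coefficients \<open>as\<close> only move \<open>v\<close> within \<open>Y\<close>.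
\<close>

lemma iter_tail:
  assumes "v \<in> vecs Y"
  shows "c * \<bar>sum_list bs\<bar> \<le> iter (as @ bs) v"
  using assms
proof (induction as arbitrary: v)
  case Nil
  define s where "s = sum_list bs"
  show ?case
  proof (cases "s = 0")
    case True
    then show ?thesis using iter_nonneg[OF Nil] by (simp add: s_def)
  next
    case False
    obtain f where f: "f \<in> vecs (dual Y)" "\<And>x. x \<in> vecs Y \<Longrightarrow> \<bar>f x\<bar> \<le> nrm Y x"
      "c \<le> \<bar>\<Phi> f - f ((- 1 / s) *\<^sub>R v)\<bar>"
      using far[OF vecs_scale[OF normed Nil, of "- 1 / s"]] by blast
    have "c * \<bar>s\<bar> \<le> \<bar>\<Phi> f - f ((- 1 / s) *\<^sub>R v)\<bar> * \<bar>s\<bar>"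
      using f(3) by (intro mult_right_mono) auto
    also have "\<dots> = \<bar>(\<Phi> f - f ((- 1 / s) *\<^sub>R v)) * s\<bar>" by (simp add: abs_mult)
    also have "(\<Phi> f - f ((- 1 / s) *\<^sub>R v)) * s = f v + s * \<Phi> f"
      using dual_scaleR[OF f(1) Nil, of "- 1 / s"] False by (simp add: field_simps)
    finally show ?thesis using iter_lower[OF f(1,2) Nil, of bs] by (simp add: s_def)
  qed
next
  case (Cons a as)
  have "eventually (\<lambda>u. c * \<bar>sum_list bs\<bar> \<le> iter (as @ bs) (v + a *\<^sub>R u)) F"
    using F_vecs by eventually_elim (use Cons.IH step_vecs[OF Cons.prems] in blast)
  from tendsto_lowerbound[OF iter_tendsto[OF Cons.prems] this F_nontrivial]
  show ?case by simp
qed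

text \<open>
  The points are chosen one after the other, the outermost first; each choice spends half of the
  remaining tolerance, for all members of \<open>A\<close> at the same time.
\<close>

lemma iter_realise:
  assumes "finite A" "distinct ts" "\<And>x. x \<in> A \<Longrightarrow> w x \<in> vecs Y" "0 < \<epsilon>"
  shows "\<exists>y. (\<forall>t. y t \<in> vecs Y) \<and>
    (\<forall>x\<in>A. \<bar>nrm Y (w x + (\<Sum>t\<in>set ts. x t *\<^sub>R y t)) - iter (map x ts) (w x)\<bar> < \<epsilon>)"
  using assms(2-)
proof (induction ts arbitrary: w \<epsilon>)
  case Nil
  then show ?case using vecs_zero[OF normed] by (intro exI[of _ "\<lambda>_. 0"]) simp
next
  case (Cons t ts)
  have "eventually (\<lambda>u. \<forall>x\<in>A. dist (iter (map x ts) (w x + x t *\<^sub>R u)) (iter (x t # map x ts) (w x)) < \<epsilon> / 2) F"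
    using assms(1)
  proof (rule eventually_ball_finite, intro ballI)
    fix x assume "x \<in> A"
    then show "eventually (\<lambda>u. dist (iter (map x ts) (w x + x t *\<^sub>R u)) (iter (x t # map x ts) (w x)) < \<epsilon> / 2) F"
      using iter_tendsto[OF Cons.prems(2)] Cons.prems(3) by (intro tendstoD) auto
  qed
  with F_vecs have "eventually (\<lambda>u. u \<in> vecs Y \<and> (\<forall>x\<in>A. dist (iter (map x ts) (w x + x t *\<^sub>R u))
      (iter (x t # map x ts) (w x)) < \<epsilon> / 2)) F"
    by eventually_elim blast
  from eventually_happens'[OF F_nontrivial this] obtain u where u: "u \<in> vecs Y"
    and close: "\<And>x. x \<in> A \<Longrightarrow> dist (iter (map x ts) (w x + x t *\<^sub>R u)) (iter (x t # map x ts) (w x)) < \<epsilon> / 2"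
    by blast
  have "distinct ts" "0 < \<epsilon> / 2" using Cons.prems by auto
  then obtain y where y: "\<And>t. y t \<in> vecs Y"
    and y': "\<And>x. x \<in> A \<Longrightarrow> \<bar>nrm Y ((w x + x t *\<^sub>R u) + (\<Sum>t\<in>set ts. x t *\<^sub>R y t)) - iter (map x ts) (w x + x t *\<^sub>R u)\<bar> < \<epsilon> / 2"
    using Cons.IH[of "\<lambda>x. w x + x t *\<^sub>R u" "\<epsilon> / 2"] step_vecs[OF Cons.prems(2) u] by blast
  have "\<bar>nrm Y (w x + (\<Sum>s\<in>set (t # ts). x s *\<^sub>R (y(t := u)) s)) - iter (map x (t # ts)) (w x)\<bar> < \<epsilon>"
    if x: "x \<in> A" for x
  proof -
    have "(\<Sum>s\<in>set ts. x s *\<^sub>R (y(t := u)) s) = (\<Sum>s\<in>set ts. x s *\<^sub>R y s)"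
      using Cons.prems(1) by (intro sum.cong) auto
    then have eq: "w x + (\<Sum>s\<in>set (t # ts). x s *\<^sub>R (y(t := u)) s) = (w x + x t *\<^sub>R u) + (\<Sum>t\<in>set ts. x t *\<^sub>R y t)"
      using Cons.prems(1) by (simp add: add.assoc)
    show ?thesis using y'[OF x] close[OF x] unfolding dist_real_def list.map eq by linarith
  qed
  moreover have "(y(t := u)) s \<in> vecs Y" for s using y u by simp
  ultimately show ?case by blast
qed

definition Q :: "(rat \<Rightarrow> real) \<Rightarrow> real" where
  "Q x = iter (map x (sorted_list_of_set (supp x))) 0"

lemma Q_eq:
  assumes S: "finite S" "supp x \<subseteq> S"
  shows "Q x = iter (map x (sorted_list_of_set S)) 0"
proof -
  have "sorted_list_of_set (supp x) = filter (\<lambda>t. x t \<noteq> 0) (sorted_list_of_set S)"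
    using S by (intro sorted_distinct_set_unique) (auto simp: sorted_wrt_filter supp_def finite_subset)
  then have "map x (sorted_list_of_set (supp x)) = filter (\<lambda>a. a \<noteq> 0) (map x (sorted_list_of_set S))"
    by (simp add: filter_map o_def)
  then show ?thesis by (simp add: Q_def iter_skip_zeros)
qed

lemma spreading: "spreading_seminorm Q B c"
proof
  note z = vecs_zero[OF normed]
  show "0 < c" by (rule c_pos)
  show "0 \<le> Q x" for x unfolding Q_def by (rule iter_nonneg[OF z])
  show "Q (x + y) \<le> Q x + Q y" if "x \<in> c00" "y \<in> c00" for x y
  proof -
    let ?S = "supp x \<union> supp y"
    have S: "finite ?S" using that by (simp add: c00_def)
    have "Q (x + y) = iter (map (\<lambda>t. x t + y t) (sorted_list_of_set ?S)) (0 + 0)"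
      using Q_eq[OF S supp_add] by (simp add: plus_fun_def)
    also have "\<dots> \<le> iter (map x (sorted_list_of_set ?S)) 0 + iter (map y (sorted_list_of_set ?S)) 0"
      by (rule iter_add[OF z z])
    also have "\<dots> = Q x + Q y" using Q_eq[OF S, of x] Q_eq[OF S, of y] by simp
    finally show ?thesis .
  qed
  show "Q (a *\<^sub>R x) = \<bar>a\<bar> * Q x" if "x \<in> c00" for a x
  proof -
    have S: "finite (supp x)" using that by (simp add: c00_def)
    have "Q (a *\<^sub>R x) = iter (map (\<lambda>t. a * x t) (sorted_list_of_set (supp x))) (a *\<^sub>R 0)"
      using Q_eq[OF S supp_scale] by (simp add: scaleR_fun_def)
    also have "\<dots> = \<bar>a\<bar> * Q x" unfolding Q_def by (rule iter_scale[OF z])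
    finally show ?thesis .
  qed
  show "Q (unit_at t) \<le> B" for t
    unfolding Q_def supp_unit using iter_upper[OF z, of "[1]"] nrm_zero[OF normed] by (simp add: unit_at_def)
  show "c * \<bar>\<Sum>t\<in>supp x \<inter> U. x t\<bar> \<le> Q x"
    if x: "x \<in> c00" and U: "\<And>s t. s \<in> U \<Longrightarrow> s \<le> t \<Longrightarrow> t \<in> U" for x U
  proof -
    have S: "finite (supp x)" using x by (simp add: c00_def)
    let ?l = "\<lambda>A. sorted_list_of_set A"
    have "?l (supp x) = ?l (supp x - U) @ ?l (supp x \<inter> U)"
      using S U by (intro sorted_distinct_set_unique) (auto simp: sorted_append intro: le_cases)
    then have "Q x = iter (map x (?l (supp x - U)) @ map x (?l (supp x \<inter> U))) 0" by (simp add: Q_def)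
    moreover have "sum_list (map x (?l (supp x \<inter> U))) = (\<Sum>t\<in>supp x \<inter> U. x t)"
      using S by (subst sum_list_distinct_conv_sum_set) auto
    ultimately show ?thesis using iter_tail[OF z] by metis
  qed
  show "Q (\<Sum>t\<in>S. a t *\<^sub>R unit_at (h t)) = Q (\<Sum>t\<in>S. a t *\<^sub>R unit_at t)"
    if S: "finite S" and h: "strict_mono_on S h" for S h a
  proof -
    have inj: "inj_on h S" using h by (rule strict_mono_on_imp_inj_on)
    let ?x = "\<Sum>t\<in>S. a t *\<^sub>R unit_at t" and ?y = "\<Sum>t\<in>S. a t *\<^sub>R unit_at (h t)"
    have x: "?x s = (if s \<in> S then a s else 0)" for s
    proof -
      have "(\<Sum>t\<in>S. (a t *\<^sub>R unit_at t) s) = (\<Sum>t\<in>S. if t = s then a s else 0)"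
        by (rule sum.cong) (auto simp: unit_at_def)
      then show ?thesis using S by (simp add: sum_apply)
    qed
    have y: "?y (h s) = a s" if s: "s \<in> S" for s
    proof -
      have "(\<Sum>t\<in>S. (a t *\<^sub>R unit_at (h t)) (h s)) = (\<Sum>t\<in>S. if t = s then a s else 0)"
        by (rule sum.cong) (use s inj in \<open>auto simp: unit_at_def inj_on_def\<close>)
      then show ?thesis using S s by (simp add: sum_apply)
    qed
    have "?y s = 0" if "s \<notin> h ` S" for s
      unfolding sum_apply by (rule sum.neutral) (use that in \<open>auto simp: unit_at_def\<close>)
    then have sy: "supp ?y \<subseteq> h ` S" unfolding supp_def by blast
    have sx: "supp ?x \<subseteq> S" unfolding supp_def x by auto
    have "sorted_list_of_set (h ` S) = map h (sorted_list_of_set S)"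
    proof (rule sorted_distinct_set_unique)
      show "sorted (map h (sorted_list_of_set S))"
        unfolding sorted_map
        by (rule sorted_wrt_mono_rel[OF _ sorted_sorted_list_of_set[of S]])
          (use h S in \<open>auto simp: strict_mono_on_def le_less\<close>)
    qed (use S inj in \<open>auto simp: distinct_map\<close>)
    then have "map ?y (sorted_list_of_set (h ` S)) = map ?x (sorted_list_of_set S)"
      using y x S by simp
    then show ?thesis using Q_eq[OF S sx] Q_eq[OF finite_imageI[OF S] sy] by metis
  qed
qed

lemma Q_realise:
  assumes A: "finite A" "A \<subseteq> c00" and \<epsilon>: "0 < \<epsilon>" and S: "finite S" "\<And>x. x \<in> A \<Longrightarrow> supp x \<subseteq> S"
  obtains y where "\<And>t. y t \<in> vecs Y" "\<And>x. x \<in> A \<Longrightarrow> \<bar>nrm Y (\<Sum>t\<in>S. x t *\<^sub>R y t) - Q x\<bar> < \<epsilon>"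
proof -
  obtain y where "\<And>t. y t \<in> vecs Y"
    "\<And>x. x \<in> A \<Longrightarrow> \<bar>nrm Y (0 + (\<Sum>t\<in>set (sorted_list_of_set S). x t *\<^sub>R y t)) - iter (map x (sorted_list_of_set S)) 0\<bar> < \<epsilon>"
    using iter_realise[OF A(1), of "sorted_list_of_set S" "\<lambda>_. 0" \<epsilon>] \<epsilon> vecs_zero[OF normed] by auto
  then show ?thesis using S Q_eq[OF S(1) S(2)] by (intro that[of y]) auto
qed

end

section \<open>The separable space with nonseparable dual\<close>

text \<open>
  Sequences indexed by \<open>nat\<close> stand for functions on the rationals through this bijection.
\<close>

definition idx :: "rat \<Rightarrow> nat" where
  "idx = to_nat_on UNIV"

lemma bij_idx: "bij idx"
  unfolding idx_def by (rule to_nat_on_infinite) (auto simp: infinite_UNIV_char_0)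

lemma inv_idx [simp]: "inv idx (idx t) = t"
  by (simp add: bij_is_inj[OF bij_idx])

lemma idx_cases: obtains t where "n = idx t"
  using bij_is_surj[OF bij_idx] by (metis surjD)

definition pairing :: "(nat \<Rightarrow> real) \<Rightarrow> (rat \<Rightarrow> real) \<Rightarrow> real" where
  "pairing \<phi> x = (\<Sum>t\<in>supp x. x t * \<phi> (idx t))"

lemma pairing_eq: "finite S \<Longrightarrow> supp x \<subseteq> S \<Longrightarrow> pairing \<phi> x = (\<Sum>t\<in>S. x t * \<phi> (idx t))"
  unfolding pairing_def by (rule sum.mono_neutral_left) (auto simp: supp_def)

lemma
  shows pairing_add_left: "pairing (\<phi> + \<psi>) x = pairing \<phi> x + pairing \<psi> x"
    and pairing_scale_left: "pairing (a *\<^sub>R \<phi>) x = a * pairing \<phi> x"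
    and pairing_zero_left: "pairing 0 x = 0"
    and pairing_unit: "pairing \<phi> (unit_at t) = \<phi> (idx t)"
proof -
  show "pairing \<phi> (unit_at t) = \<phi> (idx t)"
    unfolding pairing_def supp_unit by (simp add: unit_at_def)
qed (simp_all add: pairing_def sum.distrib sum_distrib_left algebra_simps)

lemma pairing_sum_left: "pairing (\<Sum>k\<in>K. g k) x = (\<Sum>k\<in>K. pairing (g k) x)"
  by (induction K rule: infinite_finite_induct)
    (simp_all only: sum.infinite sum.empty sum.insert pairing_add_left pairing_zero_left not_False_eq_True)

lemma pairing_add_right:
  assumes "x \<in> c00" "y \<in> c00"
  shows "pairing \<phi> (x + y) = pairing \<phi> x + pairing \<phi> y"
proof -
  let ?S = "supp x \<union> supp y"
  have S: "finite ?S" using assms by (simp add: c00_def)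
  show ?thesis
    using pairing_eq[OF S supp_add] pairing_eq[OF S, of x \<phi>] pairing_eq[OF S, of y \<phi>]
    by (simp add: sum.distrib algebra_simps)
qed

lemma pairing_scale_right:
  assumes "x \<in> c00"
  shows "pairing \<phi> (a *\<^sub>R x) = a * pairing \<phi> x"
proof -
  have S: "finite (supp x)" using assms by (simp add: c00_def)
  show ?thesis
    using pairing_eq[OF S supp_scale] by (simp add: pairing_def sum_distrib_left algebra_simps)
qed

lemma pairing_sum_right:
  assumes "\<And>k. k \<in> K \<Longrightarrow> g k \<in> c00"
  shows "pairing \<phi> (\<Sum>k\<in>K. g k) = (\<Sum>k\<in>K. pairing \<phi> (g k))"
  using assms
proof (induction K rule: infinite_finite_induct)
  case (insert k K)
  have "sum g (insert k K) = g k + sum g K" by (rule sum.insert[OF insert(1,2)])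
  moreover have "sum g K \<in> c00" using insert by (intro subspace_sum[OF subspace_c00]) auto
  moreover have "pairing \<phi> (sum g K) = (\<Sum>k\<in>K. pairing \<phi> (g k))" using insert by simp
  ultimately show ?case
    using insert(1,2) insert(4)[OF insertI1] by (simp only: pairing_add_right sum.insert not_False_eq_True)
qed (simp_all add: pairing_def supp_def)

text \<open>
  The cells of \<open>P\<close> are the maximal sets of rationals that no point of \<open>P\<close> separates: half-open
  intervals, closed on the left, and one that is unbounded below. The number of a cell is the
  number of points of \<open>P\<close> to its left, its own left end included.
\<close>

definition cell :: "rat set \<Rightarrow> rat \<Rightarrow> nat" where
  "cell P t = card {p \<in> P. p \<le> t}"

definition cell_fun :: "rat set \<Rightarrow> nat \<Rightarrow> nat \<Rightarrow> real" where
  "cell_fun P k n = (if cell P (inv idx n) = k then 1 else 0)"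

definition cells :: "rat set \<Rightarrow> nat set" where
  "cells P = range (cell P)"

definition rep :: "rat set \<Rightarrow> nat \<Rightarrow> rat" where
  "rep P k = (SOME t. cell P t = k)"

definition step_funs :: "rat set \<Rightarrow> (nat \<Rightarrow> real) set" where
  "step_funs P = {\<phi>. \<forall>s t. cell P s = cell P t \<longrightarrow> \<phi> (idx s) = \<phi> (idx t)}"

lemma cell_fun_idx [simp]: "cell_fun P k (idx t) = (if cell P t = k then 1 else 0)"
  by (simp add: cell_fun_def)

lemma cell_mono: "finite P \<Longrightarrow> s \<le> t \<Longrightarrow> cell P s \<le> cell P t"
  unfolding cell_def by (intro card_mono) auto

lemma cells_finite: "finite P \<Longrightarrow> finite (cells P)"
proof -
  assume "finite P"
  then have "cells P \<subseteq> {..card P}" by (auto simp: cells_def cell_def intro: card_mono)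
  then show ?thesis by (rule finite_subset) simp
qed

lemma cell_rep: "k \<in> cells P \<Longrightarrow> cell P (rep P k) = k"
  unfolding cells_def rep_def by (auto intro: someI)

lemma cell_in_cells [simp]: "cell P t \<in> cells P"
  by (simp add: cells_def)

lemma cell_refine:
  assumes fin: "finite P'" and sub: "P \<subseteq> P'" and eq: "cell P' s = cell P' t"
  shows "cell P s = cell P t"
proof -
  have "{p \<in> P'. p \<le> s} = {p \<in> P'. p \<le> t}"
  proof (cases "s \<le> t")
    case True
    then show ?thesis using fin eq unfolding cell_def by (intro card_subset_eq) auto
  next
    case False
    then show ?thesis using fin eq unfolding cell_def by (intro card_subset_eq[symmetric]) auto
  qed
  then have "{p \<in> P. p \<le> s} = {p \<in> P. p \<le> t}" using sub by auto
  then show ?thesis by (simp add: cell_def)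
qed

lemma step_funs_mono: "finite P' \<Longrightarrow> P \<subseteq> P' \<Longrightarrow> step_funs P \<subseteq> step_funs P'"
  unfolding step_funs_def using cell_refine by blast

lemma cell_fun_step: "cell_fun P k \<in> step_funs P"
  by (simp add: step_funs_def)

lemma subspace_step_funs: "subspace (step_funs P)"
proof (rule subspaceI)
  show "0 \<in> step_funs P" by (simp add: step_funs_def)
  fix \<phi> assume \<phi>: "\<phi> \<in> step_funs P"
  show "\<phi> + \<psi> \<in> step_funs P" if \<psi>: "\<psi> \<in> step_funs P" for \<psi>
    unfolding step_funs_def
  proof (intro CollectI allI impI)
    fix s t assume "cell P s = cell P t"
    then have "\<phi> (idx s) = \<phi> (idx t)" "\<psi> (idx s) = \<psi> (idx t)"
      using \<phi> \<psi> unfolding step_funs_def by blast+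
    then show "(\<phi> + \<psi>) (idx s) = (\<phi> + \<psi>) (idx t)" by simp
  qed
  show "a *\<^sub>R \<phi> \<in> step_funs P" for a
    unfolding step_funs_def
  proof (intro CollectI allI impI)
    fix s t assume "cell P s = cell P t"
    then have "\<phi> (idx s) = \<phi> (idx t)" using \<phi> unfolding step_funs_def by blast
    then show "(a *\<^sub>R \<phi>) (idx s) = (a *\<^sub>R \<phi>) (idx t)" by simp
  qed
qed

lemma step_expand:
  assumes P: "finite P" and \<phi>: "\<phi> \<in> step_funs P"
  shows "\<phi> = (\<Sum>k\<in>cells P. \<phi> (idx (rep P k)) *\<^sub>R cell_fun P k)"
proof
  fix n
  obtain t where n: "n = idx t" by (rule idx_cases)
  have "cell P (rep P (cell P t)) = cell P t" by (simp add: cell_rep)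
  then have eq: "\<phi> (idx (rep P (cell P t))) = \<phi> (idx t)"
    using \<phi> unfolding step_funs_def by blast
  have "(\<Sum>k\<in>cells P. \<phi> (idx (rep P k)) *\<^sub>R cell_fun P k) n
      = (\<Sum>k\<in>cells P. if k = cell P t then \<phi> (idx (rep P k)) else 0)"
    unfolding sum_apply n by (rule sum.cong) auto
  also have "\<dots> = \<phi> n" using cells_finite[OF P] eq by (simp add: n)
  finally show "\<phi> n = (\<Sum>k\<in>cells P. \<phi> (idx (rep P k)) *\<^sub>R cell_fun P k) n" by (rule sym)
qed

context spreading_seminorm
begin

definition dominated :: "(nat \<Rightarrow> real) \<Rightarrow> real \<Rightarrow> bool" where
  "dominated \<phi> C \<longleftrightarrow> 0 \<le> C \<and> (\<forall>x\<in>c00. \<bar>pairing \<phi> x\<bar> \<le> C * Q x)"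

definition dual_nrm :: "(nat \<Rightarrow> real) \<Rightarrow> real" where
  "dual_nrm \<phi> = Inf {C. dominated \<phi> C}"

definition bounded_seqs :: "(nat \<Rightarrow> real) set" where
  "bounded_seqs = {\<phi>. \<exists>C. dominated \<phi> C}"

lemma B_nonneg: "0 \<le> B"
  using Q_nonneg[OF unit_in_c00] Q_unit order_trans by blast

lemma dominated_nrm_le: "dominated \<phi> C \<Longrightarrow> dual_nrm \<phi> \<le> C"
  unfolding dual_nrm_def by (rule cInf_lower) (auto simp: dominated_def intro!: bdd_belowI[of _ 0])

lemma bounded_seqsI: "dominated \<phi> C \<Longrightarrow> \<phi> \<in> bounded_seqs"
  by (auto simp: bounded_seqs_def)

lemma dominated_dual_nrm:
  assumes "\<phi> \<in> bounded_seqs"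
  shows "dominated \<phi> (dual_nrm \<phi>)"
proof -
  let ?C = "{C. dominated \<phi> C}"
  have ne: "?C \<noteq> {}" using assms by (auto simp: bounded_seqs_def)
  have "0 \<le> dual_nrm \<phi>" unfolding dual_nrm_def using ne by (intro cInf_greatest) (auto simp: dominated_def)
  moreover have "\<bar>pairing \<phi> x\<bar> \<le> dual_nrm \<phi> * Q x" if x: "x \<in> c00" for x
  proof (cases "Q x = 0")
    case True
    then show ?thesis using ne x by (force simp: dominated_def)
  next
    case False
    then have q: "0 < Q x" using Q_nonneg[OF x] by simp
    have "\<bar>pairing \<phi> x\<bar> / Q x \<le> dual_nrm \<phi>"
      unfolding dual_nrm_def using ne
    proof (rule cInf_greatest)
      fix C assume "C \<in> ?C"
      then show "\<bar>pairing \<phi> x\<bar> / Q x \<le> C" using x q by (simp add: dominated_def pos_divide_le_eq)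
    qed
    then show ?thesis using q by (simp add: pos_divide_le_eq)
  qed
  ultimately show ?thesis by (simp add: dominated_def)
qed

lemma dominated_add:
  assumes "dominated \<phi> C" "dominated \<psi> D"
  shows "dominated (\<phi> + \<psi>) (C + D)"
  unfolding dominated_def
proof (intro conjI ballI)
  fix x assume "x \<in> c00"
  then have "\<bar>pairing \<phi> x\<bar> \<le> C * Q x" "\<bar>pairing \<psi> x\<bar> \<le> D * Q x"
    using assms by (auto simp: dominated_def)
  then show "\<bar>pairing (\<phi> + \<psi>) x\<bar> \<le> (C + D) * Q x"
    by (simp add: pairing_add_left distrib_right)
qed (use assms in \<open>auto simp: dominated_def\<close>)

lemma dominated_scale:
  assumes "dominated \<phi> C"
  shows "dominated (a *\<^sub>R \<phi>) (\<bar>a\<bar> * C)"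
  using assms by (auto simp: dominated_def pairing_scale_left abs_mult mult.assoc intro!: mult_left_mono)

lemma dominated_sum:
  assumes "\<And>k. k \<in> K \<Longrightarrow> dominated (g k) (C k)"
  shows "dominated (\<Sum>k\<in>K. g k) (\<Sum>k\<in>K. C k)"
  using assms
  by (induction K rule: infinite_finite_induct) (auto simp: dominated_add, auto simp: dominated_def pairing_zero_left)

lemma dominated_entry:
  assumes "dominated \<phi> C"
  shows "\<bar>\<phi> n\<bar> \<le> C * B"
proof -
  obtain t where n: "n = idx t" by (rule idx_cases)
  have "\<bar>\<phi> n\<bar> \<le> C * Q (unit_at t)"
    using assms unit_in_c00[of t] pairing_unit[of \<phi> t] unfolding dominated_def n by metis
  also have "\<dots> \<le> C * B" using assms Q_unit by (intro mult_left_mono) (auto simp: dominated_def)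
  finally show ?thesis .
qed

lemma dominated_upper_set:
  assumes U: "\<And>s t. s \<in> U \<Longrightarrow> s \<le> t \<Longrightarrow> t \<in> U"
  shows "dominated (\<lambda>n. if inv idx n \<in> U then 1 else 0) (1 / c)"
  unfolding dominated_def
proof (intro conjI ballI)
  fix x assume x: "x \<in> c00"
  have "pairing (\<lambda>n. if inv idx n \<in> U then 1 else 0) x = (\<Sum>t\<in>supp x. if t \<in> U then x t else 0)"
    unfolding pairing_def by (rule sum.cong) auto
  also have "\<dots> = (\<Sum>t\<in>supp x \<inter> U. x t)"
    using x by (simp add: c00_def sum.inter_restrict)
  finally show "\<bar>pairing (\<lambda>n. if inv idx n \<in> U then 1 else 0) x\<bar> \<le> 1 / c * Q x"
    using Q_tail[OF x U] c_pos by (simp add: field_simps)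
qed (use c_pos in simp)

lemma dominated_cell_fun:
  assumes P: "finite P"
  shows "dominated (cell_fun P k) (2 / c)"
proof -
  let ?g = "\<lambda>k n. if inv idx n \<in> {t. k \<le> cell P t} then 1 else (0::real)"
  have dom: "dominated (?g k) (1 / c)" for k
    by (rule dominated_upper_set) (use cell_mono[OF P] in \<open>fastforce intro: order_trans\<close>)
  have "cell_fun P k = ?g k + (-1) *\<^sub>R ?g (Suc k)"
    by (auto simp: cell_fun_def fun_eq_iff)
  then show ?thesis using dominated_add[OF dom[of k] dominated_scale[OF dom[of "Suc k"], of "-1"]] by simp
qed

lemma step_bounded:
  assumes "finite P" "\<phi> \<in> step_funs P"
  shows "\<phi> \<in> bounded_seqs"
proof -
  have "dominated (\<Sum>k\<in>cells P. \<phi> (idx (rep P k)) *\<^sub>R cell_fun P k) (\<Sum>k\<in>cells P. \<bar>\<phi> (idx (rep P k))\<bar> * (2 / c))"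
    by (intro dominated_sum dominated_scale dominated_cell_fun assms)
  then show ?thesis unfolding step_expand[OF assms, symmetric] by (rule bounded_seqsI)
qed

text \<open>
  This is the closure of the step functions in the dual of \<^const>\<open>c00\<close> with the seminorm \<open>Q\<close>.
\<close>

definition Z :: "(nat \<Rightarrow> real) nspace" where
  "Z = \<lparr>vecs = {\<phi>. \<forall>\<epsilon>>0. \<exists>P \<psi>. finite P \<and> \<psi> \<in> step_funs P \<and> dominated (\<phi> - \<psi>) \<epsilon>}, nrm = dual_nrm\<rparr>"

lemma Z_approx:
  assumes "\<phi> \<in> vecs Z" "0 < \<epsilon>"
  obtains P \<psi> where "finite P" "\<psi> \<in> step_funs P" "dominated (\<phi> - \<psi>) \<epsilon>"
  using assms by (auto simp: Z_def)

lemma nrm_Z: "nrm Z = dual_nrm"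
  by (simp add: Z_def)

lemma step_in_Z:
  assumes "finite P" "\<phi> \<in> step_funs P"
  shows "\<phi> \<in> vecs Z"
proof -
  have "dominated (\<phi> - \<phi>) \<epsilon>" if "0 < \<epsilon>" for \<epsilon>
  proof -
    have "pairing (\<phi> - \<phi>) x = 0" for x by (simp add: pairing_zero_left)
    then show ?thesis using that Q_nonneg unfolding dominated_def by (simp del: diff_self)
  qed
  then have "\<exists>P \<psi>. finite P \<and> \<psi> \<in> step_funs P \<and> dominated (\<phi> - \<psi>) \<epsilon>" if "0 < \<epsilon>" for \<epsilon>
    using assms that by blast
  then show ?thesis by (simp add: Z_def)
qed

lemma Z_bounded:
  assumes "\<phi> \<in> vecs Z"
  shows "\<phi> \<in> bounded_seqs"
proof -
  obtain P \<psi> where "finite P" "\<psi> \<in> step_funs P" "dominated (\<phi> - \<psi>) 1"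
    using Z_approx[OF assms zero_less_one] by blast
  then have "dominated ((\<phi> - \<psi>) + \<psi>) (1 + dual_nrm \<psi>)"
    by (intro dominated_add dominated_dual_nrm step_bounded)
  then show ?thesis by (simp add: bounded_seqsI)
qed

lemma Z_dominated: "\<phi> \<in> vecs Z \<Longrightarrow> dominated \<phi> (dual_nrm \<phi>)"
  by (intro dominated_dual_nrm Z_bounded)

lemma subspace_Z: "subspace (vecs Z)"
  unfolding subspace_def
proof (intro conjI ballI allI)
  show "0 \<in> vecs Z" by (rule step_in_Z[of "{}"]) (auto simp: step_funs_def)
  fix \<phi> assume \<phi>: "\<phi> \<in> vecs Z"
  show "\<phi> + \<psi> \<in> vecs Z" if \<psi>: "\<psi> \<in> vecs Z" for \<psi>
    unfolding Z_def
  proof (simp, intro allI impI)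
    fix \<epsilon> :: real assume "0 < \<epsilon>"
    then have e: "0 < \<epsilon> / 2" by simp
    obtain P f where P: "finite P" "f \<in> step_funs P" "dominated (\<phi> - f) (\<epsilon> / 2)" by (rule Z_approx[OF \<phi> e])
    obtain R g where R: "finite R" "g \<in> step_funs R" "dominated (\<psi> - g) (\<epsilon> / 2)" by (rule Z_approx[OF \<psi> e])
    have fin: "finite (P \<union> R)" using P R by simp
    then have "f + g \<in> step_funs (P \<union> R)"
      using P R step_funs_mono[OF fin, of P] step_funs_mono[OF fin, of R]
      by (intro subspace_add[OF subspace_step_funs]) auto
    moreover have "dominated ((\<phi> + \<psi>) - (f + g)) \<epsilon>"
      using dominated_add[OF P(3) R(3)] by (simp add: algebra_simps)
    ultimately show "\<exists>P. finite P \<and> (\<exists>h. h \<in> step_funs P \<and> dominated ((\<phi> + \<psi>) - h) \<epsilon>)"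
      using fin by blast
  qed
  show "a *\<^sub>R \<phi> \<in> vecs Z" for a
    unfolding Z_def
  proof (simp, intro allI impI)
    fix \<epsilon> :: real assume e: "0 < \<epsilon>"
    then have e': "0 < \<epsilon> / (\<bar>a\<bar> + 1)" by simp
    obtain P f where P: "finite P" "f \<in> step_funs P" "dominated (\<phi> - f) (\<epsilon> / (\<bar>a\<bar> + 1))"
      by (rule Z_approx[OF \<phi> e'])
    have le: "\<bar>a\<bar> * (\<epsilon> / (\<bar>a\<bar> + 1)) \<le> \<epsilon>" using e by (simp add: field_simps)
    have "dominated (a *\<^sub>R (\<phi> - f)) (\<bar>a\<bar> * (\<epsilon> / (\<bar>a\<bar> + 1)))" by (rule dominated_scale[OF P(3)])
    then have "dominated (a *\<^sub>R \<phi> - a *\<^sub>R f) \<epsilon>"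
      using e le Q_nonneg mult_right_mono[OF le] unfolding dominated_def scaleR_diff_right
      by (meson less_imp_le order_trans)
    then show "\<exists>P. finite P \<and> (\<exists>h. h \<in> step_funs P \<and> dominated (a *\<^sub>R \<phi> - h) \<epsilon>)"
      using P subspace_scale[OF subspace_step_funs] by blast
  qed
qed

lemma normed_Z: "normed_space Z"
  unfolding normed_space_def nrm_Z
proof (intro conjI ballI allI subspace_Z)
  fix \<phi> assume \<phi>: "\<phi> \<in> vecs Z"
  note dom = Z_dominated[OF \<phi>]
  show "0 \<le> dual_nrm \<phi>" using dom by (simp add: dominated_def)
  then have 0: "dual_nrm \<phi> = 0" if "\<phi> = 0"
    using that dominated_nrm_le[of 0 0] by (auto simp: dominated_def pairing_zero_left)
  have "\<phi> = 0" if "dual_nrm \<phi> = 0"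
    using dominated_entry[OF dom] that by (auto simp: fun_eq_iff)
  with 0 show "dual_nrm \<phi> = 0 \<longleftrightarrow> \<phi> = 0" by blast
  have le: "dual_nrm (a *\<^sub>R \<phi>) \<le> \<bar>a\<bar> * dual_nrm \<phi>" if "\<phi> \<in> vecs Z" for a \<phi>
    by (intro dominated_nrm_le dominated_scale Z_dominated that)
  show "dual_nrm (a *\<^sub>R \<phi>) = \<bar>a\<bar> * dual_nrm \<phi>" for a
  proof (cases "a = 0")
    case True
    have "dual_nrm 0 \<le> 0" by (rule dominated_nrm_le) (simp add: dominated_def pairing_zero_left)
    moreover have "0 \<le> dual_nrm 0"
      using Z_dominated[OF subspace_0[OF subspace_Z]] by (simp add: dominated_def)
    ultimately show ?thesis using True by simp
  next
    case False
    have "dual_nrm ((1 / a) *\<^sub>R (a *\<^sub>R \<phi>)) \<le> \<bar>1 / a\<bar> * dual_nrm (a *\<^sub>R \<phi>)"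
      by (rule le[OF subspace_scale[OF subspace_Z \<phi>]])
    then have "\<bar>a\<bar> * dual_nrm \<phi> \<le> dual_nrm (a *\<^sub>R \<phi>)" using False by (simp add: field_simps)
    with le[OF \<phi>, of a] show ?thesis by simp
  qed
  show "dual_nrm (\<phi> + \<psi>) \<le> dual_nrm \<phi> + dual_nrm \<psi>" if "\<psi> \<in> vecs Z" for \<psi>
    by (intro dominated_nrm_le dominated_add Z_dominated \<phi> that)
qed

lemma banach_Z: "banach_space Z"
proof (rule banach_spaceI[OF normed_Z])
  fix \<sigma> :: "nat \<Rightarrow> nat \<Rightarrow> real"
  assume \<sigma>: "\<And>n. \<sigma> n \<in> vecs Z"
    and cauchy: "\<And>\<epsilon>. 0 < \<epsilon> \<Longrightarrow> \<exists>N. \<forall>m\<ge>N. \<forall>n\<ge>N. nrm Z (\<sigma> m - \<sigma> n) < \<epsilon>"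
  have dom: "dominated (\<sigma> m - \<sigma> n) (dual_nrm (\<sigma> m - \<sigma> n))" for m n
    by (intro Z_dominated vecs_diff[OF normed_Z] \<sigma>)
  have "Cauchy (\<lambda>n. \<sigma> n i)" for i
  proof (rule CauchyI)
    fix e :: real assume "0 < e"
    then have "0 < e / (B + 1)" using B_nonneg by simp
    then obtain N where N: "\<And>m n. N \<le> m \<Longrightarrow> N \<le> n \<Longrightarrow> dual_nrm (\<sigma> m - \<sigma> n) < e / (B + 1)"
      using cauchy unfolding nrm_Z by blast
    have "norm (\<sigma> m i - \<sigma> n i) < e" if "N \<le> m" "N \<le> n" for m n
    proof -
      have "\<bar>(\<sigma> m - \<sigma> n) i\<bar> \<le> dual_nrm (\<sigma> m - \<sigma> n) * B" by (rule dominated_entry[OF dom])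
      also have "\<dots> \<le> e / (B + 1) * B"
        using N[OF that] B_nonneg by (intro mult_right_mono) auto
      also have "\<dots> < e" using B_nonneg \<open>0 < e\<close> by (simp add: field_simps)
      finally show ?thesis by simp
    qed
    then show "\<exists>M. \<forall>m\<ge>M. \<forall>n\<ge>M. norm (\<sigma> m i - \<sigma> n i) < e" by blast
  qed
  then have "\<exists>l. (\<lambda>n. \<sigma> n i) \<longlonglongrightarrow> l" for i by (simp add: Cauchy_convergent_iff convergent_def)
  then obtain l where l: "\<And>i. (\<lambda>n. \<sigma> n i) \<longlonglongrightarrow> l i" by metis
  have close: "\<exists>N. \<forall>n\<ge>N. dominated (\<sigma> n - l) \<epsilon>" if \<epsilon>: "0 < \<epsilon>" for \<epsilon>
  proof -
    obtain N where N: "\<And>m n. N \<le> m \<Longrightarrow> N \<le> n \<Longrightarrow> dual_nrm (\<sigma> m - \<sigma> n) < \<epsilon>"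
      using cauchy[OF \<epsilon>] unfolding nrm_Z by blast
    have "\<bar>pairing (\<sigma> n - l) x\<bar> \<le> \<epsilon> * Q x" if n: "N \<le> n" and x: "x \<in> c00" for n x
    proof (rule tendsto_upperbound)
      have "(\<lambda>m. \<bar>\<Sum>t\<in>supp x. x t * (\<sigma> n (idx t) - \<sigma> m (idx t))\<bar>) \<longlonglongrightarrow> \<bar>\<Sum>t\<in>supp x. x t * (\<sigma> n (idx t) - l (idx t))\<bar>"
        by (intro tendsto_intros l)
      then show "(\<lambda>m. \<bar>pairing (\<sigma> n - \<sigma> m) x\<bar>) \<longlonglongrightarrow> \<bar>pairing (\<sigma> n - l) x\<bar>"
        by (simp add: pairing_def)
      have "\<bar>pairing (\<sigma> n - \<sigma> m) x\<bar> \<le> \<epsilon> * Q x" if m: "N \<le> m" for m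
      proof -
        have "\<bar>pairing (\<sigma> n - \<sigma> m) x\<bar> \<le> dual_nrm (\<sigma> n - \<sigma> m) * Q x"
          using dom x by (simp add: dominated_def)
        also have "\<dots> \<le> \<epsilon> * Q x"
          using N[OF n m] Q_nonneg[OF x] by (intro mult_right_mono) auto
        finally show ?thesis .
      qed
      then show "eventually (\<lambda>m. \<bar>pairing (\<sigma> n - \<sigma> m) x\<bar> \<le> \<epsilon> * Q x) sequentially"
        by (auto simp: eventually_sequentially)
    qed simp
    then show ?thesis using \<epsilon> unfolding dominated_def by (auto intro!: exI[of _ N])
  qed
  have "l \<in> vecs Z"
    unfolding Z_def
  proof (simp, intro allI impI)
    fix \<epsilon> :: real assume "0 < \<epsilon>"
    then have e: "0 < \<epsilon> / 2" by simp
    obtain n where n: "dominated (\<sigma> n - l) (\<epsilon> / 2)" using close[OF e] by blast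
    obtain P f where P: "finite P" "f \<in> step_funs P" "dominated (\<sigma> n - f) (\<epsilon> / 2)" by (rule Z_approx[OF \<sigma> e])
    have "dominated ((-1) *\<^sub>R (\<sigma> n - l) + (\<sigma> n - f)) (\<bar>-1\<bar> * (\<epsilon> / 2) + \<epsilon> / 2)"
      by (intro dominated_add dominated_scale n P)
    then have "dominated (l - f) \<epsilon>" by simp
    then show "\<exists>P. finite P \<and> (\<exists>h. h \<in> step_funs P \<and> dominated (l - h) \<epsilon>)" using P by blast
  qed
  moreover have "\<exists>N. \<forall>n\<ge>N. nrm Z (\<sigma> n - l) < \<epsilon>" if "0 < \<epsilon>" for \<epsilon>
  proof -
    have "0 < \<epsilon> / 2" using that by simp
    from close[OF this] obtain N where "\<And>n. N \<le> n \<Longrightarrow> dominated (\<sigma> n - l) (\<epsilon> / 2)" by blast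
    then have "nrm Z (\<sigma> n - l) < \<epsilon>" if "N \<le> n" for n
      using dominated_nrm_le[of "\<sigma> n - l" "\<epsilon> / 2"] that \<open>0 < \<epsilon>\<close> by (fastforce simp: nrm_Z)
    then show ?thesis by blast
  qed
  ultimately show "\<exists>l\<in>vecs Z. \<forall>\<epsilon>>0. \<exists>N. \<forall>n\<ge>N. nrm Z (\<sigma> n - l) < \<epsilon>" by blast
qed

lemma separable_Z: "separable Z"
proof (rule separableI[OF normed_Z])
  define comb where "comb P q = (\<Sum>k\<in>cells P. q k *\<^sub>R cell_fun P k)" for P and q :: "nat \<Rightarrow> real"
  define D where "D = (\<Union>P\<in>{P. finite P}. comb P ` (\<Pi>\<^sub>E k\<in>cells P. \<rat>))"
  show "countable D"
    unfolding D_def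
  proof (intro countable_UN countable_image countable_PiE)
    show "countable {P :: rat set. finite P}" by (rule countable_Collect_finite)
  qed (auto simp: cells_finite countable_rat)
  have comb_step: "comb P q \<in> step_funs P" for P q
    unfolding comb_def by (intro subspace_sum subspace_scale subspace_step_funs cell_fun_step)
  then show "D \<subseteq> vecs Z" by (auto simp: D_def intro: step_in_Z)
  fix \<phi> and \<epsilon> :: real assume \<phi>: "\<phi> \<in> vecs Z" and \<epsilon>: "0 < \<epsilon>"
  then obtain P f where P: "finite P" "f \<in> step_funs P" "dominated (\<phi> - f) (\<epsilon> / 3)"
    using Z_approx[OF \<phi>, of "\<epsilon> / 3"] by auto
  define M where "M = real (card (cells P)) * (2 / c) + 1"
  have M: "0 < M" using c_pos by (simp add: M_def add_nonneg_pos)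
  define \<delta> where "\<delta> = \<epsilon> / (3 * M)"
  have \<delta>: "0 < \<delta>" using \<epsilon> M by (simp add: \<delta>_def)
  have "\<exists>q\<in>\<rat>. f (idx (rep P k)) < q \<and> q < f (idx (rep P k)) + \<delta>" for k
    by (rule Rats_dense_in_real) (use \<delta> in simp)
  then obtain q where q0: "\<And>k. q k \<in> \<rat> \<and> f (idx (rep P k)) < q k \<and> q k < f (idx (rep P k)) + \<delta>"
    by metis
  have q: "q k \<in> \<rat>" "\<bar>f (idx (rep P k)) - q k\<bar> \<le> \<delta>" for k
    using q0[of k] by linarith+
  have "comb P q = comb P (restrict q (cells P))" by (auto simp: comb_def intro!: sum.cong)
  then have qD: "comb P q \<in> D" using q(1) P(1) by (auto simp: D_def)
  have "dominated (\<Sum>k\<in>cells P. (f (idx (rep P k)) - q k) *\<^sub>R cell_fun P k)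
      (\<Sum>k\<in>cells P. \<bar>f (idx (rep P k)) - q k\<bar> * (2 / c))"
    by (intro dominated_sum dominated_scale dominated_cell_fun P)
  moreover have "(\<Sum>k\<in>cells P. (f (idx (rep P k)) - q k) *\<^sub>R cell_fun P k) = f - comb P q"
    by (subst (2) step_expand[OF P(1,2)]) (simp add: comb_def scaleR_diff_left sum_subtractf)
  ultimately have "dual_nrm (f - comb P q) \<le> (\<Sum>k\<in>cells P. \<bar>f (idx (rep P k)) - q k\<bar> * (2 / c))"
    by (metis dominated_nrm_le)
  also have "\<dots> \<le> (\<Sum>k\<in>cells P. \<delta> * (2 / c))"
    using q(2) c_pos by (intro sum_mono mult_right_mono) auto
  also have "\<dots> \<le> \<delta> * M" using \<delta> by (simp add: M_def algebra_simps)
  also have "\<dots> = \<epsilon> / 3" using M by (simp add: \<delta>_def)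
  finally have "dual_nrm (f - comb P q) \<le> \<epsilon> / 3" .
  moreover have "dual_nrm (\<phi> - f) \<le> \<epsilon> / 3" by (rule dominated_nrm_le[OF P(3)])
  moreover have "nrm Z ((\<phi> - f) + (f - comb P q)) \<le> nrm Z (\<phi> - f) + nrm Z (f - comb P q)"
    using \<phi> P comb_step
    by (intro normed_space_triangle[OF normed_Z] vecs_diff[OF normed_Z]) (auto intro: step_in_Z)
  ultimately have "nrm Z (\<phi> - comb P q) < \<epsilon>" using \<epsilon> by (simp add: nrm_Z)
  then show "\<exists>d\<in>D. nrm Z (\<phi> - d) < \<epsilon>" using qD by blast
qed

text \<open>
  The left limit at a real \<open>s\<close>, taken along an ultrafilter, is a functional on \<open>Z\<close>. Two of
  them are told apart by the indicator of the rationals above a rational between their points,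
  whose norm is at most \<open>2 / c\<close>.
\<close>

lemma dual_Z_not_separable: "\<not> separable (dual Z)"
proof -
  define L where "L s = filtercomap (of_rat :: rat \<Rightarrow> real) (at_left s)" for s
  have evL: "\<exists>b<s. \<forall>t. b < of_rat t \<and> of_rat t < s \<longrightarrow> P t" if ev: "eventually P (L s)" for P s
  proof -
    obtain R where "eventually R (at_left s)" "\<And>t. R (of_rat t) \<Longrightarrow> P t"
      using ev unfolding L_def eventually_filtercomap by blast
    then show ?thesis using eventually_at_left[of "s - 1" s R] by auto
  qed
  have "L s \<noteq> bot" for s
  proof
    assume "L s = bot"
    then obtain b where b: "b < s" "\<And>t. \<not> (b < of_rat t \<and> of_rat t < s)"
      using evL[of "\<lambda>_. False" s] by auto
    from of_rat_dense[OF b(1)] b(2) show False by blast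
  qed
  then have "\<exists>U. ultra U \<and> U \<le> L s" for s using ultrafilter_exists by metis
  then obtain U where U: "\<And>s. ultra (U s)" "\<And>s. U s \<le> L s" by metis
  have evU: "eventually (\<lambda>t. P (of_rat t)) (U s)" if "eventually P (at_left s)" for P s
    using U(2) by (rule filter_leD) (use that in \<open>auto simp: L_def eventually_filtercomap\<close>)
  define \<delta> where "\<delta> s \<phi> = (if \<phi> \<in> vecs Z then Lim (U s) (\<lambda>t. \<phi> (idx t)) else 0)" for s \<phi>
  have lim: "((\<lambda>t. \<phi> (idx t)) \<longlongrightarrow> \<delta> s \<phi>) (U s)" if "\<phi> \<in> vecs Z" for s \<phi>
    using that dominated_entry[OF Z_dominated[OF that]]
    by (auto simp: \<delta>_def intro!: ultra_tendsto_Lim[OF U(1), where b = "dual_nrm \<phi> * B"] always_eventually)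
  have uniq: "\<delta> s \<phi> = a" if "\<phi> \<in> vecs Z" "((\<lambda>t. \<phi> (idx t)) \<longlongrightarrow> a) (U s)" for s \<phi> a
    using that ultra_Lim_eq[OF U(1)] by (simp add: \<delta>_def)
  have \<delta>_dual: "\<delta> s \<in> vecs (dual Z)" for s
  proof (rule dualI[where K = B])
    fix \<phi> assume \<phi>: "\<phi> \<in> vecs Z"
    show "\<delta> s (\<phi> + \<psi>) = \<delta> s \<phi> + \<delta> s \<psi>" if "\<psi> \<in> vecs Z" for \<psi>
      using \<phi> that by (intro uniq vecs_add[OF normed_Z]) (auto intro!: tendsto_add lim)
    show "\<delta> s (a *\<^sub>R \<phi>) = a * \<delta> s \<phi>" for a
      using \<phi> by (intro uniq vecs_scale[OF normed_Z]) (auto intro!: tendsto_mult lim)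
    have "((\<lambda>t. \<bar>\<phi> (idx t)\<bar>) \<longlongrightarrow> \<bar>\<delta> s \<phi>\<bar>) (U s)" by (intro tendsto_rabs lim \<phi>)
    then show "\<bar>\<delta> s \<phi>\<bar> \<le> B * nrm Z \<phi>"
      by (rule tendsto_upperbound)
        (use U(1) dominated_entry[OF Z_dominated[OF \<phi>]] in \<open>auto simp: ultra_def nrm_Z mult.commute\<close>)
  qed (simp add: \<delta>_def)
  have apart: "\<delta> s (cell_fun {r} 1) = 0" "\<delta> s' (cell_fun {r} 1) = 1" if "s < of_rat r" "of_rat r < s'" for s s' r
  proof -
    have c1: "cell {r} t = 1 \<longleftrightarrow> r \<le> t" for t
    proof -
      have "{p \<in> {r}. p \<le> t} = (if r \<le> t then {r} else {})" by auto
      then show ?thesis by (simp add: cell_def)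
    qed
    have inZ: "cell_fun {r} 1 \<in> vecs Z" by (rule step_in_Z[OF _ cell_fun_step]) simp
    have "eventually (\<lambda>y. y < of_rat r) (at_left s)"
      using that(1) eventually_at_left_field[of _ s] by (auto intro!: exI[of _ "s - 1"])
    then have "eventually (\<lambda>t. cell_fun {r} 1 (idx t) = 0) (U s)"
      using evU[of "\<lambda>y. y < of_rat r" s] by (auto simp: c1[unfolded One_nat_def] of_rat_less elim!: eventually_mono)
    then show "\<delta> s (cell_fun {r} 1) = 0" by (intro uniq inZ tendsto_eventually)
    have "eventually (\<lambda>y. of_rat r < y) (at_left s')"
      using that(2) eventually_at_left_field[of _ s'] by (auto intro!: exI[of _ "of_rat r"])
    then have "eventually (\<lambda>t. cell_fun {r} 1 (idx t) = 1) (U s')"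
      using evU[of "\<lambda>y. of_rat r < y" s'] by (auto simp: c1[unfolded One_nat_def] of_rat_less elim!: eventually_mono)
    then show "\<delta> s' (cell_fun {r} 1) = 1" by (intro uniq inZ tendsto_eventually)
  qed
  have far: "c / 2 \<le> nrm (dual Z) (\<delta> s - \<delta> s')" if ne: "s \<noteq> s'" for s s'
  proof -
    have "\<exists>r. \<bar>(\<delta> s - \<delta> s') (cell_fun {r} 1)\<bar> = 1"
    proof (cases "s < s'")
      case True
      from of_rat_dense[OF this] obtain r where "s < of_rat r" "of_rat r < s'" by blast
      with apart[of s r s'] show ?thesis by (intro exI[of _ r]) simp
    next
      case False
      with ne have "s' < s" by simp
      from of_rat_dense[OF this] obtain r where "s' < of_rat r" "of_rat r < s" by blast
      with apart[of s' r s] show ?thesis by (intro exI[of _ r]) simp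
    qed
    then obtain r where r: "\<bar>(\<delta> s - \<delta> s') (cell_fun {r} 1)\<bar> = 1" by blast
    have inZ: "cell_fun {r} 1 \<in> vecs Z" by (rule step_in_Z[OF _ cell_fun_step]) simp
    have d: "\<delta> s - \<delta> s' \<in> vecs (dual Z)" by (intro vecs_diff[OF normed_space_dual[OF normed_Z]] \<delta>_dual)
    have "1 \<le> nrm (dual Z) (\<delta> s - \<delta> s') * nrm Z (cell_fun {r} 1)"
      using dual_norm_bound[OF normed_Z d inZ] r by simp
    also have "\<dots> \<le> nrm (dual Z) (\<delta> s - \<delta> s') * (2 / c)"
      using dominated_nrm_le[OF dominated_cell_fun] normed_space_nonneg[OF normed_space_dual[OF normed_Z] d]
      by (intro mult_left_mono) (auto simp: nrm_Z)
    finally show ?thesis using c_pos by (simp add: field_simps)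
  qed
  show ?thesis
  proof (rule not_separableI[OF normed_space_dual[OF normed_Z], of \<delta> UNIV])
    show "inj_on \<delta> UNIV"
    proof (rule inj_onI, rule ccontr)
      fix s s' assume "\<delta> s = \<delta> s'" "s \<noteq> s'"
      with far[of s s'] show False
        using c_pos nrm_zero[OF normed_space_dual[OF normed_Z]] by simp
    qed
    show "uncountable (UNIV :: real set)" by (rule uncountable_UNIV_real)
    show "0 < c / 2" using c_pos by simp
  qed (use \<delta>_dual far in auto)
qed

end

section \<open>Averages along the cells of a partition\<close>

text \<open>
  Cells are half-open, so to the right of any point of a cell there is room for an increasing
  sequence inside the cell.
\<close>

lemma cell_points:
  assumes P: "finite P"
  shows "\<exists>w :: nat \<Rightarrow> nat \<Rightarrow> rat. (\<forall>k\<in>cells P. \<forall>a. cell P (w k a) = k) \<and>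
    (\<forall>k a b. a < b \<longrightarrow> w k a < w k b)"
proof -
  have "\<exists>\<delta>>0. \<forall>t. s \<le> t \<and> t < s + \<delta> \<longrightarrow> cell P t = cell P s" for s
  proof -
    define \<delta> where "\<delta> = (if {p \<in> P. s < p} = {} then 1 else Min {p \<in> P. s < p} - s)"
    have "0 < \<delta>" using P Min_in[of "{p \<in> P. s < p}"] by (auto simp: \<delta>_def)
    moreover have "cell P t = cell P s" if t: "s \<le> t" "t < s + \<delta>" for t
    proof -
      have "p \<le> s" if p: "p \<in> P" "p \<le> t" for p
      proof (rule ccontr)
        assume "\<not> p \<le> s"
        then have "p \<in> {p \<in> P. s < p}" using p by simp
        then have "s + \<delta> \<le> p" using P Min_le[of "{p \<in> P. s < p}" p] by (auto simp: \<delta>_def)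
        then show False using t p by simp
      qed
      then have "{p \<in> P. p \<le> t} = {p \<in> P. p \<le> s}" using t by auto
      then show ?thesis by (simp add: cell_def)
    qed
    ultimately show ?thesis by blast
  qed
  then obtain \<delta> where \<delta>: "\<And>s. 0 < \<delta> s" "\<And>s t. s \<le> t \<Longrightarrow> t < s + \<delta> s \<Longrightarrow> cell P t = cell P s"
    by metis
  define w where "w k a = rep P k + \<delta> (rep P k) * (of_nat a / (of_nat a + 1))" for k and a :: nat
  have "cell P (w k a) = k" if "k \<in> cells P" for k a
  proof -
    have "\<delta> (rep P k) * (of_nat a / (of_nat a + 1)) < \<delta> (rep P k) * 1"
      using \<delta>(1) by (intro mult_strict_left_mono) (auto simp: field_simps)
    moreover have "0 \<le> \<delta> (rep P k) * (of_nat a / (of_nat a + 1))"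
      using \<delta>(1)[of "rep P k"] by simp
    ultimately have "cell P (w k a) = cell P (rep P k)" by (intro \<delta>(2)) (auto simp: w_def)
    then show ?thesis using that by (simp add: cell_rep)
  qed
  moreover have "w k a < w k b" if "a < b" for k a b
  proof -
    have "(of_nat a :: rat) / (of_nat a + 1) < of_nat b / (of_nat b + 1)"
      using that by (simp add: field_simps add_pos_nonneg)
    from mult_strict_left_mono[OF this \<delta>(1)] show ?thesis
      unfolding w_def by (simp only: add_less_cancel_left)
  qed
  ultimately show ?thesis by (intro exI[of _ w]) simp
qed

lemma sum_lessThan_append: "(\<Sum>a<m + n. g a) = (\<Sum>a<m. g a) + (\<Sum>a<n. g (m + a))"
  for g :: "nat \<Rightarrow> 'a::ab_group_add"
  by (induction n) (simp_all add: add.assoc)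

definition avg :: "(nat \<Rightarrow> nat \<Rightarrow> rat) \<Rightarrow> nat \<Rightarrow> nat \<Rightarrow> rat \<Rightarrow> real" where
  "avg w K k = (1 / real K) *\<^sub>R (\<Sum>a<K. unit_at (w k a))"

lemma avg_c00: "avg w K k \<in> c00"
  unfolding avg_def by (intro subspace_scale subspace_sum subspace_c00 unit_in_c00)

lemma pairing_avg:
  assumes w: "\<And>a. cell P (w k a) = k" and K: "0 < K" and \<phi>: "\<phi> \<in> step_funs P"
  shows "pairing \<phi> (avg w K k) = \<phi> (idx (rep P k))"
proof -
  have "k \<in> cells P" using w by (metis cell_in_cells)
  then have "\<phi> (idx (w k a)) = \<phi> (idx (rep P k))" for a
    using \<phi> w[of a] cell_rep[of k P] unfolding step_funs_def by simp
  then show ?thesis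
    unfolding avg_def using K
    by (simp add: pairing_scale_right subspace_sum[OF subspace_c00] unit_in_c00 pairing_sum_right pairing_unit)
qed

context spreading_seminorm
begin

lemma Q_zero: "Q 0 = 0"
  using Q_scale[OF subspace_0[OF subspace_c00], of 0] by simp

lemma Q_sum:
  assumes "\<And>i. i \<in> I \<Longrightarrow> g i \<in> c00"
  shows "Q (\<Sum>i\<in>I. g i) \<le> (\<Sum>i\<in>I. Q (g i))"
  using assms
proof (induction I rule: infinite_finite_induct)
  case (insert i I)
  have "sum g I \<in> c00" using insert by (intro subspace_sum[OF subspace_c00]) auto
  moreover have "Q (sum g I) \<le> (\<Sum>i\<in>I. Q (g i))" using insert by simp
  ultimately show ?case
    unfolding sum.insert[OF insert(1,2)] using Q_add[OF insert(4)[OF insertI1], of "sum g I"] by linarith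
qed (simp_all only: sum.infinite sum.empty Q_zero order_refl not_False_eq_True)

lemma Q_unit_sum: "Q (\<Sum>a\<in>A. unit_at (v a)) \<le> real (card A) * B"
proof -
  have "Q (\<Sum>a\<in>A. unit_at (v a)) \<le> (\<Sum>a\<in>A. Q (unit_at (v a)))" by (intro Q_sum unit_in_c00)
  also have "\<dots> \<le> (\<Sum>a\<in>A. B)" by (intro sum_mono Q_unit)
  finally show ?thesis by simp
qed

lemma Q_avg: "Q (avg w K k) \<le> B"
proof (cases "K = 0")
  case True
  then show ?thesis using B_nonneg by (simp only: avg_def lessThan_0 sum.empty scaleR_zero_right Q_zero)
next
  case False
  have "Q (avg w K k) = (1 / real K) * Q (\<Sum>a<K. unit_at (w k a))"
    unfolding avg_def by (subst Q_scale) (auto intro!: subspace_sum subspace_c00 unit_in_c00)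
  also have "\<dots> \<le> (1 / real K) * (real K * B)"
    using Q_unit_sum[of "w k" "{..<K}"] by (intro mult_left_mono) auto
  finally show ?thesis using False by simp
qed

text \<open>
  Replacing the entries of \<open>x\<close> in each cell by their sum, spread evenly over \<open>K\<close> points of the
  cell, hardly increases \<open>Q\<close>. Shift the support of \<open>x\<close> within the cells in \<open>K\<close> ways, each of which
  preserves \<open>Q\<close>: the average of the shifted copies differs from the evenly spread vector only in
  the overlap at the two ends of each run, which is bounded independently of \<open>K\<close> before the
  division by \<open>K\<close>.
\<close>

lemma Q_averaging:
  assumes P: "finite P" and w: "\<And>k a. k \<in> cells P \<Longrightarrow> cell P (w k a) = k"
    and mono: "\<And>k a b. a < b \<Longrightarrow> w k a < w k b" and x: "x \<in> c00" and K: "0 < K"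
  shows "Q (\<Sum>k\<in>cells P. pairing (cell_fun P k) x *\<^sub>R avg w K k)
    \<le> Q x + (\<Sum>t\<in>supp x. \<bar>x t\<bar>) * (2 * real (card (supp x)) * B) / real K"
proof -
  define S where "S = supp x"
  have S: "finite S" using x by (simp add: c00_def S_def)
  define \<rho> where "\<rho> t = card {u \<in> S. u < t}" for t
  have \<rho>_le: "\<rho> t \<le> card S" for t unfolding \<rho>_def using S by (intro card_mono) auto
  have \<rho>_less: "\<rho> s < \<rho> t" if "s \<in> S" "s < t" for s t
    unfolding \<rho>_def using that S by (intro psubset_card_mono) auto
  define y where "y a = (\<Sum>t\<in>S. x t *\<^sub>R unit_at (w (cell P t) (\<rho> t + a)))" for a
  have y: "y a \<in> c00" "Q (y a) = Q x" for a
  proof -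
    have "strict_mono_on S (\<lambda>t. w (cell P t) (\<rho> t + a))"
    proof (rule strict_mono_onI)
      fix s t assume st: "s \<in> S" "t \<in> S" "s < t"
      then have le: "cell P s \<le> cell P t" using P by (intro cell_mono) auto
      show "w (cell P s) (\<rho> s + a) < w (cell P t) (\<rho> t + a)"
      proof (cases "cell P s = cell P t")
        case True
        then show ?thesis using mono[of "\<rho> s + a" "\<rho> t + a" "cell P t"] \<rho>_less st by simp
      next
        case False
        then have "\<not> cell P (w (cell P t) (\<rho> t + a)) \<le> cell P (w (cell P s) (\<rho> s + a))"
          using le by (simp add: w)
        then show ?thesis using cell_mono[OF P] by (meson not_le)
      qed
    qed
    then have "Q (y a) = Q (\<Sum>t\<in>S. x t *\<^sub>R unit_at t)" unfolding y_def by (rule Q_spread[OF S])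
    also have "(\<Sum>t\<in>S. x t *\<^sub>R unit_at t) = x"
      using c00_expand[OF S, of x] by (simp add: S_def)
    finally show "Q (y a) = Q x" .
    show "y a \<in> c00" unfolding y_def by (intro subspace_sum subspace_scale subspace_c00 unit_in_c00)
  qed
  let ?shift = "\<lambda>t. (1 / real K) *\<^sub>R (\<Sum>a<K. unit_at (w (cell P t) (\<rho> t + a)))"
  define Y where "Y = (\<Sum>t\<in>S. x t *\<^sub>R ?shift t)"
  have Y_eq: "Y = (1 / real K) *\<^sub>R (\<Sum>a<K. y a)"
    unfolding Y_def y_def by (subst sum.swap) (simp add: scaleR_sum_right mult.commute)
  have "Q Y = (1 / real K) * Q (\<Sum>a<K. y a)"
    unfolding Y_eq by (subst Q_scale) (auto intro!: subspace_sum subspace_c00 y)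
  also have "\<dots> \<le> (1 / real K) * (\<Sum>a<K. Q (y a))"
    by (intro mult_left_mono Q_sum y) simp
  also have "\<dots> = Q x" using K by (simp add: y)
  finally have QY: "Q Y \<le> Q x" .
  have end_effect: "Q (avg w K (cell P t) - ?shift t) \<le> 2 * real (card S) * B / real K" for t
  proof -
    let ?g = "\<lambda>a. unit_at (w (cell P t) a)"
    have "(\<Sum>a<K. ?g a) + (\<Sum>a<\<rho> t. ?g (K + a)) = (\<Sum>a<\<rho> t. ?g a) + (\<Sum>a<K. ?g (\<rho> t + a))"
      using sum_lessThan_append[of ?g K "\<rho> t"] sum_lessThan_append[of ?g "\<rho> t" K]
      by (simp only: add.commute[of K "\<rho> t"])
    then have "(\<Sum>a<K. ?g a) - (\<Sum>a<K. ?g (\<rho> t + a)) = (\<Sum>a<\<rho> t. ?g a) + (-1) *\<^sub>R (\<Sum>a<\<rho> t. ?g (K + a))"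
      by (simp add: algebra_simps)
    then have eq: "avg w K (cell P t) - ?shift t
        = (1 / real K) *\<^sub>R ((\<Sum>a<\<rho> t. ?g a) + (-1) *\<^sub>R (\<Sum>a<\<rho> t. ?g (K + a)))"
      by (simp only: avg_def scaleR_diff_right[symmetric])
    have c: "(\<Sum>a<n. ?g (f a)) \<in> c00" for n :: nat and f by (intro subspace_sum subspace_c00 unit_in_c00)
    note c' = subspace_scale[OF subspace_c00 c]
    have "Q ((\<Sum>a<\<rho> t. ?g a) + (-1) *\<^sub>R (\<Sum>a<\<rho> t. ?g (K + a)))
        \<le> Q (\<Sum>a<\<rho> t. ?g a) + Q ((-1) *\<^sub>R (\<Sum>a<\<rho> t. ?g (K + a)))" by (intro Q_add c c')
    also have "\<dots> = Q (\<Sum>a<\<rho> t. ?g a) + Q (\<Sum>a<\<rho> t. ?g (K + a))" by (simp only: Q_scale[OF c])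
    also have "\<dots> \<le> real (\<rho> t) * B + real (\<rho> t) * B"
      using Q_unit_sum[of "\<lambda>a. w (cell P t) a" "{..<\<rho> t}"] Q_unit_sum[of "\<lambda>a. w (cell P t) (K + a)" "{..<\<rho> t}"]
      by (intro add_mono) auto
    also have "\<dots> \<le> 2 * real (card S) * B"
    proof -
      have "real (\<rho> t) * B \<le> real (card S) * B" using \<rho>_le[of t] B_nonneg by (intro mult_right_mono) auto
      then show ?thesis by linarith
    qed
    finally have "Q ((\<Sum>a<\<rho> t. ?g a) + (-1) *\<^sub>R (\<Sum>a<\<rho> t. ?g (K + a))) \<le> 2 * real (card S) * B" .
    then show ?thesis
      unfolding eq Q_scale[OF subspace_add[OF subspace_c00 c c']] using K by (simp add: divide_right_mono)
  qed
  have split: "(\<Sum>k\<in>cells P. pairing (cell_fun P k) x *\<^sub>R avg w K k) = Y + (\<Sum>t\<in>S. x t *\<^sub>R (avg w K (cell P t) - ?shift t))"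
  proof -
    have "(\<Sum>k\<in>cells P. pairing (cell_fun P k) x *\<^sub>R avg w K k)
        = (\<Sum>k\<in>cells P. \<Sum>t\<in>S. (if k = cell P t then x t *\<^sub>R avg w K k else 0))"
      unfolding pairing_def S_def scaleR_sum_left by (intro sum.cong) auto
    also have "\<dots> = (\<Sum>t\<in>S. x t *\<^sub>R avg w K (cell P t))"
      by (subst sum.swap) (simp add: cells_finite[OF P])
    finally show ?thesis unfolding Y_def by (simp add: scaleR_diff_right sum_subtractf)
  qed
  have d: "avg w K (cell P t) - ?shift t \<in> c00" for t
    by (intro subspace_diff subspace_scale subspace_sum subspace_c00 avg_c00 unit_in_c00)
  have "Q (\<Sum>t\<in>S. x t *\<^sub>R (avg w K (cell P t) - ?shift t)) \<le> (\<Sum>t\<in>S. Q (x t *\<^sub>R (avg w K (cell P t) - ?shift t)))"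
    by (intro Q_sum subspace_scale subspace_c00 d)
  also have "\<dots> \<le> (\<Sum>t\<in>S. \<bar>x t\<bar> * (2 * real (card S) * B / real K))"
    unfolding Q_scale[OF d] by (intro sum_mono mult_left_mono end_effect) simp
  also have "\<dots> = (\<Sum>t\<in>S. \<bar>x t\<bar>) * (2 * real (card S) * B) / real K"
    by (simp add: sum_distrib_right sum_divide_distrib)
  finally have "Q (\<Sum>t\<in>S. x t *\<^sub>R (avg w K (cell P t) - ?shift t)) \<le> \<dots>" .
  moreover have "Q (Y + (\<Sum>t\<in>S. x t *\<^sub>R (avg w K (cell P t) - ?shift t)))
      \<le> Q Y + Q (\<Sum>t\<in>S. x t *\<^sub>R (avg w K (cell P t) - ?shift t))"
    unfolding Y_def
    by (intro Q_add subspace_sum subspace_scale subspace_c00 d unit_in_c00)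
  ultimately show ?thesis using QY unfolding split S_def by linarith
qed

text \<open>
  A functional on \<open>Z\<close> acts on the indicators of the cells like a finitely additive signed measure.
  Its mass on each cell is spread evenly over \<open>K\<close> points of that cell.
\<close>

definition lift :: "rat set \<Rightarrow> (nat \<Rightarrow> nat \<Rightarrow> rat) \<Rightarrow> nat \<Rightarrow> ((nat \<Rightarrow> real) \<Rightarrow> real) \<Rightarrow> rat \<Rightarrow> real" where
  "lift P w K \<Psi> = (\<Sum>k\<in>cells P. \<Psi> (cell_fun P k) *\<^sub>R avg w K k)"

lemma lift_c00: "lift P w K \<Psi> \<in> c00"
  unfolding lift_def by (intro subspace_sum subspace_scale subspace_c00 avg_c00)

text \<open>
  A step function is constant on each cell, so its pairing with the lift gives back \<open>\<Psi> \<phi>\<close>.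
\<close>

lemma lift_lower:
  assumes P: "finite P" and w: "\<And>k a. k \<in> cells P \<Longrightarrow> cell P (w k a) = k"
    and \<Psi>: "\<Psi> \<in> vecs (dual Z)" and \<phi>: "\<phi> \<in> step_funs P" and K: "0 < K"
  shows "\<bar>\<Psi> \<phi>\<bar> \<le> dual_nrm \<phi> * Q (lift P w K \<Psi>)"
proof -
  have cZ: "cell_fun P k \<in> vecs Z" for k by (rule step_in_Z[OF P cell_fun_step])
  have "\<Psi> \<phi> = \<Psi> (\<Sum>k\<in>cells P. \<phi> (idx (rep P k)) *\<^sub>R cell_fun P k)"
    using step_expand[OF P \<phi>] by simp
  also have "\<dots> = (\<Sum>k\<in>cells P. \<phi> (idx (rep P k)) * \<Psi> (cell_fun P k))"
    using cZ by (simp add: dual_sum[OF normed_Z \<Psi>] dual_scaleR[OF \<Psi>] vecs_scale[OF normed_Z])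
  also have "\<dots> = pairing \<phi> (lift P w K \<Psi>)"
    unfolding lift_def
    by (subst pairing_sum_right)
      (auto intro!: sum.cong subspace_scale subspace_c00 avg_c00
        simp: pairing_scale_right avg_c00 pairing_avg[OF w K \<phi>])
  finally show ?thesis
    using dominated_dual_nrm[OF step_bounded[OF P \<phi>]] lift_c00 by (simp add: dominated_def)
qed

text \<open>
  Helly's theorem gives an \<open>x\<close> with \<open>Q x\<close> hardly larger than the norm of \<open>\<Psi>\<close> that puts almost the
  same mass as \<open>\<Psi>\<close> on every cell. Spreading those masses evenly, which costs little by
  \<open>Q_averaging\<close>, turns \<open>x\<close> into almost the lift of \<open>\<Psi>\<close>.
\<close>

lemma lift_upper:
  assumes P: "finite P" and w: "\<And>k a. k \<in> cells P \<Longrightarrow> cell P (w k a) = k"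
    and mono: "\<And>k a b. a < b \<Longrightarrow> w k a < w k b"
    and \<Psi>: "\<Psi> \<in> vecs (dual Z)" and \<epsilon>: "0 < \<epsilon>"
  shows "eventually (\<lambda>K. Q (lift P w K \<Psi>) \<le> nrm (dual Z) \<Psi> + \<epsilon>) sequentially"
proof -
  have cZ: "cell_fun P k \<in> vecs Z" for k by (rule step_in_Z[OF P cell_fun_step])
  have fin: "finite (cells P)" by (rule cells_finite[OF P])
  define n where "n = real (card (cells P))"
  define \<eta> where "\<eta> = \<epsilon> / (2 * (1 + n * B))"
  have nB: "0 \<le> n * B" using B_nonneg by (simp add: n_def)
  have \<eta>: "0 < \<eta>" using \<epsilon> nB by (simp add: \<eta>_def)
  let ?f = "\<lambda>k. pairing (cell_fun P k)"
  obtain x where x: "x \<in> c00" "Q x \<le> nrm (dual Z) \<Psi> + \<eta>"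
    "\<And>k. k \<in> cells P \<Longrightarrow> \<bar>?f k x - \<Psi> (cell_fun P k)\<bar> \<le> \<eta>"
  proof (rule Helly_moments[of c00 "cells P" \<eta> Q ?f "\<lambda>k. \<Psi> (cell_fun P k)" "nrm (dual Z) \<Psi>"])
    fix a :: "nat \<Rightarrow> real"
    assume a: "\<And>x. x \<in> c00 \<Longrightarrow> (\<Sum>k\<in>cells P. a k * ?f k x) \<le> Q x"
    let ?\<phi> = "\<Sum>k\<in>cells P. a k *\<^sub>R cell_fun P k"
    have pair: "pairing ?\<phi> x = (\<Sum>k\<in>cells P. a k * ?f k x)" for x
      by (simp add: pairing_sum_left pairing_scale_left)
    have "\<bar>pairing ?\<phi> x\<bar> \<le> Q x" if x: "x \<in> c00" for x
      using a[OF x] a[OF subspace_scale[OF subspace_c00 x, of "-1"]]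
        pairing_scale_right[OF x, of ?\<phi> "-1"] Q_scale[OF x, of "-1"] unfolding pair[symmetric] by simp
    then have "dual_nrm ?\<phi> \<le> 1" by (intro dominated_nrm_le) (auto simp: dominated_def)
    have \<phi>Z: "?\<phi> \<in> vecs Z" by (intro vecs_sum[OF normed_Z] vecs_scale[OF normed_Z] cZ)
    have "(\<Sum>k\<in>cells P. a k * \<Psi> (cell_fun P k)) = \<Psi> ?\<phi>"
      using cZ by (simp add: dual_sum[OF normed_Z \<Psi>] dual_scaleR[OF \<Psi>] vecs_scale[OF normed_Z])
    also have "\<dots> \<le> nrm (dual Z) \<Psi> * nrm Z ?\<phi>" using dual_norm_bound[OF normed_Z \<Psi> \<phi>Z] by simp
    also have "\<dots> \<le> nrm (dual Z) \<Psi> * 1"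
      using \<open>dual_nrm ?\<phi> \<le> 1\<close> normed_space_nonneg[OF normed_space_dual[OF normed_Z] \<Psi>]
      by (intro mult_left_mono) (auto simp: nrm_Z)
    finally show "(\<Sum>k\<in>cells P. a k * \<Psi> (cell_fun P k)) \<le> nrm (dual Z) \<Psi>" by simp
  qed (use subspace_c00 fin \<eta> Q_nonneg Q_add Q_scale pairing_add_right pairing_scale_right in auto)
  define D where "D = (\<Sum>t\<in>supp x. \<bar>x t\<bar>) * (2 * real (card (supp x)) * B)"
  have "((\<lambda>K. D / real K) \<longlongrightarrow> 0) sequentially" by (rule lim_const_over_n)
  then have "eventually (\<lambda>K. D / real K < \<epsilon> / 2) sequentially" by (rule order_tendstoD) (use \<epsilon> in simp)
  with eventually_gt_at_top[of 0] show ?thesis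
  proof eventually_elim
    case (elim K)
    let ?u = "\<Sum>k\<in>cells P. ?f k x *\<^sub>R avg w K k"
    let ?v = "\<Sum>k\<in>cells P. (\<Psi> (cell_fun P k) - ?f k x) *\<^sub>R avg w K k"
    have c: "(\<Sum>k\<in>cells P. b k *\<^sub>R avg w K k) \<in> c00" for b
      by (intro subspace_sum subspace_scale subspace_c00 avg_c00)
    have "Q ?v \<le> (\<Sum>k\<in>cells P. Q ((\<Psi> (cell_fun P k) - ?f k x) *\<^sub>R avg w K k))"
      by (intro Q_sum subspace_scale subspace_c00 avg_c00)
    also have "\<dots> \<le> (\<Sum>k\<in>cells P. \<eta> * B)"
      unfolding Q_scale[OF avg_c00]
      using x(3) \<eta> Q_nonneg[OF avg_c00]
      by (intro sum_mono mult_mono Q_avg) (auto simp: abs_minus_commute)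
    finally have v: "Q ?v \<le> n * (\<eta> * B)" by (simp add: n_def)
    have "lift P w K \<Psi> = ?u + ?v"
      unfolding lift_def by (simp add: sum.distrib[symmetric] scaleR_diff_left)
    then have "Q (lift P w K \<Psi>) \<le> Q ?u + Q ?v" using Q_add[OF c c] by simp
    also have "\<dots> \<le> (Q x + D / real K) + n * (\<eta> * B)"
      using Q_averaging[of P w, OF P w mono x(1) elim(1)] v by (simp add: D_def)
    also have "\<dots> \<le> nrm (dual Z) \<Psi> + (\<eta> * (1 + n * B)) + \<epsilon> / 2"
    proof -
      have "\<eta> * (1 + n * B) = \<eta> + n * (\<eta> * B)" by (simp add: algebra_simps)
      then show ?thesis using x(2) elim(2) by linarith
    qed
    also have "\<eta> * (1 + n * B) = \<epsilon> / 2"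
    proof -
      have "\<epsilon> / (2 * m) * m = \<epsilon> / 2" if "m \<noteq> 0" for m using that by simp
      from this[of "1 + n * B"] show ?thesis unfolding \<eta>_def using nB by linarith
    qed
    finally show ?case by simp
  qed
qed

lemma step_nearly_norming:
  assumes \<Psi>: "\<Psi> \<in> vecs (dual Z)" and pos: "0 < nrm (dual Z) \<Psi>"
  obtains P \<phi> where "finite P" "\<phi> \<in> step_funs P" "0 < dual_nrm \<phi>"
    "nrm (dual Z) \<Psi> * dual_nrm \<phi> \<le> 2 * \<bar>\<Psi> \<phi>\<bar>"
proof -
  let ?n = "nrm (dual Z) \<Psi>"
  (* Attaining 3/4 of the norm at z and approximating z up to 1/8 leaves 5/8 of the norm, at a
     step function of norm at most 9/8; the quotient 5/9 exceeds 1/2. *)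
  have "3 / 4 * ?n < ?n" using pos by simp
  then obtain z where z: "z \<in> vecs Z" "nrm Z z \<le> 1" "3 / 4 * ?n < \<bar>\<Psi> z\<bar>"
    by (rule dual_norm_nearly_attained[OF normed_Z])
  obtain P \<phi> where P: "finite P" "\<phi> \<in> step_funs P" and d: "dominated (z - \<phi>) (1 / 8)"
    by (rule Z_approx[OF z(1), of "1 / 8"]) auto
  have \<phi>Z: "\<phi> \<in> vecs Z" by (rule step_in_Z[OF P])
  have d': "nrm Z (z - \<phi>) \<le> 1 / 8" unfolding nrm_Z by (rule dominated_nrm_le[OF d])
  have "\<bar>\<Psi> (z - \<phi>)\<bar> \<le> ?n * nrm Z (z - \<phi>)"
    by (rule dual_norm_bound[OF normed_Z \<Psi> vecs_diff[OF normed_Z z(1) \<phi>Z]])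
  also have "\<dots> \<le> ?n * (1 / 8)" using d' pos by (intro mult_left_mono) auto
  finally have \<Psi>\<phi>: "5 / 8 * ?n \<le> \<bar>\<Psi> \<phi>\<bar>" using z(3) dual_diff[OF normed_Z \<Psi> z(1) \<phi>Z] by linarith
  have "nrm Z (z + (-1) *\<^sub>R (z - \<phi>)) \<le> nrm Z z + nrm Z ((-1) *\<^sub>R (z - \<phi>))"
    using z(1) \<phi>Z
    by (intro normed_space_triangle[OF normed_Z] vecs_scale[OF normed_Z] vecs_diff[OF normed_Z])
  then have n\<phi>: "dual_nrm \<phi> \<le> 9 / 8"
    using d' z(2) normed_space_scaleR[OF normed_Z vecs_diff[OF normed_Z z(1) \<phi>Z], of "-1"]
    by (simp add: nrm_Z)
  have "\<phi> \<noteq> 0" using \<Psi>\<phi> pos dual_zero[OF normed_Z \<Psi>] by auto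
  then have "0 < dual_nrm \<phi>"
    using normed_space_nonneg[OF normed_Z \<phi>Z] normed_space_eq_0[OF normed_Z \<phi>Z] by (simp add: nrm_Z)
  moreover have "?n * dual_nrm \<phi> \<le> ?n * (9 / 8)" using n\<phi> pos by (intro mult_left_mono) auto
  then have "?n * dual_nrm \<phi> \<le> 2 * \<bar>\<Psi> \<phi>\<bar>" using \<Psi>\<phi> pos by linarith
  ultimately show ?thesis using that P by blast
qed

text \<open>
  The lift is linear in \<open>\<Psi>\<close> once the partition is fixed, so one partition has to serve all of \<open>A\<close>.
  The common refinement of partitions that serve the single members does, because refining keeps
  step functions and the upper bound holds for every partition.
\<close>

lemma finite_dual_embedding:
  assumes A: "finite A" "A \<subseteq> vecs (dual Z)" "0 \<notin> A"
  obtains L S where "\<And>\<Psi>. L \<Psi> \<in> c00" "finite S" "\<And>\<Psi>. supp (L \<Psi>) \<subseteq> S"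
    "\<And>\<Psi> \<Psi>'. L (\<Psi> - \<Psi>') = L \<Psi> - L \<Psi>'"
    "\<And>\<Psi>. \<Psi> \<in> A \<Longrightarrow> nrm (dual Z) \<Psi> \<le> 2 * Q (L \<Psi>) \<and> Q (L \<Psi>) \<le> 2 * nrm (dual Z) \<Psi>"
proof -
  note dZ = normed_space_dual[OF normed_Z]
  have pos: "0 < nrm (dual Z) \<Psi>" if "\<Psi> \<in> A" for \<Psi>
    using that A normed_space_nonneg[OF dZ, of \<Psi>] normed_space_eq_0[OF dZ, of \<Psi>] by fastforce
  have "\<exists>P \<phi>. finite P \<and> \<phi> \<in> step_funs P \<and> 0 < dual_nrm \<phi> \<and>
      nrm (dual Z) \<Psi> * dual_nrm \<phi> \<le> 2 * \<bar>\<Psi> \<phi>\<bar>" if "\<Psi> \<in> A" for \<Psi>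
  proof -
    have "\<Psi> \<in> vecs (dual Z)" using that A by blast
    then show ?thesis by (rule step_nearly_norming[OF _ pos[OF that]]) blast
  qed
  then obtain R \<phi> where R: "\<And>\<Psi>. \<Psi> \<in> A \<Longrightarrow> finite (R \<Psi>)" "\<And>\<Psi>. \<Psi> \<in> A \<Longrightarrow> \<phi> \<Psi> \<in> step_funs (R \<Psi>)"
    "\<And>\<Psi>. \<Psi> \<in> A \<Longrightarrow> 0 < dual_nrm (\<phi> \<Psi>)"
    "\<And>\<Psi>. \<Psi> \<in> A \<Longrightarrow> nrm (dual Z) \<Psi> * dual_nrm (\<phi> \<Psi>) \<le> 2 * \<bar>\<Psi> (\<phi> \<Psi>)\<bar>"
    by metis
  define P where "P = (\<Union>\<Psi>\<in>A. R \<Psi>)"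
  have P: "finite P" using A(1) R(1) by (simp add: P_def)
  have \<phi>P: "\<phi> \<Psi> \<in> step_funs P" if "\<Psi> \<in> A" for \<Psi>
    using R(2)[OF that] step_funs_mono[OF P, of "R \<Psi>"] that by (auto simp: P_def)
  obtain w :: "nat \<Rightarrow> nat \<Rightarrow> rat" where w0: "\<forall>k\<in>cells P. \<forall>a. cell P (w k a) = k" "\<forall>k a b. a < b \<longrightarrow> w k a < w k b"
    using cell_points[OF P] by (elim exE conjE)
  have w: "k \<in> cells P \<Longrightarrow> cell P (w k a) = k" "a < b \<Longrightarrow> w k a < w k b" for k a b
    using w0 by simp_all
  have "eventually (\<lambda>K. \<forall>\<Psi>\<in>A. Q (lift P w K \<Psi>) \<le> nrm (dual Z) \<Psi> + nrm (dual Z) \<Psi>) sequentially"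
    using A(1)
  proof (rule eventually_ball_finite, intro ballI)
    fix \<Psi> assume "\<Psi> \<in> A"
    then show "eventually (\<lambda>K. Q (lift P w K \<Psi>) \<le> nrm (dual Z) \<Psi> + nrm (dual Z) \<Psi>) sequentially"
      using A(2) pos by (intro lift_upper[OF P w]) auto
  qed
  from eventually_happens'[OF sequentially_bot eventually_conj[OF eventually_gt_at_top[of 0] this]]
  obtain K where K: "0 < K" "\<And>\<Psi>. \<Psi> \<in> A \<Longrightarrow> Q (lift P w K \<Psi>) \<le> nrm (dual Z) \<Psi> + nrm (dual Z) \<Psi>"
    by blast
  show ?thesis
  proof (rule that[of "lift P w K" "\<Union>k\<in>cells P. supp (avg w K k)"])
    show "lift P w K \<Psi> \<in> c00" for \<Psi> by (rule lift_c00)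
    show "finite (\<Union>k\<in>cells P. supp (avg w K k))"
      using avg_c00 cells_finite[OF P] by (auto simp: c00_def)
    show "supp (lift P w K \<Psi>) \<subseteq> (\<Union>k\<in>cells P. supp (avg w K k))" for \<Psi>
    proof
      fix t assume "t \<in> supp (lift P w K \<Psi>)"
      then have "(\<Sum>k\<in>cells P. \<Psi> (cell_fun P k) * avg w K k t) \<noteq> 0"
        by (simp add: supp_def lift_def sum_apply)
      then obtain k where "k \<in> cells P" "\<Psi> (cell_fun P k) * avg w K k t \<noteq> 0"
        by (meson sum.neutral)
      then show "t \<in> (\<Union>k\<in>cells P. supp (avg w K k))" by (auto simp: supp_def)
    qed
    show "lift P w K (\<Psi> - \<Psi>') = lift P w K \<Psi> - lift P w K \<Psi>'" for \<Psi> \<Psi>'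
      by (simp add: lift_def scaleR_diff_left sum_subtractf)
    fix \<Psi> assume \<Psi>: "\<Psi> \<in> A"
    have "nrm (dual Z) \<Psi> * dual_nrm (\<phi> \<Psi>) \<le> 2 * Q (lift P w K \<Psi>) * dual_nrm (\<phi> \<Psi>)"
      using R(4)[OF \<Psi>] lift_lower[of P w, OF P w(1) _ \<phi>P[OF \<Psi>] K(1), of \<Psi>] A(2) \<Psi> by (auto simp: mult.commute)
    then have "nrm (dual Z) \<Psi> \<le> 2 * Q (lift P w K \<Psi>)" using R(3)[OF \<Psi>] by simp
    then show "nrm (dual Z) \<Psi> \<le> 2 * Q (lift P w K \<Psi>) \<and> Q (lift P w K \<Psi>) \<le> 2 * nrm (dual Z) \<Psi>"
      using K(2)[OF \<Psi>] by simp
  qed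
qed

end

section \<open>Embedding finite subsets\<close>

lemma op_norm_bound:
  assumes E: "normed_space E" and F: "normed_space F" and T: "bounded_op E F T" and x: "x \<in> vecs E"
  shows "nrm F (T x) \<le> op_norm E F T * nrm E x"
proof -
  have Tv: "T x \<in> vecs F" if "x \<in> vecs E" for x using T that by (auto simp: bounded_op_def)
  have Tsc: "T (a *\<^sub>R x) = a *\<^sub>R T x" if "x \<in> vecs E" for a x using T that by (simp add: bounded_op_def)
  obtain C where C: "\<And>x. x \<in> vecs E \<Longrightarrow> nrm F (T x) \<le> C * nrm E x" using T unfolding bounded_op_def by blast
  have bdd: "bdd_above ((\<lambda>x. nrm F (T x)) ` {x \<in> vecs E. nrm E x \<le> 1})"
  proof (rule bdd_aboveI2)
    fix x assume "x \<in> {x \<in> vecs E. nrm E x \<le> 1}"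
    then have x: "x \<in> vecs E" "nrm E x \<le> 1" by auto
    have "C * nrm E x \<le> \<bar>C\<bar> * nrm E x" using normed_space_nonneg[OF E x(1)] by (intro mult_right_mono) auto
    also have "\<dots> \<le> \<bar>C\<bar> * 1" using x(2) by (intro mult_left_mono) auto
    finally show "nrm F (T x) \<le> \<bar>C\<bar>" using C[OF x(1)] by simp
  qed
  show ?thesis
  proof (cases "nrm E x = 0")
    case True
    then have "x = 0" using normed_space_eq_0[OF E x] by simp
    then have "T x = 0" using Tsc[OF x, of 0] by simp
    then show ?thesis using nrm_zero[OF F] True by simp
  next
    case False
    then have pos: "0 < nrm E x" using normed_space_nonneg[OF E x] by simp
    let ?y = "(1 / nrm E x) *\<^sub>R x"
    have "nrm E ?y = 1" using normed_space_scaleR[OF E x, of "1 / nrm E x"] pos by simp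
    then have "nrm F (T ?y) \<le> op_norm E F T"
      unfolding op_norm_def using vecs_scale[OF E x] by (intro cSUP_upper bdd) auto
    moreover have "nrm F (T ?y) = nrm F (T x) / nrm E x"
      using Tsc[OF x] normed_space_scaleR[OF F Tv[OF x], of "1 / nrm E x"] pos by simp
    ultimately show ?thesis using pos by (simp add: pos_divide_le_eq)
  qed
qed

lemma normed_span:
  assumes "normed_space E" "span b \<subseteq> vecs E"
  shows "normed_space \<lparr>vecs = span b, nrm = nrm E\<rparr>"
  using assms unfolding normed_space_def by (auto simp: subset_iff)

text \<open>
  Unless the span is zero, \<open>r\<close> is the norm of the inverse of an isomorphism, and 2 bounds its
  product with the norm of the isomorphism.
\<close>

lemma finitely_representable_map:
  assumes Y: "normed_space Y" and X: "normed_space X" and fr: "finitely_representable Y X"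
    and b: "finite b" "span b \<subseteq> vecs Y"
  shows "\<exists>T. \<exists>r>0. (\<forall>u\<in>span b. \<forall>v\<in>span b. T (u - v) = T u - T v) \<and>
    (\<forall>v\<in>span b. T v \<in> vecs X \<and> nrm Y v \<le> r * nrm X (T v) \<and> r * nrm X (T v) \<le> 2 * nrm Y v)"
proof -
  let ?F = "\<lparr>vecs = span b, nrm = nrm Y\<rparr>"
  have "?F \<in> fin_dim_subspaces Y" using b by (auto simp: fin_dim_subspaces_def)
  then obtain G where G: "G \<in> fin_dim_subspaces X" "banach_mazur ?F G < ereal (1 + 1)"
    using fr unfolding finitely_representable_def by (meson zero_less_one)
  obtain d where d: "G = \<lparr>vecs = span d, nrm = nrm X\<rparr>" "span d \<subseteq> vecs X"
    using G(1) by (auto simp: fin_dim_subspaces_def)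
  have nF: "normed_space ?F" by (rule normed_span[OF Y b(2)])
  have nG: "normed_space G" unfolding d(1) by (rule normed_span[OF X d(2)])
  obtain T where "T \<in> isomorphisms ?F G"
    and lt: "ereal (op_norm ?F G T * op_norm G ?F (inv_into (vecs ?F) T)) < ereal (1 + 1)"
    using G(2) unfolding banach_mazur_def INF_less_iff by blast
  define \<alpha> where "\<alpha> = op_norm G ?F (inv_into (vecs ?F) T)"
  define \<beta> where "\<beta> = op_norm ?F G T"
  have bij: "bij_betw T (span b) (span d)" and T: "bounded_op ?F G T"
    and I: "bounded_op G ?F (inv_into (span b) T)"
    using \<open>T \<in> isomorphisms ?F G\<close> by (auto simp: isomorphisms_def d(1))
  have TG: "T v \<in> span d" if "v \<in> span b" for v using bij that by (auto simp: bij_betw_def)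
  have diff: "T (u - v) = T u - T v" if uv: "u \<in> span b" "v \<in> span b" for u v
  proof -
    have add: "T (x + y) = T x + T y" if "x \<in> span b" "y \<in> span b" for x y
      using T that by (simp add: bounded_op_def)
    have scale: "T (a *\<^sub>R x) = a *\<^sub>R T x" if "x \<in> span b" for a x
      using T that by (simp add: bounded_op_def)
    have "T (u + (-1) *\<^sub>R v) = T u + T ((-1) *\<^sub>R v)" by (rule add[OF uv(1) span_scale[OF uv(2)]])
    also have "T ((-1) *\<^sub>R v) = (-1) *\<^sub>R T v" using scale[OF uv(2)] .
    finally show ?thesis by simp
  qed
  have upper: "nrm X (T v) \<le> \<beta> * nrm Y v" if "v \<in> span b" for v
    using op_norm_bound[OF nF nG T, of v] that by (simp add: d(1) \<beta>_def)
  have lower: "nrm Y v \<le> \<alpha> * nrm X (T v)" if "v \<in> span b" for v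
    using op_norm_bound[OF nG nF, of "inv_into (span b) T" "T v"] I TG[OF that] that bij
    by (simp add: d(1) \<alpha>_def bij_betw_def)
  have nn: "0 \<le> nrm X (T v)" "0 \<le> nrm Y v" if "v \<in> span b" for v
    using normed_space_nonneg[OF X] normed_space_nonneg[OF Y] TG[OF that] that b(2) d(2) by auto
  show ?thesis
  proof (cases "0 < \<alpha>")
    case True
    have "\<alpha> * nrm X (T v) \<le> 2 * nrm Y v" if v: "v \<in> span b" for v
    proof -
      have "\<alpha> * nrm X (T v) \<le> \<alpha> * (\<beta> * nrm Y v)" using upper[OF v] True by (intro mult_left_mono) auto
      also have "\<dots> = (\<beta> * \<alpha>) * nrm Y v" by simp
      also have "\<dots> \<le> 2 * nrm Y v"
        using lt nn[OF v] by (intro mult_right_mono) (auto simp: \<alpha>_def \<beta>_def)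
      finally show ?thesis .
    qed
    then show ?thesis using True TG d(2) diff lower by (intro exI[of _ T] exI[of _ \<alpha>]) blast
  next
    \<comment> \<open>Here the space spanned by \<open>b\<close> is zero.\<close>
    case False
    have zero: "nrm Y v = 0" "T v = 0" if v: "v \<in> span b" for v
    proof -
      have "\<alpha> * nrm X (T v) \<le> 0" using False nn[OF v] by (simp add: mult_nonpos_nonneg)
      then show "nrm Y v = 0" using lower[OF v] nn[OF v] by simp
      then have "v = 0" using normed_space_eq_0[OF Y] v b(2) by auto
      then show "T v = 0" using diff[OF v v] by simp
    qed
    then show ?thesis using vecs_zero[OF X] nrm_zero[OF X] diff by (intro exI[of _ T] exI[of _ 1]) auto
  qed
qed

text \<open>
  The finitely many lifts are realised in \<open>Y\<close> with an error of at most half of the smallest of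
  their seminorms, which keeps them comparable with the functionals they come from.
\<close>

lemma (in weak_star_limit) finite_dual_into_Y:
  defines "E \<equiv> spreading_seminorm.Z Q"
  assumes A: "finite A" "A \<subseteq> vecs (dual E)" "0 \<notin> A"
  obtains J b where "finite b" "b \<subseteq> vecs Y" "\<And>\<Psi>. J \<Psi> \<in> span b" "\<And>\<Psi> \<Psi>'. J (\<Psi> - \<Psi>') = J \<Psi> - J \<Psi>'"
    "\<And>\<Psi>. \<Psi> \<in> A \<Longrightarrow> nrm (dual E) \<Psi> \<le> 4 * nrm Y (J \<Psi>) \<and> nrm Y (J \<Psi>) \<le> 4 * nrm (dual E) \<Psi>"
proof -
  interpret S: spreading_seminorm Q B c by (rule spreading)
  note dE = normed_space_dual[OF S.normed_Z, folded E_def]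
  have pos: "0 < nrm (dual E) \<Psi>" if "\<Psi> \<in> A" for \<Psi>
    using that A normed_space_nonneg[OF dE, of \<Psi>] normed_space_eq_0[OF dE, of \<Psi>] by fastforce
  obtain L S where L: "\<And>\<Psi>. L \<Psi> \<in> c00" "finite S" "\<And>\<Psi>. supp (L \<Psi>) \<subseteq> S"
    "\<And>\<Psi> \<Psi>'. L (\<Psi> - \<Psi>') = L \<Psi> - L \<Psi>'"
    "\<And>\<Psi>. \<Psi> \<in> A \<Longrightarrow> nrm (dual E) \<Psi> \<le> 2 * Q (L \<Psi>) \<and> Q (L \<Psi>) \<le> 2 * nrm (dual E) \<Psi>"
    using S.finite_dual_embedding[OF A[unfolded E_def]] unfolding E_def by metis
  define \<epsilon> where "\<epsilon> = Min (insert 1 ((\<lambda>\<Psi>. Q (L \<Psi>) / 2) ` A))"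
  have Qpos: "0 < Q (L \<Psi>)" if "\<Psi> \<in> A" for \<Psi> using L(5)[OF that] pos[OF that] by linarith
  have \<epsilon>: "0 < \<epsilon>" using A(1) Qpos by (simp add: \<epsilon>_def)
  have \<epsilon>_le: "\<epsilon> \<le> Q (L \<Psi>) / 2" if "\<Psi> \<in> A" for \<Psi>
    unfolding \<epsilon>_def by (rule Min_le) (use A(1) that in auto)
  obtain y where y: "\<And>t. y t \<in> vecs Y"
    "\<And>x. x \<in> L ` A \<Longrightarrow> \<bar>nrm Y (\<Sum>t\<in>S. x t *\<^sub>R y t) - Q x\<bar> < \<epsilon>"
    by (rule Q_realise[of "L ` A" \<epsilon> S]) (use A(1) L(1,2) \<epsilon> in \<open>auto dest: subsetD[OF L(3)]\<close>)
  show ?thesis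
  proof (rule that[of "y ` S" "\<lambda>\<Psi>. \<Sum>t\<in>S. L \<Psi> t *\<^sub>R y t"])
    show "finite (y ` S)" "y ` S \<subseteq> vecs Y" using L(2) y by auto
    show "(\<Sum>t\<in>S. L \<Psi> t *\<^sub>R y t) \<in> span (y ` S)" for \<Psi>
      by (intro span_sum span_scale span_base imageI)
    show "(\<Sum>t\<in>S. L (\<Psi> - \<Psi>') t *\<^sub>R y t) = (\<Sum>t\<in>S. L \<Psi> t *\<^sub>R y t) - (\<Sum>t\<in>S. L \<Psi>' t *\<^sub>R y t)" for \<Psi> \<Psi>'
      by (simp add: L(4) scaleR_diff_left sum_subtractf)
    fix \<Psi> assume \<Psi>: "\<Psi> \<in> A"
    have "\<bar>nrm Y (\<Sum>t\<in>S. L \<Psi> t *\<^sub>R y t) - Q (L \<Psi>)\<bar> < Q (L \<Psi>) / 2"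
      using y(2)[of "L \<Psi>"] \<epsilon>_le[OF \<Psi>] \<Psi> by fastforce
    then show "nrm (dual E) \<Psi> \<le> 4 * nrm Y (\<Sum>t\<in>S. L \<Psi> t *\<^sub>R y t) \<and>
        nrm Y (\<Sum>t\<in>S. L \<Psi> t *\<^sub>R y t) \<le> 4 * nrm (dual E) \<Psi>"
      using L(5)[OF \<Psi>] unfolding abs_less_iff by (intro conjI) linarith+
  qed
qed

theorem theorem1p4:
  fixes M :: "'m metric"
    and X :: "'x::real_vector nspace"
  assumes "\<And>Z :: (nat \<Rightarrow> real) nspace.
      \<lbrakk>banach_space Z; separable Z; \<not> separable (dual Z)\<rbrakk> \<Longrightarrow>
        \<exists>C f. bilipschitz_embedding C M (norm_metric (dual Z)) f"
    and "banach_space X"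
    and "\<not> superreflexive TYPE('y::real_vector) X"
  shows "\<exists>C. \<forall>A. finite A \<and> A \<subseteq> mspace M \<longrightarrow>
      (\<exists>f. bilipschitz_embedding C (submetric M A) (norm_metric X) f)"
proof -
  have nX: "normed_space X" using assms(2) by (simp add: banach_space_def)
  obtain Y :: "'y nspace" where Y: "banach_space Y" "finitely_representable Y X" "\<not> reflexive_space Y"
    using assms(3) by (auto simp: superreflexive_def)
  have nY: "normed_space Y" using Y(1) by (simp add: banach_space_def)
  obtain \<Phi> where \<Phi>: "\<Phi> \<in> vecs (dual (dual Y))" "\<not> (\<exists>x\<in>vecs Y. \<forall>f\<in>vecs (dual Y). \<Phi> f = f x)"
    using Y(3) by (auto simp: reflexive_space_def)
  obtain c where c: "0 < c" "\<forall>v\<in>vecs Y.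
      \<exists>f\<in>vecs (dual Y). (\<forall>x\<in>vecs Y. \<bar>f x\<bar> \<le> nrm Y x) \<and> c \<le> \<bar>\<Phi> f - f v\<bar>"
    using nonreflexive_distance[OF Y(1) \<Phi>] by blast
  obtain F B where F: "ultra F" "0 \<le> B" "eventually (\<lambda>y. y \<in> vecs Y \<and> nrm Y y \<le> B) F"
    "\<forall>f\<in>vecs (dual Y). (f \<longlongrightarrow> \<Phi> f) F"
    using Goldstine_ultrafilter[OF nY \<Phi>(1)] by blast
  interpret weak_star_limit Y F B c \<Phi>
    by unfold_locales (use nY F c in auto)
  interpret S: spreading_seminorm Q B c by (rule spreading)
  let ?D = "dual S.Z"
  have nD: "normed_space ?D" by (rule normed_space_dual[OF S.normed_Z])
  obtain C f where f: "bilipschitz_embedding C M (norm_metric ?D) f"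
    using assms(1)[OF S.banach_Z S.separable_Z S.dual_Z_not_separable] by blast
  have fD: "f u \<in> vecs ?D" if "u \<in> mspace M" for u
    using f that nD by (auto simp: bilipschitz_embedding_def)
  obtain r where r: "0 < r" "\<And>u v. u \<in> mspace M \<Longrightarrow> v \<in> mspace M \<Longrightarrow>
      r * mdist M u v \<le> nrm ?D (f u - f v) \<and> nrm ?D (f u - f v) \<le> r * C * mdist M u v"
    using f fD nD by (auto simp: bilipschitz_embedding_def mdist_norm_metric)
  (* The map from the dual of S.Z to Y costs the factor 4 in each direction, and the one from Y to X
     another 2 altogether. *)
  have "\<exists>g. bilipschitz_embedding (32 * \<bar>C\<bar>) (submetric M A) (norm_metric X) g"
    if A: "finite A" "A \<subseteq> mspace M" for A
  proof -
    define D where "D = (\<lambda>(u, v). f u - f v) ` (A \<times> A) - {0}"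
    have D: "finite D" "D \<subseteq> vecs ?D" "0 \<notin> D"
      using A fD by (auto simp: D_def intro!: vecs_diff[OF nD])
    obtain J b where J: "finite b" "b \<subseteq> vecs Y" "\<And>\<Psi>. J \<Psi> \<in> span b" "\<And>\<Psi> \<Psi>'. J (\<Psi> - \<Psi>') = J \<Psi> - J \<Psi>'"
      "\<And>\<Psi>. \<Psi> \<in> D \<Longrightarrow> nrm ?D \<Psi> \<le> 4 * nrm Y (J \<Psi>) \<and> nrm Y (J \<Psi>) \<le> 4 * nrm ?D \<Psi>"
      using finite_dual_into_Y[OF D] by metis
    have b: "span b \<subseteq> vecs Y" using J(2) normed_space_subspace[OF nY] by (rule span_minimal)
    obtain T s where s: "0 < s"
      and T_diff: "\<forall>u\<in>span b. \<forall>v\<in>span b. T (u - v) = T u - T v"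
      and T: "\<forall>v\<in>span b. T v \<in> vecs X \<and> nrm Y v \<le> s * nrm X (T v) \<and> s * nrm X (T v) \<le> 2 * nrm Y v"
      using finitely_representable_map[OF nY nX Y(2) J(1) b] by blast
    define g where "g u = T (J (f u))" for u
    have gX: "g u \<in> vecs X" for u unfolding g_def using T J(3) by blast
    have est: "nrm ?D (f u - f v) \<le> 4 * s * nrm X (g u - g v) \<and> s * nrm X (g u - g v) \<le> 8 * nrm ?D (f u - f v)"
      if "u \<in> A" "v \<in> A" for u v
    proof (cases "f u = f v")
      case True
      then show ?thesis using nrm_zero[OF nX] nrm_zero[OF nD] by (simp add: g_def)
    next
      case False
      then have "f u - f v \<in> D" using that by (auto simp: D_def)
      moreover have "g u - g v = T (J (f u - f v))" using T_diff J(3) by (simp add: g_def J(4))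
      moreover have "nrm Y (J (f u - f v)) \<le> s * nrm X (T (J (f u - f v)))"
        "s * nrm X (T (J (f u - f v))) \<le> 2 * nrm Y (J (f u - f v))"
        using T J(3) by blast+
      moreover note J(5)[of "f u - f v"]
      ultimately show ?thesis by auto
    qed
    have "bilipschitz_embedding (32 * \<bar>C\<bar>) (submetric M A) (norm_metric X) g"
      unfolding bilipschitz_embedding_def
    proof (intro conjI exI[of _ "r / (4 * s)"] ballI)
      show "g ` mspace (submetric M A) \<subseteq> mspace (norm_metric X)" using gX nX by auto
      show "0 < r / (4 * s)" using r s by simp
      fix u v assume "u \<in> mspace (submetric M A)" "v \<in> mspace (submetric M A)"
      then have uv: "u \<in> A" "v \<in> A" "u \<in> mspace M" "v \<in> mspace M" using A by auto
      note e = est[OF uv(1,2)] and r' = r(2)[OF uv(3,4)]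
      have dist: "mdist (norm_metric X) (g u) (g v) = nrm X (g u - g v)"
        by (rule mdist_norm_metric[OF nX gX gX])
      have "r * mdist M u v \<le> 4 * s * nrm X (g u - g v)" using e r' by linarith
      then show "r / (4 * s) * mdist (submetric M A) u v \<le> mdist (norm_metric X) (g u) (g v)"
        using s by (simp add: dist field_simps)
      have "r * C * mdist M u v \<le> r * \<bar>C\<bar> * mdist M u v"
        using r(1) by (intro mult_right_mono mult_left_mono) auto
      then have "s * nrm X (g u - g v) \<le> 8 * (r * \<bar>C\<bar> * mdist M u v)" using e r' by linarith
      then show "mdist (norm_metric X) (g u) (g v) \<le> r / (4 * s) * (32 * \<bar>C\<bar>) * mdist (submetric M A) u v"
        using s by (simp add: dist field_simps)
    qed
    then show ?thesis by blast
  qed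
  then show ?thesis by blast
qed

end
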